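(* Let $\mathbb{M}^3$ be one of the 3-dimensional space-forms $\mathbb{R}^3$, $\mathbb{S}^3$, $\mathbb{H}^3$, let $\mathbb{L}(\mathbb{M}^3)$ be its space of oriented geodesics with its canonical neutral metric, and let $S\subset\mathbb{M}^3$ be a smooth strictly convex 2-sphere with tangent hypersurface $\mathcal{H}(S)\subset\mathbb{L}(\mathbb{M}^3)$ and projection $\pi:\mathcal{H}(S)\to S$. Then the distribution of $\alpha$-planes and the distribution of $\beta$-planes on $\mathcal{H}(S)$ are both contact structures. Moreover, a knot $\mathcal{C}\subset\mathcal{H}(S)$ with contact curve $c=\pi(\mathcal{C})\subset S$ is $\alpha$-Legendrian if and only if every $\gamma\in\mathcal{C}$ is tangent to $c\subset S\subset\mathbb{M}^3$ (at the point $\pi(\gamma)$). In addition, for such a knot $\mathcal{C}$ with contact curve $c$, any two of the following imply the third: (i) $\mathcal{C}$ is $\beta$-Legendrian; (ii) every $\gamma\in\mathcal{C}$ is normal to $c$ (at the point $\pi(\gamma)$); (iii) either $c$ is a line of curvature of $S$, or $S$ is umbilic along $c$. Finally, the Reeb vector field of the $\alpha$-planes consists of the oriented lines normal to a geodesic of $S$; that is, along each integral curve $\mathcal{C}$ of the Reeb vector field of the contact form $\omega$ of the $\alpha$-planes (specified in the context), the contact curve $c=\pi(\mathcal{C})$ is a geodesic of $S$, and $\mathcal{C}$ consists of oriented geodesics of $\mathbb{M}^3$ tangent to $S$ along $c$ and orthogonal to $c$.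
   Context: Tangent hypersurface. $\mathcal{H}(S)$ is the set of oriented geodesics of $\mathbb{M}^3$ tangent to $S$. For $S$ strictly convex (principal curvatures $k_1,k_2$ with $k_1k_2>0$) it is an embedded copy of the unit tangent bundle of $S$; $\pi:\mathcal{H}(S)\to S$ sends a tangent geodesic to its point of tangency, and the fibres are the circles obtained by rotation about the normal to $S$. A knot $\mathcal{C}\subset\mathcal{H}(S)$ is an oriented tangent line field over a (regular) curve $c=\pi(\mathcal{C})\subset S$, called its contact curve. A line of curvature is a curve everywhere tangent to a principal direction. Neutral metric, flat case. $\mathbb{L}(\mathbb{R}^3)\equiv T\mathbb{S}^2$: with $\xi$ the standard holomorphic coordinate on $\mathbb{S}^2$ about the north pole, the tangent vector $\eta\,\partial_\xi+\bar\eta\,\partial_{\bar\xi}$ is identified with the oriented line, parameterized by $r\in\mathbb{R}$, $$x^1+ix^2=\frac{2(\eta-\bar{\xi}^2\bar{\eta})}{(1+\xi\bar{\xi})^2}+\frac{2\xi}{1+\xi\bar{\xi}}r,\qquad x^3=-\frac{2(\xi\bar{\eta}+\bar{\xi}\eta)}{(1+\xi\bar{\xi})^2}+\frac{1-\xi\bar{\xi}}{1+\xi\bar{\xi}}r .$$ The canonical neutral metric, invariant under the Euclidean group, is $$\mathbb{G}=2(1+\xi\bar{\xi})^{-2}\,\mathrm{Im}\left(d\bar{\eta}\, d\xi+\frac{2\bar{\xi}\eta}{1+\xi\bar{\xi}}d\xi\, d\bar{\xi}\right),$$ and $\mathbb{J}^+$ is the complex structure for which $(\xi,\eta)$ are holomorphic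 coordinates. Neutral metric, non-flat case. For $\epsilon\in\{1,-1\}$ let $\langle\cdot,\cdot\rangle_\epsilon=\epsilon(dx^1)^2+\epsilon(dx^2)^2+\epsilon(dx^3)^2+(dx^4)^2$ on $\mathbb{R}^4$ and $\mathbb{S}^3_\epsilon=\{x\in\mathbb{R}^4:\langle x,x\rangle_\epsilon=1\}$ (one sheet if $\epsilon=-1$), so $\mathbb{S}^3_1=\mathbb{S}^3$ and $\mathbb{S}^3_{-1}$ is anti-isometric to $\mathbb{H}^3$. Then $\mathbb{L}(\mathbb{S}^3_\epsilon)=\{x\wedge y\in\Lambda^2(\mathbb{R}^4): x\in\mathbb{S}^3_\epsilon,\ y\in T_x\mathbb{S}^3_\epsilon,\ \langle y,y\rangle_\epsilon=\epsilon\}$, where $x\wedge y$ is the oriented geodesic through $x$ with direction $y$. On $\Lambda^2(\mathbb{R}^4)$ put $\langle\langle x_1\wedge y_1,x_2\wedge y_2\rangle\rangle_\epsilon=\langle x_1,x_2\rangle_\epsilon\langle y_1,y_2\rangle_\epsilon-\langle x_1,y_2\rangle_\epsilon\langle y_1,x_2\rangle_\epsilon$. The tangent space $T_{x\wedge y}\mathbb{L}(\mathbb{S}^3_\epsilon)$ consists of $x\wedge X+y\wedge Y$ with $X,Y$ in the plane $(x\wedge y)^\perp_\epsilon=\{\zeta\in\mathbb{R}^4:\langle \zeta,x\rangle_\epsilon=\langle \zeta,y\rangle_\epsilon=0\}$. Let $J'$ be rotation by $\pi/2$ in the oriented plane $(x\wedge y)^\perp_\epsilon$ (the choice of orientation only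 affects the overall sign of $J'$) and define $$\mathbb{J}(x\wedge X+y\wedge Y)=y\wedge X-\epsilon\, x\wedge Y,\qquad \mathbb{J}'(x\wedge X+y\wedge Y)=x\wedge J'X+y\wedge J'Y .$$ The canonical neutral metric is $\mathbb{G}_\epsilon=-\langle\langle\cdot,\mathbb{J}\circ\mathbb{J}'\,\cdot\rangle\rangle_\epsilon$ restricted to $\mathbb{L}(\mathbb{S}^3_\epsilon)$. Null planes. A plane is totally null if the metric vanishes identically on it. $\mathcal{H}(S)$ is a null hypersurface, and at each point its null tangent vectors form exactly two totally null planes, intersecting along the null normal (which is tangent to the fibre of $\pi$). The $\alpha$-plane is the one invariant under $\mathbb{J}^+$ (flat case) or $\mathbb{J}'$ (non-flat case); the $\beta$-plane is the other one (in the non-flat case, it is the one invariant under $\mathbb{J}$). A knot is $\alpha$-Legendrian ($\beta$-Legendrian) if its tangent lies in the $\alpha$-plane ($\beta$-plane) at each point. Reeb vector field. For a contact 1-form $\omega$, the Reeb vector field $X$ is characterised by $d\omega(X,\cdot)=0$, $\omega(X)=1$. The contact form for the $\alpha$-planes is, up to sign, $\omega_\gamma(X)=\langle d\pi(X),v^\perp\rangle$, where $\gamma\in\mathcal{H}(S)$ has unit direction $v\in T_{\pi(\gamma)}S$, $v^\perp$ is $v$ rotated by $\pi/2$ in $T_{\pi(\gamma)}S$, and $\langle\cdot,\cdot\rangle$ is the (positive definite) Riemannian metric of $S\subset\mathbb{M}^3$.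
   Formalization: In the flat case the identification of TS² with oriented lines uses η − ξ²η̄ in x¹+ix² in place of the printed η − ξ̄²η̄, which is a misprint: at ξ = e^{iπ/4} the printed formula sends η = 0 and η = 1−i to the same line. *)

theory Defs
  imports "HOL-Analysis.Analysis"
begin

section \<open>Smooth maps, submanifolds and contact structures\<close>

fun C_on :: "nat \<Rightarrow> ('a::euclidean_space \<Rightarrow> 'b::real_normed_vector) \<Rightarrow> 'a set \<Rightarrow> bool" where
  "C_on 0 f U \<longleftrightarrow> continuous_on U f"
| "C_on (Suc n) f U \<longleftrightarrow> (\<forall>x\<in>U. f differentiable (at x)) \<and>
     (\<forall>v. C_on n (\<lambda>x. frechet_derivative f (at x) v) U)"

text \<open>Meant for open \<open>U\<close> only; on other sets use \<open>smooth_map_on\<close>.\<close>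

definition smooth_on :: "('a::euclidean_space \<Rightarrow> 'b::real_normed_vector) \<Rightarrow> 'a set \<Rightarrow> bool" where
  "smooth_on f U \<longleftrightarrow> (\<forall>n. C_on n f U)"

definition smooth_map_on :: "('a::euclidean_space \<Rightarrow> 'b::real_normed_vector) \<Rightarrow> 'a set \<Rightarrow> bool" where
  "smooth_map_on f N \<longleftrightarrow>
     (\<exists>U g. open U \<and> N \<subseteq> U \<and> smooth_on g U \<and> (\<forall>x\<in>N. g x = f x))"

text \<open>All manifolds below are smooth submanifolds of Euclidean spaces; their tangent vectors are
  the velocities of smooth curves.\<close>

definition tangent_space :: "'a::euclidean_space set \<Rightarrow> 'a \<Rightarrow> 'a set" where
  "tangent_space N p = {w. \<exists>c e. 0 < e \<and> smooth_on c {-e<..<e} \<and> (\<forall>t\<in>{-e<..<e}. c t \<in> N) \<and>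
     c (0::real) = p \<and> (c has_vector_derivative w) (at 0)}"

definition embedded_sphere :: "'a::euclidean_space set \<Rightarrow> bool" where
  "embedded_sphere S \<longleftrightarrow> (\<exists>(f :: real^3 \<Rightarrow> 'a) U. open U \<and> sphere 0 1 \<subseteq> U \<and> smooth_on f U \<and>
     inj_on f (sphere 0 1) \<and>
     (\<forall>p\<in>sphere 0 1. \<forall>v. v \<bullet> p = 0 \<and> v \<noteq> 0 \<longrightarrow> frechet_derivative f (at p) v \<noteq> 0) \<and>
     f ` sphere 0 1 = S)"

definition one_form_on :: "'a::euclidean_space set \<Rightarrow> ('a \<Rightarrow> 'a \<Rightarrow> real) \<Rightarrow> bool" where
  "one_form_on U \<omega> \<longleftrightarrow> (\<forall>P\<in>U. linear (\<omega> P)) \<and> (\<forall>W. smooth_on (\<lambda>P. \<omega> P W) U)"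

definition ext_deriv :: "('a::euclidean_space \<Rightarrow> 'a \<Rightarrow> real) \<Rightarrow> 'a \<Rightarrow> 'a \<Rightarrow> 'a \<Rightarrow> real" where
  "ext_deriv \<omega> P X Y =
     frechet_derivative (\<lambda>Q. \<omega> Q Y) (at P) X - frechet_derivative (\<lambda>Q. \<omega> Q X) (at P) Y"

text \<open>A plane field \<open>\<xi>\<close> on a 3-manifold \<open>N\<close> is a contact structure if it is locally the kernel of a
  1-form \<open>\<omega>\<close> with \<open>\<omega> \<and> d\<omega> \<noteq> 0\<close>. Local forms are given by forms on an open subset of the ambient
  space; restriction to \<open>N\<close> commutes with the exterior derivative.\<close>

definition contact_structure :: "'a::euclidean_space set \<Rightarrow> ('a \<Rightarrow> 'a set) \<Rightarrow> bool" where
  "contact_structure N \<xi> \<longleftrightarrow> (\<forall>P\<in>N. \<exists>U \<omega>. open U \<and> P \<in> U \<and> one_form_on U \<omega> \<and>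
     (\<forall>Q\<in>N \<inter> U. \<xi> Q = {X \<in> tangent_space N Q. \<omega> Q X = 0} \<and>
        (\<exists>X\<in>tangent_space N Q. \<exists>Y\<in>tangent_space N Q. \<exists>Z\<in>tangent_space N Q.
           \<omega> Q X * ext_deriv \<omega> Q Y Z + \<omega> Q Y * ext_deriv \<omega> Q Z X + \<omega> Q Z * ext_deriv \<omega> Q X Y \<noteq> 0)))"

text \<open>Here \<open>\<omega> Q\<close> is only relevant on \<open>tangent_space N Q\<close> for \<open>Q \<in> N\<close>. Its exterior derivative
  is computed from a smooth local extension \<open>\<omega>'\<close>; on \<open>tangent_space N Q\<close> the result does not
  depend on the extension.\<close>

definition reeb_vector ::
    "'a::euclidean_space set \<Rightarrow> ('a \<Rightarrow> 'a \<Rightarrow> real) \<Rightarrow> 'a \<Rightarrow> 'a \<Rightarrow> bool" where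
  "reeb_vector N \<omega> Q X \<longleftrightarrow> X \<in> tangent_space N Q \<and> \<omega> Q X = 1 \<and>
     (\<exists>U \<omega>'. open U \<and> Q \<in> U \<and> one_form_on U \<omega>' \<and>
        (\<forall>P\<in>N \<inter> U. \<forall>W\<in>tangent_space N P. \<omega>' P W = \<omega> P W) \<and>
        (\<forall>Y\<in>tangent_space N Q. ext_deriv \<omega>' Q X Y = 0))"


section \<open>Space forms and their oriented geodesics\<close>

text \<open>
  \<^item> \<open>carrier_set\<close>: the 3-manifold \<open>M\<close>, inside a vector space;
  \<^item> \<open>metric\<close>: a bilinear form on that space restricting to the Riemannian metric of \<open>M\<close>;
  \<^item> \<open>geod x v\<close>: the oriented geodesic through \<open>x\<close> with unit direction \<open>v\<close>;
  \<^item> \<open>neutral \<gamma>\<close>: the neutral metric on the tangent space at \<open>\<gamma>\<close> of the space of oriented geodesics;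
  \<^item> \<open>alpha_cx \<gamma>\<close>: the complex structure there which leaves the \<open>\<alpha>\<close>-planes invariant.
\<close>

record ('m, 'l) space_form =
  carrier_set :: "'m set"
  metric :: "'m \<Rightarrow> 'm \<Rightarrow> real"
  geod :: "'m \<Rightarrow> 'm \<Rightarrow> 'l"
  neutral :: "'l \<Rightarrow> 'l \<Rightarrow> 'l \<Rightarrow> real"
  alpha_cx :: "'l \<Rightarrow> 'l \<Rightarrow> 'l"


subsection \<open>Flat case\<close>

text \<open>An oriented line is the pair (unit direction, point of the line orthogonal to the direction),
  an element of \<open>T S\<^sup>2\<close>. In \<open>line_of\<close> these are the coefficient of \<open>r\<close> and the constant term of the
  parameterization of the line with holomorphic coordinates \<open>(\<xi>, \<eta>)\<close>.\<close>

definition line_dir :: "complex \<Rightarrow> real^3" where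
  "line_dir \<xi> = (let d = 1 + (cmod \<xi>)\<^sup>2; z = 2 * \<xi> / of_real d
     in vector [Re z, Im z, (1 - (cmod \<xi>)\<^sup>2) / d])"

definition line_foot :: "complex \<Rightarrow> complex \<Rightarrow> real^3" where
  "line_foot \<xi> \<eta> = (let d = 1 + (cmod \<xi>)\<^sup>2; z = 2 * (\<eta> - (cnj \<eta>) * \<xi>\<^sup>2) / of_real (d\<^sup>2)
     in vector [Re z, Im z, - 2 * Re (\<xi> * cnj \<eta> + cnj \<xi> * \<eta>) / d\<^sup>2])"

definition line_of :: "complex \<times> complex \<Rightarrow> (real^3) \<times> (real^3)" where
  "line_of = (\<lambda>(\<xi>, \<eta>). (line_dir \<xi>, line_foot \<xi> \<eta>))"

definition line_coords :: "(real^3) \<times> (real^3) \<Rightarrow> complex \<times> complex" where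
  "line_coords \<gamma> = inv line_of \<gamma>"

definition line_dcoords :: "(real^3) \<times> (real^3) \<Rightarrow> (real^3) \<times> (real^3) \<Rightarrow> complex \<times> complex" where
  "line_dcoords \<gamma> W = inv (frechet_derivative line_of (at (line_coords \<gamma>))) W"

text \<open>\<open>(a\<^sub>i, b\<^sub>i)\<close> are the values of \<open>(d\<xi>, d\<eta>)\<close> on the two tangent vectors; products of
  differentials are symmetrized.\<close>

definition coord_neutral ::
    "complex \<times> complex \<Rightarrow> complex \<times> complex \<Rightarrow> complex \<times> complex \<Rightarrow> real" where
  "coord_neutral = (\<lambda>(\<xi>, \<eta>) (a\<^sub>1, b\<^sub>1) (a\<^sub>2, b\<^sub>2). 2 / (1 + (cmod \<xi>)\<^sup>2)\<^sup>2 *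
     Im ((cnj b\<^sub>1 * a\<^sub>2 + cnj b\<^sub>2 * a\<^sub>1) / 2 +
         2 * cnj \<xi> * \<eta> / of_real (1 + (cmod \<xi>)\<^sup>2) * ((a\<^sub>1 * cnj a\<^sub>2 + a\<^sub>2 * cnj a\<^sub>1) / 2)))"

definition chart_neutral ::
    "(real^3) \<times> (real^3) \<Rightarrow> (real^3) \<times> (real^3) \<Rightarrow> (real^3) \<times> (real^3) \<Rightarrow> real" where
  "chart_neutral \<gamma> W\<^sub>1 W\<^sub>2 =
     coord_neutral (line_coords \<gamma>) (line_dcoords \<gamma> W\<^sub>1) (line_dcoords \<gamma> W\<^sub>2)"

definition chart_cx :: "(real^3) \<times> (real^3) \<Rightarrow> (real^3) \<times> (real^3) \<Rightarrow> (real^3) \<times> (real^3)" where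
  "chart_cx \<gamma> W = frechet_derivative line_of (at (line_coords \<gamma>))
     (\<i> * fst (line_dcoords \<gamma> W), \<i> * snd (line_dcoords \<gamma> W))"

text \<open>The chart misses exactly the lines pointing to the south pole. There the two (rotation
  invariant) structures are transported by the rotation by \<open>\<pi>\<close> about the first axis.\<close>

definition half_turn :: "real^3 \<Rightarrow> real^3" where
  "half_turn x = vector [x$1, - (x$2), - (x$3)]"

definition line_half_turn :: "(real^3) \<times> (real^3) \<Rightarrow> (real^3) \<times> (real^3)" where
  "line_half_turn = map_prod half_turn half_turn"

definition flat_neutral ::
    "(real^3) \<times> (real^3) \<Rightarrow> (real^3) \<times> (real^3) \<Rightarrow> (real^3) \<times> (real^3) \<Rightarrow> real" where
  "flat_neutral \<gamma> W\<^sub>1 W\<^sub>2 = (if fst \<gamma> $ 3 \<noteq> - 1 then chart_neutral \<gamma> W\<^sub>1 W\<^sub>2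
     else chart_neutral (line_half_turn \<gamma>) (line_half_turn W\<^sub>1) (line_half_turn W\<^sub>2))"

definition flat_cx :: "(real^3) \<times> (real^3) \<Rightarrow> (real^3) \<times> (real^3) \<Rightarrow> (real^3) \<times> (real^3)" where
  "flat_cx \<gamma> W = (if fst \<gamma> $ 3 \<noteq> - 1 then chart_cx \<gamma> W
     else line_half_turn (chart_cx (line_half_turn \<gamma>) (line_half_turn W)))"

definition flat_space :: "(real^3, (real^3) \<times> (real^3)) space_form" where
  "flat_space = \<lparr>carrier_set = UNIV, metric = inner,
     geod = (\<lambda>x v. (v, x - (x \<bullet> v) *\<^sub>R v)),
     neutral = flat_neutral, alpha_cx = flat_cx\<rparr>"


subsection \<open>Non-flat case\<close>

definition eps_form :: "real \<Rightarrow> real^4 \<Rightarrow> real^4 \<Rightarrow> real" where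
  "eps_form \<epsilon> x y = \<epsilon> * (x$1 * y$1) + \<epsilon> * (x$2 * y$2) + \<epsilon> * (x$3 * y$3) + x$4 * y$4"

definition eps_sphere :: "real \<Rightarrow> (real^4) set" where
  "eps_sphere \<epsilon> = {x. eps_form \<epsilon> x x = 1 \<and> (\<epsilon> = - 1 \<longrightarrow> 0 < x$4)}"

text \<open>Bivectors are antisymmetric matrices.\<close>

definition wedge :: "real^4 \<Rightarrow> real^4 \<Rightarrow> real^4^4" where
  "wedge x y = (\<chi> i j. x$i * y$j - x$j * y$i)"

definition eps_sign :: "real \<Rightarrow> 4 \<Rightarrow> real" where
  "eps_sign \<epsilon> i = (if i = 4 then 1 else \<epsilon>)"

definition eps_form2 :: "real \<Rightarrow> real^4^4 \<Rightarrow> real^4^4 \<Rightarrow> real" where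
  "eps_form2 \<epsilon> A B =
     (\<Sum>i\<in>UNIV. \<Sum>j\<in>UNIV. eps_sign \<epsilon> i * eps_sign \<epsilon> j * (A$i$j) * (B$i$j)) / 2"

lemma eps_form2_wedge:
  "eps_form2 \<epsilon> (wedge x\<^sub>1 y\<^sub>1) (wedge x\<^sub>2 y\<^sub>2) =
     eps_form \<epsilon> x\<^sub>1 x\<^sub>2 * eps_form \<epsilon> y\<^sub>1 y\<^sub>2 - eps_form \<epsilon> x\<^sub>1 y\<^sub>2 * eps_form \<epsilon> y\<^sub>1 x\<^sub>2"
  unfolding eps_form2_def wedge_def eps_sign_def eps_form_def
  by (simp add: sum_4 field_simps)

definition eps_frame :: "real \<Rightarrow> real^4 \<Rightarrow> real^4 \<Rightarrow> bool" where
  "eps_frame \<epsilon> x y \<longleftrightarrow> x \<in> eps_sphere \<epsilon> \<and> eps_form \<epsilon> x y = 0 \<and> eps_form \<epsilon> y y = \<epsilon>"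

definition eps_perp :: "real \<Rightarrow> real^4 \<Rightarrow> real^4 \<Rightarrow> (real^4) set" where
  "eps_perp \<epsilon> x y = {\<zeta>. eps_form \<epsilon> \<zeta> x = 0 \<and> eps_form \<epsilon> \<zeta> y = 0}"

text \<open>Rotation by \<open>\<pi>/2\<close> in \<open>eps_perp \<epsilon> x y\<close>, oriented by the standard orientation of the whole
  space and \<open>x, y\<close>; the form is definite on that plane.\<close>

definition eps_rot :: "real \<Rightarrow> real^4 \<Rightarrow> real^4 \<Rightarrow> real^4 \<Rightarrow> real^4" where
  "eps_rot \<epsilon> x y X = (THE Z. Z \<in> eps_perp \<epsilon> x y \<and> eps_form \<epsilon> Z X = 0 \<and>
     eps_form \<epsilon> Z Z = eps_form \<epsilon> X X \<and> 0 \<le> det (vector [x, y, X, Z] :: real^4^4))"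

definition eps_J :: "real \<Rightarrow> real^4^4 \<Rightarrow> real^4^4 \<Rightarrow> real^4^4" where
  "eps_J \<epsilon> \<gamma> W = (THE W'. \<exists>x y. eps_frame \<epsilon> x y \<and> \<gamma> = wedge x y \<and>
     (\<exists>X\<in>eps_perp \<epsilon> x y. \<exists>Y\<in>eps_perp \<epsilon> x y.
        W = wedge x X + wedge y Y \<and> W' = wedge y X - \<epsilon> *\<^sub>R wedge x Y))"

definition eps_J' :: "real \<Rightarrow> real^4^4 \<Rightarrow> real^4^4 \<Rightarrow> real^4^4" where
  "eps_J' \<epsilon> \<gamma> W = (THE W'. \<exists>x y. eps_frame \<epsilon> x y \<and> \<gamma> = wedge x y \<and>
     (\<exists>X\<in>eps_perp \<epsilon> x y. \<exists>Y\<in>eps_perp \<epsilon> x y.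
        W = wedge x X + wedge y Y \<and> W' = wedge x (eps_rot \<epsilon> x y X) + wedge y (eps_rot \<epsilon> x y Y)))"

text \<open>\<open>\<epsilon> = 1\<close> is the 3-sphere, \<open>\<epsilon> = - 1\<close> hyperbolic 3-space; the factor \<open>\<epsilon>\<close> in the metric makes
  it positive definite on the manifold in both cases.\<close>

definition curved_space :: "real \<Rightarrow> (real^4, real^4^4) space_form" where
  "curved_space \<epsilon> = \<lparr>carrier_set = eps_sphere \<epsilon>, metric = (\<lambda>v w. \<epsilon> * eps_form \<epsilon> v w),
     geod = wedge,
     neutral = (\<lambda>\<gamma> W\<^sub>1 W\<^sub>2. - eps_form2 \<epsilon> W\<^sub>1 (eps_J \<epsilon> \<gamma> (eps_J' \<epsilon> \<gamma> W\<^sub>2))),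
     alpha_cx = eps_J' \<epsilon>\<rparr>"


section \<open>Surfaces in space forms\<close>

text \<open>\<open>\<nu>\<close> is extended smoothly to a neighbourhood of \<open>S\<close>; its derivative along \<open>S\<close> does not depend on
  the extension.\<close>

definition unit_normal_field ::
    "('m::euclidean_space, 'l) space_form \<Rightarrow> 'm set \<Rightarrow> ('m \<Rightarrow> 'm) \<Rightarrow> bool" where
  "unit_normal_field F S \<nu> \<longleftrightarrow> (\<exists>U. open U \<and> S \<subseteq> U \<and> smooth_on \<nu> U) \<and>
     (\<forall>p\<in>S. \<nu> p \<in> tangent_space (carrier_set F) p \<and> metric F (\<nu> p) (\<nu> p) = 1 \<and>
        (\<forall>w\<in>tangent_space S p. metric F (\<nu> p) w = 0))"

text \<open>The derivative in the surrounding vector space agrees with the covariant derivative of \<open>M\<close>: in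
  the non-flat case they differ by a multiple of the position vector \<open>p\<close>, and the component along
  \<open>p\<close> of the derivative of \<open>\<nu>\<close> in a direction tangent to \<open>S\<close> vanishes.\<close>

definition shape_operator :: "('m::euclidean_space \<Rightarrow> 'm) \<Rightarrow> 'm \<Rightarrow> 'm \<Rightarrow> 'm" where
  "shape_operator \<nu> p X = - frechet_derivative \<nu> (at p) X"

definition principal_curvatures ::
    "('m::euclidean_space, 'l) space_form \<Rightarrow> 'm set \<Rightarrow> ('m \<Rightarrow> 'm) \<Rightarrow> 'm \<Rightarrow> real \<Rightarrow> real \<Rightarrow> bool" where
  "principal_curvatures F S \<nu> p k\<^sub>1 k\<^sub>2 \<longleftrightarrow>
     (\<exists>e\<^sub>1\<in>tangent_space S p. \<exists>e\<^sub>2\<in>tangent_space S p.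
        metric F e\<^sub>1 e\<^sub>1 = 1 \<and> metric F e\<^sub>2 e\<^sub>2 = 1 \<and> metric F e\<^sub>1 e\<^sub>2 = 0 \<and>
        shape_operator \<nu> p e\<^sub>1 = k\<^sub>1 *\<^sub>R e\<^sub>1 \<and> shape_operator \<nu> p e\<^sub>2 = k\<^sub>2 *\<^sub>R e\<^sub>2)"

definition strictly_convex :: "('m::euclidean_space, 'l) space_form \<Rightarrow> 'm set \<Rightarrow> bool" where
  "strictly_convex F S \<longleftrightarrow> (\<exists>\<nu>. unit_normal_field F S \<nu> \<and>
     (\<forall>p\<in>S. \<exists>k\<^sub>1 k\<^sub>2. principal_curvatures F S \<nu> p k\<^sub>1 k\<^sub>2 \<and> 0 < k\<^sub>1 * k\<^sub>2))"

definition smooth_strictly_convex_sphere ::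
    "('m::euclidean_space, 'l) space_form \<Rightarrow> 'm set \<Rightarrow> bool" where
  "smooth_strictly_convex_sphere F S \<longleftrightarrow>
     S \<subseteq> carrier_set F \<and> embedded_sphere S \<and> strictly_convex F S"

definition principal_direction ::
    "'m::euclidean_space set \<Rightarrow> ('m \<Rightarrow> 'm) \<Rightarrow> 'm \<Rightarrow> 'm \<Rightarrow> bool" where
  "principal_direction S \<nu> p X \<longleftrightarrow>
     X \<in> tangent_space S p \<and> X \<noteq> 0 \<and> (\<exists>k. shape_operator \<nu> p X = k *\<^sub>R X)"

definition line_of_curvature ::
    "('m::euclidean_space, 'l) space_form \<Rightarrow> 'm set \<Rightarrow> (real \<Rightarrow> 'm) \<Rightarrow> bool" where
  "line_of_curvature F S c \<longleftrightarrow> (\<exists>\<nu>. unit_normal_field F S \<nu> \<and>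
     (\<forall>t. principal_direction S \<nu> (c t) (vector_derivative c (at t))))"

definition umbilic_along ::
    "('m::euclidean_space, 'l) space_form \<Rightarrow> 'm set \<Rightarrow> (real \<Rightarrow> 'm) \<Rightarrow> bool" where
  "umbilic_along F S c \<longleftrightarrow> (\<exists>\<nu>. unit_normal_field F S \<nu> \<and>
     (\<forall>t. \<exists>k. principal_curvatures F S \<nu> (c t) k k))"

text \<open>The covariant derivative of \<open>S\<close> is the component tangent to \<open>S\<close> of the derivative in the
  surrounding vector space.\<close>

definition geodesic_of ::
    "('m::euclidean_space, 'l) space_form \<Rightarrow> 'm set \<Rightarrow> (real \<Rightarrow> 'm) \<Rightarrow> real set \<Rightarrow> bool" where
  "geodesic_of F S c I \<longleftrightarrow> smooth_on c I \<and>
     (\<forall>t\<in>I. c t \<in> S \<and> vector_derivative c (at t) \<noteq> 0 \<and>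
        (\<forall>w\<in>tangent_space S (c t).
           metric F (vector_derivative (\<lambda>s. vector_derivative c (at s)) (at t)) w = 0))"

text \<open>The two choices of such a field are the rotations by \<open>\<pi>/2\<close> of the tangent planes of \<open>S\<close> for
  its two orientations.\<close>

definition quarter_turn ::
    "('m::euclidean_space, 'l) space_form \<Rightarrow> 'm set \<Rightarrow> ('m \<Rightarrow> 'm \<Rightarrow> 'm) \<Rightarrow> bool" where
  "quarter_turn F S R \<longleftrightarrow>
     smooth_map_on (\<lambda>(p, v). R p v) {(p, v). p \<in> S \<and> v \<in> tangent_space S p} \<and>
     (\<forall>p\<in>S. \<forall>v\<in>tangent_space S p. R p v \<in> tangent_space S p \<and>
        metric F (R p v) (R p v) = metric F v v \<and> metric F (R p v) v = 0)"


section \<open>The tangent hypersurface\<close>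

text \<open>Each geodesic tangent to \<open>S\<close> is recorded together with its point of tangency, that is, the
  tangent hypersurface is given as the graph of its projection \<open>\<pi>\<close> to \<open>S\<close>. Hence \<open>\<pi>\<close> is
  \<open>snd\<close>, and \<open>fst\<close> is the inclusion into the space of oriented geodesics, along which the
  neutral metric and the complex structure are pulled back.\<close>

definition tangent_hypersurface ::
    "('m::euclidean_space, 'l::euclidean_space) space_form \<Rightarrow> 'm set \<Rightarrow> ('l \<times> 'm) set" where
  "tangent_hypersurface F S =
     {(\<gamma>, p). p \<in> S \<and> (\<exists>v\<in>tangent_space S p. metric F v v = 1 \<and> \<gamma> = geod F p v)}"

definition direction ::
    "('m::euclidean_space, 'l::euclidean_space) space_form \<Rightarrow> 'm set \<Rightarrow> 'l \<times> 'm \<Rightarrow> 'm" where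
  "direction F S Q =
     (THE v. v \<in> tangent_space S (snd Q) \<and> metric F v v = 1 \<and> fst Q = geod F (snd Q) v)"

definition null_plane ::
    "('m::euclidean_space, 'l::euclidean_space) space_form \<Rightarrow> 'm set \<Rightarrow> 'l \<times> 'm \<Rightarrow> ('l \<times> 'm) set \<Rightarrow> bool"
  where
  "null_plane F S Q E \<longleftrightarrow> subspace E \<and> dim E = 2 \<and>
     E \<subseteq> tangent_space (tangent_hypersurface F S) Q \<and>
     (\<forall>X\<in>E. \<forall>Y\<in>E. neutral F (fst Q) (fst X) (fst Y) = 0)"

definition alpha_plane ::
    "('m::euclidean_space, 'l::euclidean_space) space_form \<Rightarrow> 'm set \<Rightarrow> 'l \<times> 'm \<Rightarrow> ('l \<times> 'm) set" where
  "alpha_plane F S Q =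
     (THE E. null_plane F S Q E \<and> alpha_cx F (fst Q) ` fst ` E \<subseteq> fst ` E)"

definition beta_plane ::
    "('m::euclidean_space, 'l::euclidean_space) space_form \<Rightarrow> 'm set \<Rightarrow> 'l \<times> 'm \<Rightarrow> ('l \<times> 'm) set" where
  "beta_plane F S Q = (THE E. null_plane F S Q E \<and> E \<noteq> alpha_plane F S Q)"

text \<open>A knot is parameterized by the circle \<open>\<real>/\<int>\<close>, embedded, with regular contact curve.\<close>

definition knot ::
    "('m::euclidean_space, 'l::euclidean_space) space_form \<Rightarrow> 'm set \<Rightarrow> (real \<Rightarrow> 'l \<times> 'm) \<Rightarrow> bool" where
  "knot F S C \<longleftrightarrow> smooth_on C UNIV \<and> (\<forall>t. C t \<in> tangent_hypersurface F S) \<and>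
     (\<forall>t. C (t + 1) = C t) \<and> inj_on C {0..<1} \<and>
     (\<forall>t. vector_derivative (snd \<circ> C) (at t) \<noteq> 0)"

definition legendrian :: "('a::euclidean_space \<Rightarrow> 'a set) \<Rightarrow> (real \<Rightarrow> 'a) \<Rightarrow> bool" where
  "legendrian \<xi> C \<longleftrightarrow> (\<forall>t. vector_derivative C (at t) \<in> \<xi> (C t))"

definition tangent_to_contact_curve ::
    "('m::euclidean_space, 'l::euclidean_space) space_form \<Rightarrow> 'm set \<Rightarrow> (real \<Rightarrow> 'l \<times> 'm) \<Rightarrow> bool" where
  "tangent_to_contact_curve F S C \<longleftrightarrow>
     (\<forall>t. vector_derivative (snd \<circ> C) (at t) \<in> span {direction F S (C t)})"

definition normal_to_contact_curve ::
    "('m::euclidean_space, 'l::euclidean_space) space_form \<Rightarrow> 'm set \<Rightarrow> (real \<Rightarrow> 'l \<times> 'm) \<Rightarrow> real set \<Rightarrow> bool"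
  where
  "normal_to_contact_curve F S C I \<longleftrightarrow>
     (\<forall>t\<in>I. metric F (vector_derivative (snd \<circ> C) (at t)) (direction F S (C t)) = 0)"

definition alpha_form ::
    "('m::euclidean_space, 'l::euclidean_space) space_form \<Rightarrow> 'm set \<Rightarrow> ('m \<Rightarrow> 'm \<Rightarrow> 'm) \<Rightarrow>
       'l \<times> 'm \<Rightarrow> 'l \<times> 'm \<Rightarrow> real" where
  "alpha_form F S R Q X = metric F (snd X) (R (snd Q) (direction F S Q))"

definition reeb_integral_curve ::
    "('m::euclidean_space, 'l::euclidean_space) space_form \<Rightarrow> 'm set \<Rightarrow> ('m \<Rightarrow> 'm \<Rightarrow> 'm) \<Rightarrow>
       (real \<Rightarrow> 'l \<times> 'm) \<Rightarrow> real set \<Rightarrow> bool" where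
  "reeb_integral_curve F S R C I \<longleftrightarrow> smooth_on C I \<and>
     (\<forall>t\<in>I. C t \<in> tangent_hypersurface F S \<and>
        reeb_vector (tangent_hypersurface F S) (alpha_form F S R) (C t) (vector_derivative C (at t)))"

end

theory Submission
  imports Defs
begin

text \<open>
The three space forms are treated together. An oriented geodesic tangent to \<open>S\<close> is given by a
point \<open>p\<close> of \<open>S\<close> and a unit vector \<open>v\<close> tangent to \<open>S\<close> at \<open>p\<close>. Let \<open>\<nu>\<close> be the unit normal of \<open>S\<close>,
\<open>A\<close> its shape operator, and complete \<open>v\<close> to an orthonormal frame \<open>v, w, \<nu>\<close>. Differentiating the
relations \<open>\<langle>v, v\<rangle> = 1\<close> and \<open>\<langle>v, \<nu>\<rangle> = 0\<close> shows that a tangent vector of the tangent hypersurface is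
described by

  \<open>dp = a v + b w\<close>, \<open>dv = \<theta> w + h \<nu>\<close> (up to a multiple of \<open>p\<close>), with \<open>h = \<langle>A dp, v\<rangle>\<close>,

where \<open>a, b, \<theta>\<close> are arbitrary. In each of the three models the neutral norm of this vector is a
nonzero multiple of \<open>b h\<close>, so the null vectors form the two planes \<open>b = 0\<close> and \<open>h = 0\<close>. The complex
structure turns the pair \<open>(\<theta>, h)\<close> by a right angle and does the same to the displacement transverse
to the geodesic. It preserves \<open>b = 0\<close>, because convexity makes \<open>h = a \<langle>A v, v\<rangle>\<close> arbitrary on that
plane, and it does not preserve \<open>h = 0\<close>. Hence the \<open>\<alpha>\<close>-plane consists of the vectors with \<open>dp\<close>
parallel to \<open>v\<close>, and the \<open>\<beta>\<close>-plane of those with \<open>dp\<close> conjugate to \<open>v\<close> for the second fundamental form.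

Everything else follows from these descriptions. The form \<open>b = \<langle>dp, w\<rangle>\<close> has differential
\<open>a \<and> \<theta>\<close>, so it is a contact form, and the conditions on its Reeb vector are \<open>a = \<theta> = 0\<close>, \<open>b = 1\<close>:
the direction \<open>v\<close> is parallel along the contact curve, whose velocity is orthogonal to \<open>v\<close>, and so
the contact curve is a geodesic. The form \<open>h\<close> is the restriction of \<open>\<langle>dv, \<nu>\<rangle>\<close>, whose differential
is \<open>\<theta> \<and> \<langle>w, A dp\<rangle>\<close>, and \<open>h \<and> dh \<noteq> 0\<close> because \<open>A\<close> is definite. A knot is \<open>\<beta>\<close>-Legendrian
when \<open>\<langle>A c', v\<rangle> = 0\<close>; combined with \<open>\<langle>c', v\<rangle> = 0\<close> this says that \<open>c'\<close> is an eigenvector of \<open>A\<close>, and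
conversely each of the two orthogonality relations implies the other if \<open>c'\<close> is an eigenvector, the
eigenvalue being nonzero.

The differential of a form defined near a submanifold is computed by pulling it back along smooth
families (\<open>H_family\<close>), with symmetry of second derivatives (\<open>frechet_derivative_commute\<close>) removing
the second order terms. The two models of the space of geodesics enter only through
\<open>curved_neutral_space\<close> and \<open>flat_neutral_space\<close>.
\<close>


section \<open>Calculus of smooth maps\<close>

lemma C_on_cong:
  assumes "open U" "\<And>x. x \<in> U \<Longrightarrow> f x = g x"
  shows "C_on n f U \<longleftrightarrow> C_on n g U"
  using assms
proof (induction n arbitrary: f g)
  case 0
  then show ?case by (auto cong: continuous_on_cong)
next
  case (Suc n)
  have d: "f differentiable at x \<longleftrightarrow> g differentiable at x" if "x \<in> U" for x
    unfolding differentiable_def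
    using has_derivative_transform_within_open[OF _ Suc.prems(1) that, of f _ UNIV g]
      has_derivative_transform_within_open[OF _ Suc.prems(1) that, of g _ UNIV f] Suc.prems(2)
    by metis
  have e: "frechet_derivative f (at x) v = frechet_derivative g (at x) v" if "x \<in> U" for x v
  proof -
    have "(f has_derivative D) (at x) \<longleftrightarrow> (g has_derivative D) (at x)" for D
      using has_derivative_transform_within_open[OF _ Suc.prems(1) that, of f _ UNIV g]
        has_derivative_transform_within_open[OF _ Suc.prems(1) that, of g _ UNIV f] Suc.prems(2)
      by metis
    then show ?thesis unfolding frechet_derivative_def by simp
  qed
  have "C_on n (\<lambda>x. frechet_derivative f (at x) v) U \<longleftrightarrow> C_on n (\<lambda>x. frechet_derivative g (at x) v) U" for v
    by (intro Suc.IH Suc.prems e)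
  with d show ?case by simp
qed

lemma C_on_subset: "C_on n f U \<Longrightarrow> V \<subseteq> U \<Longrightarrow> C_on n f V"
  by (induction n arbitrary: f) (auto intro: continuous_on_subset)

lemma C_on_Suc_imp: "C_on (Suc n) f U \<Longrightarrow> C_on n f U"
proof (induction n arbitrary: f)
  case 0
  then show ?case
    by (auto intro!: continuous_at_imp_continuous_on differentiable_imp_continuous_within)
next
  case (Suc n)
  then show ?case by (metis C_on.simps(2))
qed

lemma C_on_const [intro]: "C_on n (\<lambda>x. c) U"
  by (induction n arbitrary: c) auto

text \<open>The definition of \<open>C_on\<close> speaks of \<open>frechet_derivative\<close>, which can be replaced by any explicitly
known derivative. In this form it drives the inductions on the order that prove the closure properties.\<close>

lemma C_on_SucI:
  assumes U: "open U" and d: "\<And>x. x \<in> U \<Longrightarrow> (f has_derivative f' x) (at x)"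
    and c: "\<And>v. C_on n (\<lambda>x. f' x v) U"
  shows "C_on (Suc n) f U"
proof -
  have e: "frechet_derivative f (at x) = f' x" if "x \<in> U" for x
    using d[OF that] by (metis frechet_derivative_at)
  have "C_on n (\<lambda>x. frechet_derivative f (at x) v) U" for v
    using c[of v] C_on_cong[OF U, of "\<lambda>x. frechet_derivative f (at x) v" "\<lambda>x. f' x v" n] e by simp
  then show ?thesis using d by (auto simp: differentiable_def)
qed

lemma C_on_derivD:
  assumes "C_on (Suc n) f U" "x \<in> U"
  shows "(f has_derivative frechet_derivative f (at x)) (at x)"
  using assms by (auto simp: frechet_derivative_works[symmetric])

lemma C_on_add:
  assumes "open U" "C_on n f U" "C_on n g U"
  shows "C_on n (\<lambda>x. f x + g x) U"
  using assms(2,3)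
proof (induction n arbitrary: f g)
  case 0 then show ?case by (auto intro: continuous_intros)
next
  case (Suc n)
  show ?case
    by (rule C_on_SucI[OF assms(1) has_derivative_add[OF C_on_derivD[OF Suc.prems(1)] C_on_derivD[OF Suc.prems(2)]]])
      (use Suc in auto)
qed

lemma C_on_linear:
  assumes "open U" "bounded_linear L" "C_on n f U"
  shows "C_on n (\<lambda>x. L (f x)) U"
  using assms(3)
proof (induction n arbitrary: f)
  case 0 then show ?case by (auto intro: bounded_linear.continuous_on[OF assms(2)])
next
  case (Suc n)
  show ?case
    by (rule C_on_SucI[OF assms(1) bounded_linear.has_derivative[OF assms(2) C_on_derivD[OF Suc.prems(1)]]])
      (use Suc in auto)
qed

lemma C_on_bilinear:
  assumes "open U" "bounded_bilinear B" "C_on n f U" "C_on n g U"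
  shows "C_on n (\<lambda>x. B (f x) (g x)) U"
  using assms(3,4)
proof (induction n arbitrary: f g)
  case 0 then show ?case by (auto intro: bounded_bilinear.continuous_on[OF assms(2)])
next
  case (Suc n)
  show ?case
    by (rule C_on_SucI[OF assms(1) bounded_bilinear.FDERIV[OF assms(2) C_on_derivD[OF Suc.prems(1)] C_on_derivD[OF Suc.prems(2)]]])
      (use Suc C_on_Suc_imp[OF Suc.prems(1)] C_on_Suc_imp[OF Suc.prems(2)] in \<open>auto intro!: C_on_add assms(1)\<close>)
qed

lemma C_on_sum:
  assumes "open U" "\<And>i. i \<in> I \<Longrightarrow> C_on n (f i) U"
  shows "C_on n (\<lambda>x. \<Sum>i\<in>I. f i x) U"
  using assms(2) by (induction I rule: infinite_finite_induct) (auto intro: C_on_add[OF assms(1)])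

text \<open>By the chain rule, a directional derivative of \<open>f \<circ> g\<close> is a sum over the basis of products of
partial derivatives of \<open>f\<close>, composed with \<open>g\<close>, and components of the derivative of \<open>g\<close>; the
induction hypothesis applies to the former since it is stated for every \<open>f\<close>.\<close>

lemma C_on_compose:
  fixes f :: "'b::euclidean_space \<Rightarrow> 'c::real_normed_vector" and g :: "'a::euclidean_space \<Rightarrow> 'b"
  assumes "open U" "open V" "g ` U \<subseteq> V" "C_on n f V" "C_on n g U"
  shows "C_on n (\<lambda>x. f (g x)) U"
  using assms(4,5)
proof (induction n arbitrary: f)
  case 0 then show ?case using assms(3) by (auto intro: continuous_on_compose2)
next
  case (Suc n)
  have g: "C_on n g U" by (rule C_on_Suc_imp[OF Suc.prems(2)])
  have gV: "g x \<in> V" if "x \<in> U" for x using that assms(3) by auto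
  have d: "((\<lambda>x. f (g x)) has_derivative
      (\<lambda>v. \<Sum>i\<in>Basis. (frechet_derivative g (at x) v \<bullet> i) *\<^sub>R frechet_derivative f (at (g x)) i)) (at x)"
    if x: "x \<in> U" for x
  proof -
    let ?f = "frechet_derivative f (at (g x))" and ?g = "frechet_derivative g (at x)"
    have f: "(f has_derivative ?f) (at (g x))" using C_on_derivD[OF Suc.prems(1) gV[OF x]] .
    then interpret linear ?f by (rule has_derivative_linear)
    have "?f (?g v) = (\<Sum>i\<in>Basis. (?g v \<bullet> i) *\<^sub>R ?f i)" for v
      by (subst euclidean_representation[of "?g v", symmetric]) (simp add: sum scale)
    then show ?thesis
      using diff_chain_at[OF C_on_derivD[OF Suc.prems(2) x] f] by (simp add: o_def)
  qed
  have 1: "C_on n (\<lambda>x. (\<lambda>y. frechet_derivative f (at y) i) (g x)) U" for i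
    by (rule Suc.IH[OF _ g]) (use Suc.prems(1) in simp)
  have 2: "C_on n (\<lambda>x. (frechet_derivative g (at x) v \<bullet> i)) U" for i v
    by (rule C_on_linear[OF assms(1) bounded_linear_inner_left]) (use Suc.prems(2) in simp)
  show ?case
    by (rule C_on_SucI[OF assms(1) d])
      (auto intro!: C_on_sum[OF assms(1)] C_on_bilinear[OF assms(1) bounded_bilinear_scaleR] 1 2)
qed

lemma C_on_ident: "open U \<Longrightarrow> C_on n (\<lambda>x. x) U"
proof (cases n)
  case (Suc m)
  assume "open U"
  then show ?thesis unfolding Suc by (rule C_on_SucI[OF _ has_derivative_ident]) auto
qed auto

lemma smooth_on_cong:
  "open U \<Longrightarrow> (\<And>x. x \<in> U \<Longrightarrow> f x = g x) \<Longrightarrow> smooth_on f U \<longleftrightarrow> smooth_on g U"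
  unfolding smooth_on_def using C_on_cong by blast

lemma smooth_on_subset: "smooth_on f U \<Longrightarrow> V \<subseteq> U \<Longrightarrow> smooth_on f V"
  unfolding smooth_on_def using C_on_subset by blast

lemma smooth_on_const: "smooth_on (\<lambda>x. c) U"
  unfolding smooth_on_def by auto

lemma smooth_on_ident: "open U \<Longrightarrow> smooth_on (\<lambda>x. x) U"
  unfolding smooth_on_def by (auto intro: C_on_ident)

lemma smooth_on_add: "open U \<Longrightarrow> smooth_on f U \<Longrightarrow> smooth_on g U \<Longrightarrow> smooth_on (\<lambda>x. f x + g x) U"
  unfolding smooth_on_def by (auto intro: C_on_add)

lemma smooth_on_linear:
  "open U \<Longrightarrow> bounded_linear L \<Longrightarrow> smooth_on f U \<Longrightarrow> smooth_on (\<lambda>x. L (f x)) U"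
  unfolding smooth_on_def by (auto intro: C_on_linear)

lemma smooth_on_bilinear:
  "open U \<Longrightarrow> bounded_bilinear B \<Longrightarrow> smooth_on f U \<Longrightarrow> smooth_on g U \<Longrightarrow>
    smooth_on (\<lambda>x. B (f x) (g x)) U"
  unfolding smooth_on_def by (auto intro: C_on_bilinear)

lemma smooth_on_compose:
  fixes f :: "'b::euclidean_space \<Rightarrow> 'c::real_normed_vector" and g :: "'a::euclidean_space \<Rightarrow> 'b"
  shows "open U \<Longrightarrow> open V \<Longrightarrow> g ` U \<subseteq> V \<Longrightarrow> smooth_on f V \<Longrightarrow> smooth_on g U \<Longrightarrow>
    smooth_on (\<lambda>x. f (g x)) U"
  unfolding smooth_on_def by (auto intro: C_on_compose)

lemma smooth_on_Pair:
  assumes "open U" "smooth_on f U" "smooth_on g U"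
  shows "smooth_on (\<lambda>x. (f x, g x)) U"
proof -
  have "smooth_on (\<lambda>x. (f x, 0) + (0, g x)) U"
    by (intro smooth_on_add smooth_on_linear[OF _ _ assms(2)] smooth_on_linear[OF _ _ assms(3)] assms(1)
        bounded_linear_Pair bounded_linear_ident bounded_linear_zero)
  then show ?thesis by simp
qed

lemma smooth_on_minus: "open U \<Longrightarrow> smooth_on f U \<Longrightarrow> smooth_on (\<lambda>x. - f x) U"
  by (rule smooth_on_linear[OF _ bounded_linear_minus[OF bounded_linear_ident]])

lemma smooth_on_diff: "open U \<Longrightarrow> smooth_on f U \<Longrightarrow> smooth_on g U \<Longrightarrow> smooth_on (\<lambda>x. f x - g x) U"
  using smooth_on_add[OF _ _ smooth_on_minus, of U f g] by simp

lemmas smooth_on_scaleR = smooth_on_bilinear[OF _ bounded_bilinear_scaleR]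
lemmas smooth_on_fst = smooth_on_linear[OF _ bounded_linear_fst]
lemmas smooth_on_snd = smooth_on_linear[OF _ bounded_linear_snd]

lemma smooth_on_has_derivative:
  "smooth_on f U \<Longrightarrow> x \<in> U \<Longrightarrow> (f has_derivative frechet_derivative f (at x)) (at x)"
  unfolding smooth_on_def using C_on_derivD by blast

lemma smooth_on_frechet_derivative:
  "smooth_on f U \<Longrightarrow> smooth_on (\<lambda>x. frechet_derivative f (at x) v) U"
  unfolding smooth_on_def by (metis C_on.simps(2))

lemma smooth_on_imp_continuous_on: "smooth_on f U \<Longrightarrow> continuous_on U f"
  unfolding smooth_on_def by (metis C_on.simps(1))

lemma frechet_derivative_eq: "(f has_derivative f') (at x) \<Longrightarrow> frechet_derivative f (at x) = f'"
  by (metis frechet_derivative_at)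

lemma smooth_on_has_vector_derivative:
  fixes f :: "real \<Rightarrow> 'b::real_normed_vector"
  assumes "smooth_on f U" "x \<in> U"
  shows "(f has_vector_derivative vector_derivative f (at x)) (at x)"
  using smooth_on_has_derivative[OF assms]
  by (meson differentiableI has_derivative_imp_has_field_derivative vector_derivative_works differentiable_def)

lemma smooth_on_vector_derivative:
  fixes f :: "real \<Rightarrow> 'b::real_normed_vector"
  assumes "open U" "smooth_on f U"
  shows "smooth_on (\<lambda>x. vector_derivative f (at x)) U"
proof -
  have e: "frechet_derivative f (at x) 1 = vector_derivative f (at x)" if "x \<in> U" for x
    using frechet_derivative_eq[OF smooth_on_has_vector_derivative[OF assms(2) that, unfolded has_vector_derivative_def]]
    by simp
  show ?thesis
    by (rule smooth_on_cong[THEN iffD1, OF assms(1) e smooth_on_frechet_derivative[OF assms(2), of 1]])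
qed

text \<open>Source of the smoothness of normalisation: the derivative of a power is again a multiple of a power.\<close>

lemma smooth_on_powr: "smooth_on (\<lambda>x::real. x powr a) {0<..}"
proof -
  have "C_on n (\<lambda>x::real. x powr a) {0<..}" for n
  proof (induction n arbitrary: a)
    case 0
    then show ?case by (auto intro!: continuous_intros)
  next
    case (Suc n)
    show ?case
    proof (rule C_on_SucI)
      show "((\<lambda>x::real. x powr a) has_derivative (\<lambda>v. v * (a * x powr (a - 1)))) (at x)" if "x \<in> {0<..}" for x
        using that by (auto intro!: derivative_eq_intros simp: powr_diff fun_eq_iff)
      show "C_on n (\<lambda>x. v * (a * x powr (a - 1))) {0<..}" for v
        by (rule C_on_linear[OF _ bounded_linear_mult_right] | rule Suc.IH open_greaterThan)+
    qed simp
  qed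
  then show ?thesis by (simp add: smooth_on_def)
qed

text \<open>The mean value theorem applied in each variable in turn. The left-hand side is symmetric in the two
variables, which is what makes mixed second derivatives agree.\<close>

lemma second_difference_mean_value:
  fixes g g1 g12 :: "real \<Rightarrow> real \<Rightarrow> real"
  assumes h: "0 < h"
    and g1: "\<And>s t. s \<in> {0..h} \<Longrightarrow> t \<in> {0..h} \<Longrightarrow> ((\<lambda>s. g s t) has_field_derivative g1 s t) (at s)"
    and g12: "\<And>s t. s \<in> {0..h} \<Longrightarrow> t \<in> {0..h} \<Longrightarrow> ((\<lambda>t. g1 s t) has_field_derivative g12 s t) (at t)"
  shows "\<exists>s\<in>{0..h}. \<exists>t\<in>{0..h}. g h h - g h 0 - g 0 h + g 0 0 = h * h * g12 s t"
proof -
  obtain s where s: "0 < s" "s < h" and 1: "(g h h - g h 0) - (g 0 h - g 0 0) = (h - 0) * (g1 s h - g1 s 0)"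
    using MVT2[of 0 h "\<lambda>s. g s h - g s 0" "\<lambda>s. g1 s h - g1 s 0"] h g1
    by (force intro!: DERIV_diff)
  obtain t where t: "0 < t" "t < h" and 2: "g1 s h - g1 s 0 = (h - 0) * g12 s t"
    using MVT2[of 0 h "g1 s" "g12 s"] h s g12 by force
  show ?thesis
    using s t 1 2 by (intro bexI[of _ s] bexI[of _ t]) (auto simp: algebra_simps)
qed


lemma smooth_on_mixed_derivative_line:
  fixes f :: "'a::euclidean_space \<Rightarrow> 'b::euclidean_space"
  assumes "smooth_on f U" "a + s *\<^sub>R u \<in> U"
  shows "((\<lambda>s. f (a + s *\<^sub>R u) \<bullet> b) has_field_derivative frechet_derivative f (at (a + s *\<^sub>R u)) u \<bullet> b) (at s)"
proof -
  have 1: "((\<lambda>s. a + s *\<^sub>R u) has_derivative (\<lambda>h. h *\<^sub>R u)) (at s)"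
    by (auto intro!: derivative_eq_intros)
  note f = smooth_on_has_derivative[OF assms]
  have "((\<lambda>s. f (a + s *\<^sub>R u) \<bullet> b) has_derivative
      (\<lambda>h. frechet_derivative f (at (a + s *\<^sub>R u)) (h *\<^sub>R u) \<bullet> b)) (at s)"
    using has_derivative_inner_left[OF diff_chain_at[OF 1 f]] by (simp add: o_def)
  then show ?thesis
    unfolding has_field_derivative_def
    by (rule has_derivative_eq_rhs)
      (use linear_cmul[OF has_derivative_linear[OF f]] in \<open>auto simp: fun_eq_iff\<close>)
qed

text \<open>Symmetry of second derivatives. Near \<open>z\<close>, the second difference over a small parallelogram is
\<open>h\<^sup>2\<close> times a value of either mixed derivative, and both mixed derivatives are continuous.\<close>

theorem frechet_derivative_commute:
  fixes f :: "'a::euclidean_space \<Rightarrow> 'b::euclidean_space"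
  assumes U: "open U" and f: "smooth_on f U" and z: "z \<in> U"
  shows "frechet_derivative (\<lambda>x. frechet_derivative f (at x) u) (at z) v
       = frechet_derivative (\<lambda>x. frechet_derivative f (at x) v) (at z) u"
proof (rule euclidean_eqI)
  fix b :: 'b
  define d where "d u v x = frechet_derivative (\<lambda>x. frechet_derivative f (at x) u) (at x) v \<bullet> b" for u v x
  have cont: "continuous_on U (d u v)" for u v
    unfolding d_def
    by (intro continuous_intros smooth_on_imp_continuous_on smooth_on_frechet_derivative f)
  have "d u v z = d v u z"
  proof (rule ccontr)
    assume ne: "d u v z \<noteq> d v u z"
    define e where "e = \<bar>d u v z - d v u z\<bar> / 2"
    have "e > 0" using ne by (simp add: e_def)
    have ev: "\<forall>\<^sub>F x in nhds z. x \<in> U \<and> dist (d u v x) (d u v z) < e \<and> dist (d v u x) (d v u z) < e"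
      using cont[of u v] cont[of v u] U z \<open>e > 0\<close>
      by (auto intro!: eventually_conj eventually_nhds_in_open tendstoD
          simp: continuous_on_eq_continuous_at isCont_def tendsto_at_iff_tendsto_nhds)
    then obtain r where r: "r > 0" and
      R: "\<And>x. dist x z < r \<Longrightarrow> x \<in> U \<and> dist (d u v x) (d u v z) < e \<and> dist (d v u x) (d v u z) < e"
      unfolding eventually_nhds_metric by blast
    \<comment> \<open>the parallelogram spanned by \<open>h u\<close> and \<open>h v\<close> at \<open>z\<close> stays within distance \<open>r\<close>\<close>
    define h where "h = r / (2 * (norm u + norm v + 1))"
    have h: "0 < h" using r by (simp add: h_def add_nonneg_pos)
    have hr: "h * (norm u + norm v) < r"
    proof -
      have "h * (norm u + norm v) \<le> h * (norm u + norm v + 1)" using h by simp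
      also have "\<dots> = r / 2"
        using add_nonneg_pos[of "norm u + norm v" 1] by (simp add: h_def field_simps)
      finally show ?thesis using r by simp
    qed
    have near: "dist (z + s *\<^sub>R u + t *\<^sub>R v) z < r" if "s \<in> {0..h}" "t \<in> {0..h}" for s t
    proof -
      have "norm (s *\<^sub>R u + t *\<^sub>R v) \<le> s * norm u + t * norm v"
        using norm_triangle_ineq[of "s *\<^sub>R u" "t *\<^sub>R v"] that by simp
      also have "\<dots> \<le> h * norm u + h * norm v"
        using that by (intro add_mono mult_right_mono) auto
      finally show ?thesis using hr by (simp add: dist_norm algebra_simps)
    qed
    note near' = near[THEN R, THEN conjunct1]
    have 1: "\<exists>s\<in>{0..h}. \<exists>t\<in>{0..h}. f (z + h *\<^sub>R u + h *\<^sub>R v) \<bullet> b - f (z + h *\<^sub>R u + 0 *\<^sub>R v) \<bullet> b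
        - f (z + 0 *\<^sub>R u + h *\<^sub>R v) \<bullet> b + f (z + 0 *\<^sub>R u + 0 *\<^sub>R v) \<bullet> b = h * h * d u v (z + s *\<^sub>R u + t *\<^sub>R v)"
    proof (rule second_difference_mean_value[OF h])
      show "((\<lambda>s. f (z + s *\<^sub>R u + t *\<^sub>R v) \<bullet> b) has_field_derivative
          frechet_derivative f (at (z + s *\<^sub>R u + t *\<^sub>R v)) u \<bullet> b) (at s)"
        if "s \<in> {0..h}" "t \<in> {0..h}" for s t
        using smooth_on_mixed_derivative_line[OF f, of "z + t *\<^sub>R v" s u b] near'[OF that] by (simp add: ac_simps)
      show "((\<lambda>t. frechet_derivative f (at (z + s *\<^sub>R u + t *\<^sub>R v)) u \<bullet> b) has_field_derivative
          d u v (z + s *\<^sub>R u + t *\<^sub>R v)) (at t)"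
        if "s \<in> {0..h}" "t \<in> {0..h}" for s t
        using smooth_on_mixed_derivative_line[OF smooth_on_frechet_derivative[OF f], of "z + s *\<^sub>R u" t v u b] near'[OF that]
        by (simp add: d_def)
    qed
    have 2: "\<exists>t\<in>{0..h}. \<exists>s\<in>{0..h}. f (z + h *\<^sub>R u + h *\<^sub>R v) \<bullet> b - f (z + 0 *\<^sub>R u + h *\<^sub>R v) \<bullet> b
        - f (z + h *\<^sub>R u + 0 *\<^sub>R v) \<bullet> b + f (z + 0 *\<^sub>R u + 0 *\<^sub>R v) \<bullet> b = h * h * d v u (z + s *\<^sub>R u + t *\<^sub>R v)"
    proof (rule second_difference_mean_value[OF h, of "\<lambda>t s. f (z + s *\<^sub>R u + t *\<^sub>R v) \<bullet> b"])
      show "((\<lambda>t. f (z + s *\<^sub>R u + t *\<^sub>R v) \<bullet> b) has_field_derivative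
          frechet_derivative f (at (z + s *\<^sub>R u + t *\<^sub>R v)) v \<bullet> b) (at t)"
        if "t \<in> {0..h}" "s \<in> {0..h}" for s t
        using smooth_on_mixed_derivative_line[OF f, of "z + s *\<^sub>R u" t v b] near'[OF that(2,1)] by simp
      show "((\<lambda>s. frechet_derivative f (at (z + s *\<^sub>R u + t *\<^sub>R v)) v \<bullet> b) has_field_derivative
          d v u (z + s *\<^sub>R u + t *\<^sub>R v)) (at s)"
        if "t \<in> {0..h}" "s \<in> {0..h}" for s t
        using smooth_on_mixed_derivative_line[OF smooth_on_frechet_derivative[OF f], of "z + t *\<^sub>R v" s u v b] near'[OF that(2,1)]
        by (simp add: d_def ac_simps)
    qed
    from 1 obtain s t where st: "s \<in> {0..h}" "t \<in> {0..h}"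
      and s: "f (z + h *\<^sub>R u + h *\<^sub>R v) \<bullet> b - f (z + h *\<^sub>R u + 0 *\<^sub>R v) \<bullet> b
        - f (z + 0 *\<^sub>R u + h *\<^sub>R v) \<bullet> b + f (z + 0 *\<^sub>R u + 0 *\<^sub>R v) \<bullet> b = h * h * d u v (z + s *\<^sub>R u + t *\<^sub>R v)"
      by blast
    from 2 obtain s' t' where st': "s' \<in> {0..h}" "t' \<in> {0..h}"
      and s': "f (z + h *\<^sub>R u + h *\<^sub>R v) \<bullet> b - f (z + 0 *\<^sub>R u + h *\<^sub>R v) \<bullet> b
        - f (z + h *\<^sub>R u + 0 *\<^sub>R v) \<bullet> b + f (z + 0 *\<^sub>R u + 0 *\<^sub>R v) \<bullet> b = h * h * d v u (z + s' *\<^sub>R u + t' *\<^sub>R v)"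
      by blast
    from s s' have "h * h * d u v (z + s *\<^sub>R u + t *\<^sub>R v) = h * h * d v u (z + s' *\<^sub>R u + t' *\<^sub>R v)"
      by linarith
    then have "d u v (z + s *\<^sub>R u + t *\<^sub>R v) = d v u (z + s' *\<^sub>R u + t' *\<^sub>R v)"
      using h by simp
    moreover have "dist (d u v (z + s *\<^sub>R u + t *\<^sub>R v)) (d u v z) < e"
      "dist (d v u (z + s' *\<^sub>R u + t' *\<^sub>R v)) (d v u z) < e"
      using R[OF near[OF st]] R[OF near[OF st']] by auto
    ultimately show False by (simp add: e_def dist_real_def abs_if split: if_splits)
  qed
  then show "frechet_derivative (\<lambda>x. frechet_derivative f (at x) u) (at z) v \<bullet> b
       = frechet_derivative (\<lambda>x. frechet_derivative f (at x) v) (at z) u \<bullet> b"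
    by (simp add: d_def)
qed

section \<open>Normalisation and tangent vectors\<close>

text \<open>The bilinear form \<open>B\<close> need not be definite on the whole space: in the hyperbolic case it is positive
only on some vectors, and \<open>m\<close> is assumed to be one of them wherever it matters.\<close>

definition normalise :: "('a::real_vector \<Rightarrow> 'a \<Rightarrow> real) \<Rightarrow> 'a \<Rightarrow> 'a" where
  "normalise B m = (B m m) powr (- (1/2)) *\<^sub>R m"

lemma normalise_unit:
  assumes "bounded_bilinear B" "0 < B m m"
  shows "B (normalise B m) (normalise B m) = 1"
proof -
  interpret bounded_bilinear B by fact
  have "B m m powr (- (1/2)) * B m m powr (- (1/2)) = B m m powr (- 1)"
    by (simp only: powr_add[symmetric]) simp
  then have "B m m powr (- (1/2)) * B m m powr (- (1/2)) * B m m = 1"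
    using assms(2) by (simp only: powr_minus) simp
  then show ?thesis by (simp add: normalise_def scaleR_left scaleR_right mult.assoc)
qed

lemma normalise_of_unit: "B m m = 1 \<Longrightarrow> normalise B m = m"
  by (simp add: normalise_def)

lemma smooth_on_normalise:
  fixes m :: "'a::euclidean_space \<Rightarrow> 'b::euclidean_space"
  assumes "bounded_bilinear B" "open U" "smooth_on m U" "\<And>x. x \<in> U \<Longrightarrow> 0 < B (m x) (m x)"
  shows "smooth_on (\<lambda>x. normalise B (m x)) U"
proof -
  have "smooth_on (\<lambda>x. B (m x) (m x)) U"
    by (rule smooth_on_bilinear[OF assms(2,1,3,3)])
  then have "smooth_on (\<lambda>x. B (m x) (m x) powr (- (1/2))) U"
    by (rule smooth_on_compose[OF assms(2) open_greaterThan _ smooth_on_powr, rotated]) (use assms(4) in auto)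
  from smooth_on_scaleR[OF assms(2) this assms(3)] show ?thesis
    unfolding normalise_def .
qed

text \<open>The derivative at a unit vector is the projection onto its orthogonal complement, since the derivative
of \<open>r \<mapsto> r\<^sup>-\<^sup>1\<^sup>/\<^sup>2\<close> at \<open>1\<close> is \<open>-1/2\<close> and that of \<open>B m m\<close> is \<open>2 B m m'\<close>.\<close>

lemma has_derivative_normalise:
  assumes B: "bounded_bilinear B" "\<And>x y. B x y = B y x"
    and m: "(m has_derivative m') (at x)" and unit: "B (m x) (m x) = 1"
  shows "((\<lambda>z. normalise B (m z)) has_derivative (\<lambda>h. m' h - B (m x) (m' h) *\<^sub>R m x)) (at x)"
proof -
  interpret bounded_bilinear B by fact
  have N: "((\<lambda>z. B (m z) (m z)) has_derivative (\<lambda>h. 2 * B (m x) (m' h))) (at x)"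
    by (rule has_derivative_eq_rhs[OF FDERIV[OF m m]]) (simp add: B(2)[of "m' _"])
  have "((\<lambda>r::real. r powr (- (1/2))) has_derivative (\<lambda>d. d * (-1/2))) (at (B (m x) (m x)))"
    using unit by (auto intro!: derivative_eq_intros)
  from diff_chain_at[OF N this]
  have "((\<lambda>z. (B (m z) (m z)) powr (- (1/2))) has_derivative (\<lambda>h. - B (m x) (m' h))) (at x)"
    by (simp add: o_def)
  from has_derivative_scaleR[OF this m] show ?thesis
    unfolding normalise_def by (rule has_derivative_eq_rhs) (simp add: unit fun_eq_iff)
qed

lemma has_vector_derivative_const_near:
  assumes "(g has_vector_derivative d) (at (0::real))" "0 < e" "\<And>t. t \<in> {-e<..<e} \<Longrightarrow> g t = c"
  shows "d = 0"
proof -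
  have "((\<lambda>t. c) has_vector_derivative d) (at 0)"
    using has_vector_derivative_transform_within_open[OF assms(1), of "{-e<..<e}" "\<lambda>t. c"] assms by auto
  then show ?thesis using vector_derivative_unique_at by (metis has_vector_derivative_const)
qed

lemma tangent_space_mono: "N \<subseteq> N' \<Longrightarrow> tangent_space N p \<subseteq> tangent_space N' p"
  unfolding tangent_space_def by blast

lemma has_derivative_imp_vector_derivative:
  assumes "(f has_derivative f') (at (c t))" "(c has_vector_derivative d) (at t)"
  shows "((\<lambda>s. f (c s)) has_vector_derivative f' d) (at t)"
  using vector_derivative_diff_chain_within[of c d t UNIV f f'] assms
  by (auto simp: o_def intro: has_derivative_at_withinI)

text \<open>Tangent vectors are produced by following a smooth map into \<open>N\<close> along a straight line of its domain.\<close>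

lemma tangent_space_of_family:
  fixes \<Phi> :: "'a::euclidean_space \<Rightarrow> 'b::euclidean_space"
  assumes "open Z" "z\<^sub>0 \<in> Z" "smooth_on \<Phi> Z" "\<Phi> ` Z \<subseteq> N"
  shows "frechet_derivative \<Phi> (at z\<^sub>0) z \<in> tangent_space N (\<Phi> z\<^sub>0)"
proof -
  let ?c = "\<lambda>t. z\<^sub>0 + t *\<^sub>R z"
  have c: "(?c has_vector_derivative z) (at (0::real))"
    by (auto intro!: derivative_eq_intros)
  have "open (?c -` Z)" "0 \<in> ?c -` Z"
    using assms(2) by (auto intro!: open_vimage assms(1) continuous_intros)
  then obtain e where e: "0 < e" and ball: "ball (0::real) e \<subseteq> ?c -` Z"
    by (meson openE)
  then have Z: "?c t \<in> Z" if "t \<in> {-e<..<e}" for t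
    using that by (auto simp: subset_iff dist_real_def abs_less_iff)
  have I: "open {-e<..<e}" by simp
  show ?thesis unfolding tangent_space_def
  proof (intro CollectI exI conjI)
    show "smooth_on (\<lambda>t. \<Phi> (?c t)) {-e<..<e}"
      by (rule smooth_on_compose[OF I assms(1) _ assms(3) smooth_on_add[OF I smooth_on_const
            smooth_on_linear[OF I bounded_linear_scaleR_left smooth_on_ident[OF I]]]])
        (use Z in auto)
    show "((\<lambda>t. \<Phi> (?c t)) has_vector_derivative frechet_derivative \<Phi> (at z\<^sub>0) z) (at 0)"
      by (rule has_derivative_imp_vector_derivative[OF _ c])
        (use smooth_on_has_derivative[OF assms(3,2)] in simp)
    show "\<forall>t\<in>{-e<..<e}. \<Phi> (?c t) \<in> N"
      using Z assms(4) by blast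
  qed (use e in auto)
qed

lemma tangent_space_curve:
  fixes C :: "real \<Rightarrow> 'b::euclidean_space"
  assumes "open I" "t \<in> I" "smooth_on C I" "C ` I \<subseteq> N"
  shows "vector_derivative C (at t) \<in> tangent_space N (C t)"
  using tangent_space_of_family[OF assms, of 1]
    frechet_derivative_eq[OF smooth_on_has_vector_derivative[OF assms(3,2), unfolded has_vector_derivative_def]]
  by simp

text \<open>Relations holding along a submanifold may be differentiated in its tangent directions.\<close>

lemma derivative_zero_of_constant:
  assumes \<phi>: "(\<phi> has_derivative \<phi>') (at Q)" and U: "open U" "Q \<in> U"
    and c: "\<And>P. P \<in> N \<Longrightarrow> P \<in> U \<Longrightarrow> \<phi> P = c" and Y: "Y \<in> tangent_space N Q"
  shows "\<phi>' Y = (0 :: 'c::real_normed_vector)"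
proof -
  obtain g e where e: "0 < e" and g: "\<And>t. t \<in> {-e<..<e} \<Longrightarrow> g t \<in> N" "g 0 = Q"
    "(g has_vector_derivative Y) (at (0::real))"
    using Y unfolding tangent_space_def by blast
  have "(g \<longlongrightarrow> g 0) (nhds 0)"
    using has_vector_derivative_continuous[OF g(3)]
    unfolding continuous_at tendsto_at_iff_tendsto_nhds .
  from topological_tendstoD[OF this U(1)] have "\<forall>\<^sub>F t in nhds 0. g t \<in> U"
    using U(2) g(2) by simp
  then obtain d where d: "0 < d" "\<And>t. dist t 0 < d \<Longrightarrow> g t \<in> U"
    unfolding eventually_nhds_metric by blast
  have "((\<lambda>t. \<phi> (g t)) has_vector_derivative \<phi>' Y) (at 0)"
    by (rule has_derivative_imp_vector_derivative[OF _ g(3)]) (simp add: g(2) \<phi>)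
  then show ?thesis
    by (rule has_vector_derivative_const_near[of _ _ "min d e"]) (use d e g(1) in \<open>auto intro!: c simp: dist_real_def\<close>)
qed

section \<open>Spaces of oriented geodesics\<close>

text \<open>The common features of the three models. The constant \<open>K\<close> is \<open>0\<close> for Euclidean space, where the
space form is the whole vector space, and \<open>\<epsilon>\<close> for the unit quadrics in four-space. Thus
\<open>K * metric F x p = 0\<close> says that \<open>x\<close> is tangent to the space form at \<open>p\<close> (no condition if \<open>K = 0\<close>),
and \<open>x - (K * metric F x p) *\<^sub>R p\<close> is the tangential part of \<open>x\<close>.

\<open>D\<close> recovers the direction from a geodesic and a point on it. It is defined and smooth on the whole
vector space, so that it may be differentiated there. \<open>dgeod p v\<close> is the derivative of
\<open>geod F\<close> at \<open>(p, v)\<close>.\<close>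

locale geodesic_space =
  fixes F :: "('m::euclidean_space, 'l::euclidean_space) space_form"
    and K :: real
    and D :: "'l \<times> 'm \<Rightarrow> 'm"
    and dgeod :: "'m \<Rightarrow> 'm \<Rightarrow> 'm \<Rightarrow> 'm \<Rightarrow> 'l"
  assumes metric_bilinear: "bounded_bilinear (metric F)"
    and metric_sym: "metric F x y = metric F y x"
    and carrier_norm: "p \<in> carrier_set F \<Longrightarrow> K \<noteq> 0 \<Longrightarrow> K * metric F p p = 1"
    and dim_tangent: "p \<in> carrier_set F \<Longrightarrow> dim {z. K * metric F z p = 0} = 3"
    and smooth_geod: "smooth_on (\<lambda>(p, v). geod F p v) UNIV"
    and geod_derivative: "((\<lambda>(p, v). geod F p v) has_derivative (\<lambda>(x, y). dgeod p v x y)) (at (p, v))"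
    and smooth_D: "smooth_on D UNIV"
    and D_geod: "p \<in> carrier_set F \<Longrightarrow> metric F v v = 1 \<Longrightarrow> K * metric F v p = 0 \<Longrightarrow> D (geod F p v, p) = v"
begin

abbreviation ip :: "'m \<Rightarrow> 'm \<Rightarrow> real" where "ip \<equiv> metric F"

sublocale ip: bounded_bilinear "metric F" by (rule metric_bilinear)

lemmas ip_simps = ip.add_left ip.add_right ip.diff_left ip.diff_right ip.scaleR_left ip.scaleR_right
  ip.minus_left ip.minus_right ip.zero_left ip.zero_right

text \<open>Orthonormal frames of the space form at \<open>p\<close>, written so that the case \<open>K = 0\<close> needs no separate
treatment.\<close>

definition frame :: "'m \<Rightarrow> 'm \<Rightarrow> 'm \<Rightarrow> 'm \<Rightarrow> bool" where
  "frame p v w n \<longleftrightarrow> p \<in> carrier_set F \<and>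
     K * ip v p = 0 \<and> K * ip w p = 0 \<and> K * ip n p = 0 \<and>
     ip v v = 1 \<and> ip w w = 1 \<and> ip n n = 1 \<and> ip v w = 0 \<and> ip v n = 0 \<and> ip w n = 0"

lemma frameD:
  assumes "frame p v w n"
  shows "p \<in> carrier_set F" "K * ip v p = 0" "K * ip w p = 0" "K * ip n p = 0"
    "ip v v = 1" "ip w w = 1" "ip n n = 1" "ip v w = 0" "ip v n = 0" "ip w n = 0"
    "ip w v = 0" "ip n v = 0" "ip n w = 0" "K * ip p v = 0" "K * ip p w = 0" "K * ip p n = 0"
  using assms metric_sym[of w v] metric_sym[of n v] metric_sym[of n w]
    metric_sym[of p v] metric_sym[of p w] metric_sym[of p n] by (auto simp: frame_def)

text \<open>An orthonormal triple in the three-dimensional tangent space is a basis. Such a triple being given by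
the principal directions and the normal, positivity of the metric on this space is a consequence.\<close>

lemma frame_expand:
  assumes fr: "frame p v w n" and z: "K * ip z p = 0"
  shows "z = ip z v *\<^sub>R v + ip z w *\<^sub>R w + ip z n *\<^sub>R n"
proof -
  note f = frameD[OF fr]
  define T where "T = {z. K * ip z p = 0}"
  define L where "L = (\<lambda>(a::real, b::real, c::real). a *\<^sub>R v + b *\<^sub>R w + c *\<^sub>R n)"
  have lin: "linear L"
    unfolding L_def by (rule linearI) (auto simp: algebra_simps)
  have coords: "ip (L (a, b, c)) v = a" "ip (L (a, b, c)) w = b" "ip (L (a, b, c)) n = c" for a b c
    by (auto simp: L_def ip_simps f)
  have "inj L"
  proof (rule injI)
    fix r s assume "L r = L s"
    then show "r = s" using coords by (cases r, cases s) metis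
  qed
  have sub: "range L \<subseteq> T" using f by (auto simp: T_def L_def ip_simps distrib_left)
  have "dim (range L) = 3"
    using dim_image_eq[OF lin, of UNIV] \<open>inj L\<close> by simp
  moreover have "subspace T"
    unfolding T_def by (auto simp: subspace_def ip_simps distrib_left)
  ultimately have "range L = T"
    using sub dim_tangent[OF f(1)] subspace_dim_equal[of "range L" T] linear_subspace_image[OF lin subspace_UNIV]
    by (simp add: T_def)
  moreover have "z \<in> T" using z by (simp add: T_def)
  ultimately obtain r where "z = L r" by blast
  then show ?thesis using coords by (cases r) (simp add: L_def)
qed

lemma frame_eqI:
  assumes fr: "frame p v w n" and "ip z v = ip z' v" "ip z w = ip z' w" "ip z n = ip z' n" "K * ip z p = K * ip z' p"
  shows "z = z'"
  using frame_expand[OF fr, of "z - z'"] assms by (simp add: ip_simps algebra_simps)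

lemma tangent_space_carrier:
  assumes "z \<in> tangent_space (carrier_set F) p"
  shows "K * ip z p = 0"
proof (cases "K = 0")
  case False
  obtain c e where c: "0 < e" "\<And>t. t \<in> {-e<..<e} \<Longrightarrow> c t \<in> carrier_set F" "c 0 = p"
    "(c has_vector_derivative z) (at 0)"
    using assms unfolding tangent_space_def by blast
  have "((\<lambda>t. ip (c t) (c t)) has_vector_derivative (ip p z + ip z p)) (at 0)"
    using ip.has_vector_derivative[OF c(4) c(4)] c(3) by simp
  moreover have "ip (c t) (c t) = 1 / K" if "t \<in> {-e<..<e}" for t
    using carrier_norm[OF c(2)[OF that] False] False by (simp add: field_simps)
  ultimately have "ip p z + ip z p = 0"
    using has_vector_derivative_const_near c(1) by blast
  then show ?thesis using metric_sym[of p z] by simp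
qed simp

lemma proj_carrier: "p \<in> carrier_set F \<Longrightarrow> K * (K * ip p p) = K"
  using carrier_norm by (cases "K = 0") auto

end

section \<open>Strictly convex surfaces and their tangent hypersurfaces\<close>

locale convex_surface = geodesic_space F K D dgeod
  for F :: "('m::euclidean_space, 'l::euclidean_space) space_form" and K D dgeod +
  fixes S :: "'m set" and \<nu> :: "'m \<Rightarrow> 'm"
  assumes S_carrier: "S \<subseteq> carrier_set F"
    and S_sphere: "embedded_sphere S"
    and normal: "unit_normal_field F S \<nu>"
    and convex: "\<And>p. p \<in> S \<Longrightarrow> \<exists>k\<^sub>1 k\<^sub>2. principal_curvatures F S \<nu> p k\<^sub>1 k\<^sub>2 \<and> 0 < k\<^sub>1 * k\<^sub>2"
begin

abbreviation H :: "('l \<times> 'm) set" where "H \<equiv> tangent_hypersurface F S"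

abbreviation shape :: "'m \<Rightarrow> 'm \<Rightarrow> 'm" where "shape \<equiv> shape_operator \<nu>"

lemma tangent_space_S_perp:
  assumes "p \<in> S" "z \<in> tangent_space S p"
  shows "K * ip z p = 0" "unit_normal_field F S \<mu> \<Longrightarrow> ip z (\<mu> p) = 0"
proof -
  show "K * ip z p = 0"
    using tangent_space_carrier tangent_space_mono[OF S_carrier] assms by blast
  show "ip z (\<mu> p) = 0" if "unit_normal_field F S \<mu>"
    using that assms unfolding unit_normal_field_def metric_sym[of z] by blast
qed

lemma unit_normalD:
  assumes "unit_normal_field F S \<mu>" "p \<in> S"
  shows "K * ip (\<mu> p) p = 0" "ip (\<mu> p) (\<mu> p) = 1"
  using assms tangent_space_carrier unfolding unit_normal_field_def by blast+

lemma principal_frame: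
  assumes "p \<in> S"
  obtains e1 e2 k1 k2 where "e1 \<in> tangent_space S p" "e2 \<in> tangent_space S p" "frame p e1 e2 (\<nu> p)"
    "shape p e1 = k1 *\<^sub>R e1" "shape p e2 = k2 *\<^sub>R e2" "0 < k1 * k2"
proof -
  obtain k1 k2 e1 e2 where *: "0 < k1 * k2" "e1 \<in> tangent_space S p" "e2 \<in> tangent_space S p"
    "ip e1 e1 = 1" "ip e2 e2 = 1" "ip e1 e2 = 0"
    "shape p e1 = k1 *\<^sub>R e1" "shape p e2 = k2 *\<^sub>R e2"
    using convex[OF assms] unfolding principal_curvatures_def by blast
  have "frame p e1 e2 (\<nu> p)"
    unfolding frame_def
    using * S_carrier assms tangent_space_S_perp[OF assms] unit_normalD[OF normal assms] normal by auto
  with * that show ?thesis by blast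
qed

lemma smooth_normal:
  obtains U where "open U" "S \<subseteq> U" "smooth_on \<nu> U"
  using normal unfolding unit_normal_field_def by blast

lemma sphere_param:
  obtains f U where "open U" "sphere 0 1 \<subseteq> U" "smooth_on f U" "f ` sphere (0::real^3) 1 = S"
    "\<And>q v. q \<in> sphere 0 1 \<Longrightarrow> v \<bullet> q = 0 \<Longrightarrow> v \<noteq> 0 \<Longrightarrow> frechet_derivative f (at q) v \<noteq> 0"
  using S_sphere unfolding embedded_sphere_def by metis

text \<open>A parameterization \<open>f\<close> by the unit sphere is turned into a family on an open subset of the ambient
space by composing it with normalisation.\<close>

lemma sphere_param_family:
  fixes f :: "real^3 \<Rightarrow> 'm"
  assumes U: "open U" "sphere 0 1 \<subseteq> U" "smooth_on f U" "f ` sphere 0 1 = S" and q: "q \<in> sphere 0 1"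
  defines "Z \<equiv> {z. 0 < (q + z) \<bullet> (q + z)}"
  defines "P \<equiv> \<lambda>z. f (normalise inner (q + z))"
  shows "open Z" "0 \<in> Z" "smooth_on P Z" "P ` Z \<subseteq> S" "P 0 = f q"
    "(P has_derivative (\<lambda>z. frechet_derivative f (at q) (z - (q \<bullet> z) *\<^sub>R q))) (at 0)"
proof -
  have qq: "q \<bullet> q = 1" using q by (simp add: dot_square_norm)
  show oZ: "open Z" unfolding Z_def by (intro open_Collect_less continuous_intros)
  show "0 \<in> Z" using q by (auto simp: Z_def)
  have sph: "normalise inner (q + z) \<in> sphere 0 1" if "z \<in> Z" for z
    using normalise_unit[OF bounded_bilinear_inner, of "q + z"] that
    by (simp add: Z_def norm_eq_1)
  have shift: "smooth_on (\<lambda>z. q + z) Z"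
    by (rule smooth_on_add[OF oZ smooth_on_const smooth_on_ident[OF oZ]])
  have "smooth_on (\<lambda>z. normalise inner (q + z)) Z"
    by (rule smooth_on_normalise[OF bounded_bilinear_inner oZ shift]) (simp add: Z_def)
  then show "smooth_on P Z"
    unfolding P_def
    by (rule smooth_on_compose[OF oZ U(1) _ U(3), rotated]) (use sph U(2) in blast)
  show "P ` Z \<subseteq> S" using sph U(4) by (auto simp: P_def)
  show "P 0 = f q" by (simp add: P_def normalise_of_unit qq)
  have n: "((\<lambda>z. normalise inner (q + z)) has_derivative (\<lambda>z. z - (q \<bullet> z) *\<^sub>R q)) (at 0)"
    by (rule has_derivative_eq_rhs[OF has_derivative_normalise[OF bounded_bilinear_inner, of "\<lambda>z. q + z" "\<lambda>z. z"]])
      (auto intro!: derivative_eq_intros simp: qq inner_commute)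
  have "(f has_derivative frechet_derivative f (at q)) (at (normalise inner (q + 0)))"
    using smooth_on_has_derivative[OF U(3), of q] U(2) q by (auto simp: normalise_of_unit qq)
  from diff_chain_at[OF n this] show "(P has_derivative (\<lambda>z. frechet_derivative f (at q) (z - (q \<bullet> z) *\<^sub>R q))) (at 0)"
    by (simp add: P_def o_def)
qed

text \<open>Both inclusions are obtained from a count of dimensions: the image of \<open>df\<close> is contained in the tangent
space, which is contained in the orthogonal complement of \<open>\<nu>\<close>. The first is two-dimensional because
\<open>f\<close> is an immersion, the last because it is spanned by two principal directions.\<close>

lemma tangent_space_S_param:
  fixes f :: "real^3 \<Rightarrow> 'm"
  assumes U: "open U" "sphere 0 1 \<subseteq> U" "smooth_on f U" "f ` sphere 0 1 = S" and q: "q \<in> sphere 0 1"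
    and im: "\<And>v. v \<bullet> q = 0 \<Longrightarrow> v \<noteq> 0 \<Longrightarrow> frechet_derivative f (at q) v \<noteq> 0"
  shows "tangent_space S (f q) = {z. K * ip z (f q) = 0 \<and> ip z (\<nu> (f q)) = 0}"
    "tangent_space S (f q) = frechet_derivative f (at q) ` {x. q \<bullet> x = 0}"
proof -
  let ?p = "f q" and ?f = "frechet_derivative f (at q)"
  define T where "T = {z. K * ip z ?p = 0 \<and> ip z (\<nu> ?p) = 0}"
  have p: "?p \<in> S" using U(4) q by blast
  have lin: "linear ?f"
    using smooth_on_has_derivative[OF U(3), of q] U(2) q has_derivative_linear by blast
  have 1: "?f ` {x. q \<bullet> x = 0} \<subseteq> tangent_space S ?p"
  proof
    fix y assume "y \<in> ?f ` {x. q \<bullet> x = 0}"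
    then obtain x where x: "q \<bullet> x = 0" "y = ?f x" by blast
    note F = sphere_param_family[OF U q]
    show "y \<in> tangent_space S ?p"
      using tangent_space_of_family[OF F(1-4), of x] unfolding F(5) frechet_derivative_eq[OF F(6)]
      using x by simp
  qed
  have 2: "tangent_space S ?p \<subseteq> T"
    using tangent_space_S_perp[OF p] normal by (auto simp: T_def)
  obtain e1 e2 where fr: "frame ?p e1 e2 (\<nu> ?p)" using principal_frame[OF p] by metis
  have "z \<in> span {e1, e2}" if "z \<in> T" for z
  proof -
    have "z = ip z e1 *\<^sub>R e1 + ip z e2 *\<^sub>R e2"
      using frame_expand[OF fr, of z] that by (simp add: T_def)
    then show ?thesis by (metis span_add span_scale span_base insertI1 insertI2)
  qed
  then have "T \<subseteq> span {e1, e2}" by blast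
  then have "dim T \<le> card {e1, e2}" by (intro dim_le_card) auto
  then have dT: "dim T \<le> 2" using card_insert_le_m1[of 2 "{e2}" e1] by simp
  have "q \<noteq> 0" using q by auto
  have inj: "inj_on ?f (span {x. q \<bullet> x = 0})"
  proof -
    have span: "span {x. q \<bullet> x = 0} = {x. q \<bullet> x = 0}"
      by (rule span_eq_iff[THEN iffD2, OF subspace_hyperplane])
    show ?thesis unfolding span
    proof (rule inj_onI)
      fix x y assume "x \<in> {x. q \<bullet> x = 0}" "y \<in> {x. q \<bullet> x = 0}" "?f x = ?f y"
      then have "?f (x - y) = 0" "(x - y) \<bullet> q = 0"
        by (simp_all add: linear_diff[OF lin] inner_diff_right inner_commute[of _ q])
      then show "x = y" using im[of "x - y"] by auto
    qed
  qed
  have "dim (?f ` {x. q \<bullet> x = 0}) = 2"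
    using dim_image_eq[OF lin inj] dim_hyperplane[OF \<open>q \<noteq> 0\<close>] by simp
  moreover have "subspace T"
    unfolding T_def by (auto simp: subspace_def ip_simps distrib_left)
  ultimately have "?f ` {x. q \<bullet> x = 0} = T"
    by (intro subspace_dim_equal order_trans[OF 1 2] linear_subspace_image[OF lin subspace_hyperplane])
      (use dT in simp_all)
  with 1 2 show "tangent_space S ?p = T" "tangent_space S ?p = ?f ` {x. q \<bullet> x = 0}"
    by simp_all
qed

lemma tangent_space_S:
  assumes "p \<in> S"
  shows "tangent_space S p = {z. K * ip z p = 0 \<and> ip z (\<nu> p) = 0}"
proof -
  obtain f U where f: "open U" "sphere 0 1 \<subseteq> U" "smooth_on f U" "f ` sphere (0::real^3) 1 = S"
    "\<And>q v. q \<in> sphere 0 1 \<Longrightarrow> v \<bullet> q = 0 \<Longrightarrow> v \<noteq> 0 \<Longrightarrow> frechet_derivative f (at q) v \<noteq> 0"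
    by (rule sphere_param) (rule that)
  obtain q where q: "q \<in> sphere 0 1" "p = f q" using assms f(4) by blast
  show ?thesis unfolding q(2) by (rule tangent_space_S_param(1)[OF f(1-4) q(1) f(5)[OF q(1)]])
qed

lemma subspace_tangent_space_S: "p \<in> S \<Longrightarrow> subspace (tangent_space S p)"
  by (auto simp: tangent_space_S subspace_def ip_simps distrib_left)

end

context convex_surface begin

lemma hypersurfaceD:
  assumes "Q \<in> H"
  shows "snd Q \<in> S" "D Q \<in> tangent_space S (snd Q)" "ip (D Q) (D Q) = 1" "fst Q = geod F (snd Q) (D Q)"
    "K * ip (D Q) (snd Q) = 0" "ip (D Q) (\<nu> (snd Q)) = 0" "snd Q \<in> carrier_set F"
proof -
  obtain \<gamma> p v where Q: "Q = (\<gamma>, p)" "p \<in> S" "v \<in> tangent_space S p" "ip v v = 1" "\<gamma> = geod F p v"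
    using assms unfolding tangent_hypersurface_def by blast
  have "D Q = v"
    using D_geod[of p v] Q tangent_space_S_perp(1)[OF Q(2,3)] S_carrier by auto
  then show "snd Q \<in> S" "D Q \<in> tangent_space S (snd Q)" "ip (D Q) (D Q) = 1"
    "fst Q = geod F (snd Q) (D Q)" "K * ip (D Q) (snd Q) = 0" "ip (D Q) (\<nu> (snd Q)) = 0" "snd Q \<in> carrier_set F"
    using Q tangent_space_S_perp[OF Q(2,3)] normal S_carrier by auto
qed

lemma hypersurfaceI:
  assumes "p \<in> S" "v \<in> tangent_space S p" "ip v v = 1"
  shows "(geod F p v, p) \<in> H" "D (geod F p v, p) = v"
proof -
  show "(geod F p v, p) \<in> H" using assms unfolding tangent_hypersurface_def by blast
  show "D (geod F p v, p) = v"
    using D_geod[of p v] assms tangent_space_S_perp(1)[OF assms(1,2)] S_carrier by auto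
qed

lemma direction_eq:
  assumes "Q \<in> H"
  shows "direction F S Q = D Q"
  unfolding direction_def
proof (rule the_equality)
  fix v assume v: "v \<in> tangent_space S (snd Q) \<and> ip v v = 1 \<and> fst Q = geod F (snd Q) v"
  then have "D (geod F (snd Q) v, snd Q) = v" using hypersurfaceI(2) hypersurfaceD(1)[OF assms] by blast
  then show "v = D Q" using v by (metis prod.collapse)
qed (use hypersurfaceD[OF assms] in blast)

lemma D_has_derivative: "(D has_derivative frechet_derivative D (at Q)) (at Q)"
  by (rule smooth_on_has_derivative[OF smooth_D]) simp

lemma normal_has_derivative:
  assumes "unit_normal_field F S \<mu>" "p \<in> S"
  shows "(\<mu> has_derivative (\<lambda>x. - shape_operator \<mu> p x)) (at p)"
proof -
  obtain U where "S \<subseteq> U" "smooth_on \<mu> U" using assms(1) unfolding unit_normal_field_def by blast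
  then show ?thesis using smooth_on_has_derivative[of \<mu> U p] assms(2) by (auto simp: shape_operator_def)
qed

abbreviation dD :: "'l \<times> 'm \<Rightarrow> 'l \<times> 'm \<Rightarrow> 'm" where
  "dD Q \<equiv> frechet_derivative D (at Q)"

lemma linear_dD: "linear (dD Q)"
  using D_has_derivative by (rule has_derivative_linear)

text \<open>Differentiation, along a curve in the tangent hypersurface, of the defining relations of its points:
\<open>v\<close> is a unit vector, orthogonal to the normal and tangent to the space form. The relation with the
normal is where the shape operator enters; it is stated for every unit normal field \<open>\<mu>\<close> because
lines of curvature and umbilics may be given by a field different from \<open>\<nu>\<close>.\<close>

lemma tangent_space_H:
  assumes "X \<in> tangent_space H Q"
  shows "snd X \<in> tangent_space S (snd Q)"
    "fst X = dgeod (snd Q) (D Q) (snd X) (dD Q X)"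
    "ip (dD Q X) (D Q) = 0"
    "unit_normal_field F S \<mu> \<Longrightarrow> ip (dD Q X) (\<mu> (snd Q)) = ip (shape_operator \<mu> (snd Q) (snd X)) (D Q)"
    "K * ip (dD Q X) (snd Q) = - (K * ip (snd X) (D Q))"
    "Q \<in> H"
proof -
  obtain c e where e: "0 < e" and sm: "smooth_on c {-e<..<e}"
    and cH: "\<And>t. t \<in> {-e<..<e} \<Longrightarrow> c t \<in> H" and c0: "c 0 = Q" and cX: "(c has_vector_derivative X) (at 0)"
    using assms unfolding tangent_space_def by blast
  define P where "P t = snd (c t)" for t
  define V where "V t = D (c t)" for t
  have P0: "P 0 = snd Q" and V0: "V 0 = D Q" by (auto simp: P_def V_def c0)
  show Q: "Q \<in> H" using cH[of 0] c0 e by auto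
  have P: "(P has_vector_derivative snd X) (at 0)"
    unfolding P_def using bounded_linear.has_vector_derivative[OF bounded_linear_snd cX] .
  have V: "(V has_vector_derivative dD Q X) (at 0)"
    unfolding V_def using has_derivative_imp_vector_derivative[OF _ cX, of D] D_has_derivative c0 by simp
  note H = hypersurfaceD[OF cH, folded P_def V_def]
  show "snd X \<in> tangent_space S (snd Q)"
    unfolding tangent_space_def
  proof (intro CollectI exI conjI)
    show "smooth_on P {-e<..<e}" unfolding P_def by (rule smooth_on_snd[OF _ sm]) simp
  qed (use e H P P0 in auto)
  have "((\<lambda>t. (P t, V t)) has_vector_derivative (snd X, dD Q X)) (at 0)"
    by (rule has_vector_derivative_Pair[OF P V])
  then have "((\<lambda>t. case (P t, V t) of (p, v) \<Rightarrow> geod F p v) has_vector_derivative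
      (case (snd X, dD Q X) of (x, y) \<Rightarrow> dgeod (P 0) (V 0) x y)) (at 0)"
    by (rule has_derivative_imp_vector_derivative[OF geod_derivative])
  then have g: "((\<lambda>t. geod F (P t) (V t)) has_vector_derivative dgeod (P 0) (V 0) (snd X) (dD Q X)) (at 0)"
    by simp
  have "((\<lambda>t. fst (c t)) has_vector_derivative fst X) (at 0)"
    using bounded_linear.has_vector_derivative[OF bounded_linear_fst cX] .
  then have "((\<lambda>t. geod F (P t) (V t)) has_vector_derivative fst X) (at 0)"
    by (rule has_vector_derivative_transform_within_open[of _ _ _ "{-e<..<e}"]) (use e H(4) in auto)
  with g show "fst X = dgeod (snd Q) (D Q) (snd X) (dD Q X)"
    using vector_derivative_unique_at P0 V0 by metis
  have "ip (V 0) (dD Q X) + ip (dD Q X) (V 0) = 0"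
    by (rule has_vector_derivative_const_near[OF ip.has_vector_derivative[OF V V] e H(3)])
  then show "ip (dD Q X) (D Q) = 0" using metric_sym[of "D Q"] V0 by simp
  show "ip (dD Q X) (\<mu> (snd Q)) = ip (shape_operator \<mu> (snd Q) (snd X)) (D Q)" if \<mu>: "unit_normal_field F S \<mu>"
  proof -
    have "((\<lambda>t. \<mu> (P t)) has_vector_derivative - shape_operator \<mu> (P 0) (snd X)) (at 0)"
      using has_derivative_imp_vector_derivative[OF normal_has_derivative[OF \<mu>] P] H(1)[of 0] e by simp
    note ip.has_vector_derivative[OF V this]
    moreover have "ip (V t) (\<mu> (P t)) = 0" if "t \<in> {-e<..<e}" for t
      using tangent_space_S_perp(2)[OF H(1,2)[OF that] \<mu>] .
    ultimately have "ip (V 0) (- shape_operator \<mu> (P 0) (snd X)) + ip (dD Q X) (\<mu> (P 0)) = 0"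
      by (rule has_vector_derivative_const_near[OF _ e])
    then show ?thesis using metric_sym[of "D Q"] by (simp add: P0 V0 ip_simps)
  qed
  have "K * (ip (V 0) (snd X) + ip (dD Q X) (P 0)) = 0"
    by (rule has_vector_derivative_const_near[OF has_vector_derivative_mult_right[OF ip.has_vector_derivative[OF V P]] e H(5)])
  then show "K * ip (dD Q X) (snd Q) = - (K * ip (snd X) (D Q))"
    using metric_sym[of "D Q"] by (simp add: P0 V0 algebra_simps)
qed

text \<open>All statements are read off from the principal directions. The last one says that the second
fundamental form is definite, the two principal curvatures having the same sign.\<close>

lemma shape_tangent:
  assumes "p \<in> S"
  shows "linear (shape p)" "x \<in> tangent_space S p \<Longrightarrow> shape p x \<in> tangent_space S p"
    "x \<in> tangent_space S p \<Longrightarrow> x \<noteq> 0 \<Longrightarrow> ip (shape p x) x \<noteq> 0"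
proof -
  have "linear (\<lambda>x. - shape p x)"
    using normal_has_derivative[OF normal assms] by (rule has_derivative_linear)
  from linear_compose_neg[OF this] show lin: "linear (shape p)" by simp
  obtain e1 e2 k1 k2 where e: "e1 \<in> tangent_space S p" "e2 \<in> tangent_space S p"
    and fr: "frame p e1 e2 (\<nu> p)"
    and k: "shape p e1 = k1 *\<^sub>R e1" "shape p e2 = k2 *\<^sub>R e2" "0 < k1 * k2"
    by (rule principal_frame[OF assms])
  note sub = subspace_tangent_space_S[OF assms]
  have x: "x = ip x e1 *\<^sub>R e1 + ip x e2 *\<^sub>R e2" if "x \<in> tangent_space S p" for x
    using frame_expand[OF fr, of x] that by (simp add: tangent_space_S[OF assms])
  have Ax: "shape p x = (ip x e1 * k1) *\<^sub>R e1 + (ip x e2 * k2) *\<^sub>R e2" if "x \<in> tangent_space S p" for x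
    by (subst x[OF that]) (simp add: linear_add[OF lin] linear_scale[OF lin] k)
  show "shape p x \<in> tangent_space S p" if "x \<in> tangent_space S p"
    unfolding Ax[OF that] by (intro subspace_add[OF sub] subspace_scale[OF sub] e)
  show "ip (shape p x) x \<noteq> 0" if "x \<in> tangent_space S p" "x \<noteq> 0"
  proof
    assume 0: "ip (shape p x) x = 0"
    have "ip (shape p x) x = k1 * (ip x e1)\<^sup>2 + k2 * (ip x e2)\<^sup>2"
      using metric_sym[of e1 x] metric_sym[of e2 x]
      by (simp add: Ax[OF that(1)] ip_simps power2_eq_square)
    then have "k1 * (k1 * (ip x e1)\<^sup>2 + k2 * (ip x e2)\<^sup>2) = 0" using 0 by simp
    then have "(k1 * ip x e1)\<^sup>2 + k1 * k2 * (ip x e2)\<^sup>2 = 0"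
      by (simp add: power_mult_distrib power2_eq_square algebra_simps)
    moreover have "0 \<le> (k1 * ip x e1)\<^sup>2" "0 \<le> k1 * k2 * (ip x e2)\<^sup>2" using k(3) by auto
    ultimately have "(k1 * ip x e1)\<^sup>2 = 0" "k1 * k2 * (ip x e2)\<^sup>2 = 0" by linarith+
    then have "ip x e1 = 0" "ip x e2 = 0" using k(3) by auto
    then show False using x[OF that(1)] that(2) by simp
  qed
qed

lemma tangent_frame:
  assumes "p \<in> S" "v \<in> tangent_space S p" "ip v v = 1"
  obtains w where "w \<in> tangent_space S p" "frame p v w (\<nu> p)"
proof -
  obtain e1 e2 where e: "e1 \<in> tangent_space S p" "e2 \<in> tangent_space S p"
    and fr: "frame p e1 e2 (\<nu> p)"
    using principal_frame[OF assms(1)] by metis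
  note sub = subspace_tangent_space_S[OF assms(1)] and f = frameD[OF fr]
  have v: "v = ip v e1 *\<^sub>R e1 + ip v e2 *\<^sub>R e2"
    using frame_expand[OF fr, of v] assms by (simp add: tangent_space_S)
  define w where "w = ip v e1 *\<^sub>R e2 - ip v e2 *\<^sub>R e1"
  have w: "w \<in> tangent_space S p"
    unfolding w_def by (intro subspace_diff[OF sub] subspace_scale[OF sub] e)
  have 1: "ip v v = ip v e1 * ip v e1 + ip v e2 * ip v e2"
    by (subst (2) v) (simp add: ip_simps)
  have "ip w w = ip v e1 * ip v e1 + ip v e2 * ip v e2" "ip v w = 0"
    by (simp_all add: w_def ip_simps f)
  then have "frame p v w (\<nu> p)"
    unfolding frame_def
    using assms w f 1 by (auto simp: tangent_space_S)
  with w that show ?thesis by blast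
qed


text \<open>A local parameterization of the tangent hypersurface around \<open>Q\<close>, with one superfluous parameter. The
point \<open>P\<close> of \<open>S\<close> moves by \<open>sphere_param_family\<close>. The direction is obtained from \<open>v + t w\<close> by projection
to the tangent plane of \<open>S\<close> at \<open>P\<close> and normalisation. Its derivatives attain all values permitted by
\<open>tangent_space_H\<close>, which is therefore an exact description of the tangent spaces.\<close>

lemma H_family:
  assumes Q: "Q \<in> H"
  obtains \<Phi> :: "(real^3) \<times> real \<Rightarrow> 'l \<times> 'm" and Z
  where "open Z" "0 \<in> Z" "smooth_on \<Phi> Z" "\<Phi> ` Z \<subseteq> H" "\<Phi> 0 = Q"
    "\<And>x y. x \<in> tangent_space S (snd Q) \<Longrightarrow> ip y (D Q) = 0 \<Longrightarrow>
       ip y (\<nu> (snd Q)) = ip (shape (snd Q) x) (D Q) \<Longrightarrow> K * ip y (snd Q) = - (K * ip x (D Q)) \<Longrightarrow>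
       \<exists>z. snd (frechet_derivative \<Phi> (at 0) z) = x \<and> dD Q (frechet_derivative \<Phi> (at 0) z) = y"
proof -
  define p where "p = snd Q"
  define v where "v = D Q"
  have pS: "p \<in> S" and vT: "v \<in> tangent_space S p" and vv: "ip v v = 1" and fQ: "fst Q = geod F p v"
    using hypersurfaceD[OF Q] by (auto simp: p_def v_def)
  obtain w where wT: "w \<in> tangent_space S p" and fr: "frame p v w (\<nu> p)"
    by (rule tangent_frame[OF pS vT vv])
  note fr' = frameD[OF fr]
  obtain f U where f: "open U" "sphere 0 1 \<subseteq> U" "smooth_on f U" "f ` sphere (0::real^3) 1 = S"
    "\<And>q v. q \<in> sphere 0 1 \<Longrightarrow> v \<bullet> q = 0 \<Longrightarrow> v \<noteq> 0 \<Longrightarrow> frechet_derivative f (at q) v \<noteq> 0"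
    by (rule sphere_param) (rule that)
  obtain q where q: "q \<in> sphere 0 1" "p = f q" using pS f(4) by blast
  define Z0 where "Z0 = {z. 0 < (q + z) \<bullet> (q + z)}"
  define P0 where "P0 = (\<lambda>z. f (normalise inner (q + z)))"
  define dP where "dP = (\<lambda>z. frechet_derivative f (at q) (z - (q \<bullet> z) *\<^sub>R q))"
  have P0: "open Z0" "0 \<in> Z0" "smooth_on P0 Z0" "P0 ` Z0 \<subseteq> S" "P0 0 = p" "(P0 has_derivative dP) (at 0)"
    using sphere_param_family[OF f(1-4) q(1)] by (simp_all only: P0_def Z0_def dP_def q(2))
  obtain N where N: "open N" "S \<subseteq> N" "smooth_on \<nu> N" by (rule smooth_normal)
  define Z1 where "Z1 = (fst -` Z0 :: ((real^3) \<times> real) set)"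
  have oZ1: "open Z1" unfolding Z1_def by (intro open_vimage P0 continuous_intros)
  define P where "P = (\<lambda>z :: (real^3) \<times> real. P0 (fst z))"
  define n where "n = (\<lambda>z. \<nu> (P z))"
  define u where "u = (\<lambda>z :: (real^3) \<times> real. v + snd z *\<^sub>R w)"
  \<comment> \<open>the part of \<open>u\<close> tangent to \<open>S\<close> at \<open>P\<close>; a unit vector at \<open>0\<close>, hence of positive length nearby\<close>
  define m where "m = (\<lambda>z. u z - ip (u z) (n z) *\<^sub>R n z - (K * ip (u z) (P z)) *\<^sub>R P z)"
  define Z where "Z = {z \<in> Z1. 0 < ip (m z) (m z)}"
  define V where "V = (\<lambda>z. normalise ip (m z))"
  define \<Phi> where "\<Phi> = (\<lambda>z. (geod F (P z) (V z), P z))"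
  have PS: "P z \<in> S" if "z \<in> Z1" for z using that P0(4) by (auto simp: P_def Z1_def)
  have smP: "smooth_on P Z1"
    unfolding P_def
    by (rule smooth_on_compose[OF oZ1 P0(1) _ P0(3) smooth_on_fst[OF oZ1 smooth_on_ident[OF oZ1]]])
      (auto simp: Z1_def)
  have smn: "smooth_on n Z1"
    unfolding n_def by (rule smooth_on_compose[OF oZ1 N(1) _ N(3) smP]) (use PS N(2) in blast)
  have smu: "smooth_on u Z1"
    unfolding u_def
    by (rule smooth_on_add[OF oZ1 smooth_on_const smooth_on_scaleR[OF oZ1 smooth_on_snd[OF oZ1 smooth_on_ident[OF oZ1]] smooth_on_const]])
  note smip = smooth_on_bilinear[OF oZ1 metric_bilinear]
  have smm: "smooth_on m Z1"
    unfolding m_def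
    by (rule smooth_on_diff[OF oZ1 smooth_on_diff[OF oZ1 smu smooth_on_scaleR[OF oZ1 smip[OF smu smn] smn]]
        smooth_on_scaleR[OF oZ1 smooth_on_linear[OF oZ1 bounded_linear_mult_right smip[OF smu smP]] smP]])
  have "continuous_on Z1 (\<lambda>z. ip (m z) (m z))"
    by (rule smooth_on_imp_continuous_on[OF smip[OF smm smm]])
  from continuous_open_preimage[OF this oZ1 open_greaterThan[of 0]]
  have oZ: "open Z" by (simp add: Z_def vimage_def Int_def)
  have ZZ1: "Z \<subseteq> Z1" by (auto simp: Z_def)
  have smV: "smooth_on V Z"
    unfolding V_def by (rule smooth_on_normalise[OF metric_bilinear oZ smooth_on_subset[OF smm ZZ1]]) (simp add: Z_def)
  have sm\<Phi>: "smooth_on \<Phi> Z"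
  proof -
    have "smooth_on (\<lambda>z. case (P z, V z) of (p, v) \<Rightarrow> geod F p v) Z"
      by (rule smooth_on_compose[OF oZ open_UNIV _ smooth_geod smooth_on_Pair[OF oZ smooth_on_subset[OF smP ZZ1] smV]]) simp
    then show ?thesis
      unfolding \<Phi>_def by (intro smooth_on_Pair[OF oZ _ smooth_on_subset[OF smP ZZ1]]) simp
  qed
  have mT: "m z \<in> tangent_space S (P z)" if z: "z \<in> Z1" for z
  proof -
    have nn: "ip (n z) (n z) = 1" using unit_normalD(2)[OF normal PS[OF z]] by (simp add: n_def)
    have nP: "K \<noteq> 0 \<Longrightarrow> ip (n z) (P z) = 0" using unit_normalD(1)[OF normal PS[OF z]] by (simp add: n_def)
    have Pn: "K \<noteq> 0 \<Longrightarrow> ip (P z) (n z) = 0" using nP metric_sym[of "P z"] by simp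
    have PP: "(K * a) * ip (P z) (P z) = a" if "K \<noteq> 0" for a
      using carrier_norm[of "P z"] PS[OF z] S_carrier that by (auto simp: mult.commute[of K] mult.assoc)
    have "K * ip (m z) (P z) = 0" "ip (m z) (n z) = 0"
      using nP PP Pn by (cases "K = 0"; simp add: m_def ip_simps nn)+
    then show ?thesis by (simp add: tangent_space_S[OF PS[OF z]] n_def)
  qed
  have V1: "ip (V z) (V z) = 1" "V z \<in> tangent_space S (P z)" if "z \<in> Z" for z
    using that normalise_unit[OF metric_bilinear, of "m z"] mT[of z]
      subspace_scale[OF subspace_tangent_space_S[OF PS, of z]]
    by (auto simp: Z_def V_def normalise_def)
  have \<Phi>H: "\<Phi> z \<in> H" "D (\<Phi> z) = V z" if "z \<in> Z" for z
    unfolding \<Phi>_def using hypersurfaceI[OF PS V1(2,1), OF _ that that] that ZZ1 by blast+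
  have P_0: "P 0 = p" and n_0: "n 0 = \<nu> p" and u_0: "u 0 = v" by (simp_all add: P_def n_def u_def P0)
  have m_0: "m 0 = v" using fr' by (simp add: m_def P_0 n_0 u_0)
  have V_0: "V 0 = v" by (simp add: V_def m_0 normalise_of_unit vv)
  have Z_0: "0 \<in> Z" using P0(2) by (simp add: Z_def Z1_def m_0 vv)
  have \<Phi>_0: "\<Phi> 0 = Q" by (simp add: \<Phi>_def P_0 V_0 fQ[symmetric]) (simp add: p_def)
  have dP': "(P has_derivative (\<lambda>h. dP (fst h))) (at 0)"
    using diff_chain_at[OF bounded_linear_imp_has_derivative[OF bounded_linear_fst, of "at 0"], of P0 dP] P0(6)
    by (simp add: P_def o_def)
  have "(\<nu> has_derivative (\<lambda>x. - shape p x)) (at (P 0))"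
    using normal_has_derivative[OF normal pS] by (simp add: P_0)
  from diff_chain_at[OF dP' this] have dn: "(n has_derivative (\<lambda>h. - shape p (dP (fst h)))) (at 0)"
    by (simp add: n_def o_def)
  have du: "(u has_derivative (\<lambda>h. snd h *\<^sub>R w)) (at 0)"
    unfolding u_def by (auto intro!: derivative_eq_intros)
  note D1 = has_derivative_scaleR[OF ip.FDERIV[OF du dn] dn]
  note D2 = has_derivative_scaleR[OF has_derivative_mult_right[OF ip.FDERIV[OF du dP'], of K] dP']
  note D3 = has_derivative_diff[OF has_derivative_diff[OF du D1] D2]
  have "(m has_derivative (\<lambda>h. snd h *\<^sub>R w + ip v (shape p (dP (fst h))) *\<^sub>R \<nu> p - (K * ip v (dP (fst h))) *\<^sub>R p)) (at 0)"
    unfolding m_def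
    by (rule has_derivative_eq_rhs[OF D3]) (auto simp: fun_eq_iff P_0 n_0 u_0 fr' ip_simps distrib_left mult.left_commute[of K])
  note dm = has_derivative_normalise[OF metric_bilinear metric_sym this]
  have vp: "K = 0 \<or> ip v p = 0" using fr'(2) by simp
  from dm
  have dV: "(V has_derivative (\<lambda>h. snd h *\<^sub>R w + ip v (shape p (dP (fst h))) *\<^sub>R \<nu> p - (K * ip v (dP (fst h))) *\<^sub>R p)) (at 0)"
    unfolding V_def m_0
    by (rule has_derivative_eq_rhs) (use vp in \<open>auto simp: fun_eq_iff vv fr' ip_simps\<close>)
  show ?thesis
  proof (rule that[OF oZ Z_0 sm\<Phi> _ \<Phi>_0])
    show "\<Phi> ` Z \<subseteq> H" using \<Phi>H by blast
    fix x y assume x: "x \<in> tangent_space S (snd Q)" and y: "ip y (D Q) = 0"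
      "ip y (\<nu> (snd Q)) = ip (shape (snd Q) x) (D Q)" "K * ip y (snd Q) = - (K * ip x (D Q))"
    obtain x' where x': "q \<bullet> x' = 0" "frechet_derivative f (at q) x' = x"
      using x tangent_space_S_param(2)[OF f(1-4) q(1) f(5)[OF q(1)]] by (auto simp: p_def[symmetric] q(2))
    then have dPx: "dP x' = x" by (simp add: dP_def)
    let ?z = "(x', ip y w)"
    note d\<Phi> = smooth_on_has_derivative[OF sm\<Phi> Z_0]
    have 1: "(P has_derivative (\<lambda>h. snd (frechet_derivative \<Phi> (at 0) h))) (at 0)"
      using has_derivative_snd[OF d\<Phi>] by (simp add: \<Phi>_def)
    have "(D has_derivative dD Q) (at (\<Phi> 0))" using D_has_derivative \<Phi>_0 by simp
    from diff_chain_at[OF d\<Phi> this]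
    have "((\<lambda>z. D (\<Phi> z)) has_derivative (\<lambda>h. dD Q (frechet_derivative \<Phi> (at 0) h))) (at 0)"
      by (simp add: o_def)
    then have 2: "(V has_derivative (\<lambda>h. dD Q (frechet_derivative \<Phi> (at 0) h))) (at 0)"
      by (rule has_derivative_transform_within_open[OF _ oZ Z_0]) (use \<Phi>H in auto)
    have "snd (frechet_derivative \<Phi> (at 0) ?z) = x"
      using fun_cong[OF has_derivative_unique[OF 1 dP'], of ?z] dPx by simp
    moreover have "dD Q (frechet_derivative \<Phi> (at 0) ?z) = y"
    proof -
      have pp: "K * (ip v x * (K * ip p p)) = K * ip v x"
        using proj_carrier[OF fr'(1)] by (metis mult.assoc mult.commute)
      have "dD Q (frechet_derivative \<Phi> (at 0) ?z) = ip y w *\<^sub>R w + ip v (shape p x) *\<^sub>R \<nu> p - (K * ip v x) *\<^sub>R p"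
        using fun_cong[OF has_derivative_unique[OF 2 dV], of ?z] dPx by simp
      also have "\<dots> = y"
      proof (rule frame_eqI[OF fr])
        let ?y = "ip y w *\<^sub>R w + ip v (shape p x) *\<^sub>R \<nu> p - (K * ip v x) *\<^sub>R p"
        have pe: "K = 0 \<or> ip p v = 0 \<and> ip p w = 0 \<and> ip p (\<nu> p) = 0"
          "K = 0 \<or> ip w p = 0 \<and> ip (\<nu> p) p = 0"
          using fr' by auto
        show "ip ?y v = ip y v" using pe(1) y(1) by (auto simp: ip_simps fr' v_def[symmetric])
        show "ip ?y w = ip y w" using pe(1) by (auto simp: ip_simps fr')
        show "ip ?y (\<nu> p) = ip y (\<nu> p)"
          using pe(1) y(2) metric_sym[of v "shape p x"] by (auto simp: ip_simps fr' v_def[symmetric] p_def[symmetric])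
        have "K * ip ?y p = - (K * (ip v x * (K * ip p p)))"
          using pe(2) by (auto simp: ip_simps)
        also have "\<dots> = K * ip y p"
          using y(3) pp unfolding metric_sym[of v x] v_def[symmetric] p_def[symmetric] by simp
        finally show "K * ip ?y p = K * ip y p" .
      qed
      finally show ?thesis .
    qed
    ultimately show "\<exists>z. snd (frechet_derivative \<Phi> (at 0) z) = x \<and> dD Q (frechet_derivative \<Phi> (at 0) z) = y"
      by blast
  qed
qed

end

context convex_surface begin

lemma tangent_space_H_exists:
  assumes Q: "Q \<in> H"
    and "x \<in> tangent_space S (snd Q)" "ip y (D Q) = 0"
    "ip y (\<nu> (snd Q)) = ip (shape (snd Q) x) (D Q)" "K * ip y (snd Q) = - (K * ip x (D Q))"
  shows "\<exists>X\<in>tangent_space H Q. snd X = x \<and> dD Q X = y"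
proof -
  obtain \<Phi> :: "(real^3) \<times> real \<Rightarrow> 'l \<times> 'm" and Z
    where F: "open Z" "0 \<in> Z" "smooth_on \<Phi> Z" "\<Phi> ` Z \<subseteq> H" "\<Phi> 0 = Q"
    "\<And>x y. x \<in> tangent_space S (snd Q) \<Longrightarrow> ip y (D Q) = 0 \<Longrightarrow>
       ip y (\<nu> (snd Q)) = ip (shape (snd Q) x) (D Q) \<Longrightarrow> K * ip y (snd Q) = - (K * ip x (D Q)) \<Longrightarrow>
       \<exists>z. snd (frechet_derivative \<Phi> (at 0) z) = x \<and> dD Q (frechet_derivative \<Phi> (at 0) z) = y"
    by (rule H_family[OF Q]) (rule that)
  show ?thesis
    using F(6)[OF assms(2-)] tangent_space_of_family[OF F(1-4)] F(5) by metis
qed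

lemma tangent_space_H_eqI:
  assumes "X \<in> tangent_space H Q" "Y \<in> tangent_space H Q" "snd X = snd Y" "dD Q X = dD Q Y"
  shows "X = Y"
  using tangent_space_H(2)[OF assms(1)] tangent_space_H(2)[OF assms(2)] assms(3,4) by (simp add: prod_eq_iff)

lemma linear_dgeod: "linear (\<lambda>(x, y). dgeod p v x y)"
  by (rule has_derivative_linear[OF geod_derivative])

lemma tangent_space_H_iff:
  assumes Q: "Q \<in> H"
  shows "X \<in> tangent_space H Q \<longleftrightarrow>
    fst X = dgeod (snd Q) (D Q) (snd X) (dD Q X) \<and> snd X \<in> tangent_space S (snd Q) \<and> ip (dD Q X) (D Q) = 0 \<and>
    ip (dD Q X) (\<nu> (snd Q)) = ip (shape (snd Q) (snd X)) (D Q) \<and>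
    K * ip (dD Q X) (snd Q) = - (K * ip (snd X) (D Q))" (is "_ \<longleftrightarrow> ?R")
proof
  assume X: "X \<in> tangent_space H Q"
  show ?R using tangent_space_H(1,2,3,5)[OF X] tangent_space_H(4)[OF X normal] by blast
next
  assume R: ?R
  then obtain Y where Y: "Y \<in> tangent_space H Q" "snd Y = snd X" "dD Q Y = dD Q X"
    using tangent_space_H_exists[OF Q, of "snd X" "dD Q X"] by blast
  then have "Y = X" using tangent_space_H(2)[OF Y(1)] R by (simp add: prod_eq_iff)
  with Y show "X \<in> tangent_space H Q" by simp
qed

lemma subspace_tangent_space_H:
  assumes Q: "Q \<in> H"
  shows "subspace (tangent_space H Q)"
proof -
  note S = subspace_tangent_space_S[OF hypersurfaceD(1)[OF Q]]
  have A: "linear (shape (snd Q))" by (rule shape_tangent(1)[OF hypersurfaceD(1)[OF Q]])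
  have g: "dgeod p v (x + x') (y + y') = dgeod p v x y + dgeod p v x' y'"
    "dgeod p v (r *\<^sub>R x) (r *\<^sub>R y) = r *\<^sub>R dgeod p v x y" "dgeod p v 0 0 = 0" for p v x x' y y' r
    using linear_add[OF linear_dgeod, of p v "(x, y)" "(x', y')"]
      linear_scale[OF linear_dgeod, of p v r "(x, y)"] linear_0[OF linear_dgeod, of p v] by (auto simp: zero_prod_def)
  have set_eq: "tangent_space H Q = {X. fst X = dgeod (snd Q) (D Q) (snd X) (dD Q X) \<and>
    snd X \<in> tangent_space S (snd Q) \<and> ip (dD Q X) (D Q) = 0 \<and>
    ip (dD Q X) (\<nu> (snd Q)) = ip (shape (snd Q) (snd X)) (D Q) \<and>
    K * ip (dD Q X) (snd Q) = - (K * ip (snd X) (D Q))}"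
    by (intro set_eqI) (simp add: tangent_space_H_iff[OF Q])
  show ?thesis
    unfolding subspace_def set_eq
    using subspace_add[OF S] subspace_scale[OF S] subspace_0[OF S]
    by (simp add: linear_add[OF linear_dD] linear_scale[OF linear_dD] linear_0[OF linear_dD]
        linear_add[OF A] linear_scale[OF A] linear_0[OF A] ip_simps g distrib_left mult.left_commute[of K])
qed

text \<open>The coordinates \<open>a, b, \<theta>, h\<close> of a tangent vector of the tangent hypersurface. The term in \<open>snd Q\<close>
keeps \<open>v\<close> tangent to the space form and is absent in the flat case.\<close>

lemma tangent_H_coords:
  assumes Q: "Q \<in> H" and fr: "frame (snd Q) (D Q) w (\<nu> (snd Q))" and X: "X \<in> tangent_space H Q"
  shows "snd X = ip (snd X) (D Q) *\<^sub>R D Q + ip (snd X) w *\<^sub>R w" (is ?A)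
    "dD Q X = ip (dD Q X) w *\<^sub>R w + ip (dD Q X) (\<nu> (snd Q)) *\<^sub>R \<nu> (snd Q) - (K * ip (snd X) (D Q)) *\<^sub>R snd Q" (is ?B)
proof -
  note f = frameD[OF fr] and H = hypersurfaceD[OF Q] and T = tangent_space_H[OF X]
  show ?A
    using frame_expand[OF fr, of "snd X"] T(1) by (simp add: tangent_space_S[OF H(1)])
  show ?B
  proof (rule frame_eqI[OF fr])
    let ?y = "ip (dD Q X) w *\<^sub>R w + ip (dD Q X) (\<nu> (snd Q)) *\<^sub>R \<nu> (snd Q) - (K * ip (snd X) (D Q)) *\<^sub>R snd Q"
    have pe: "K = 0 \<or> ip (snd Q) (D Q) = 0 \<and> ip (snd Q) w = 0 \<and> ip (snd Q) (\<nu> (snd Q)) = 0"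
      "K = 0 \<or> ip w (snd Q) = 0 \<and> ip (\<nu> (snd Q)) (snd Q) = 0"
      using f by auto
    show "ip (dD Q X) (D Q) = ip ?y (D Q)" using pe(1) T(3) by (auto simp: ip_simps f)
    show "ip (dD Q X) w = ip ?y w" using pe(1) by (auto simp: ip_simps f)
    show "ip (dD Q X) (\<nu> (snd Q)) = ip ?y (\<nu> (snd Q))" using pe(1) by (auto simp: ip_simps f)
    have pp: "K * (ip (snd X) (D Q) * (K * ip (snd Q) (snd Q))) = K * ip (snd X) (D Q)"
      using proj_carrier[OF f(1)] by (metis mult.assoc mult.commute)
    have "K * ip ?y (snd Q) = - (K * (ip (snd X) (D Q) * (K * ip (snd Q) (snd Q))))"
      using pe(2) by (auto simp: ip_simps)
    then show "K * ip (dD Q X) (snd Q) = K * ip ?y (snd Q)" using T(5) pp by simp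
  qed
qed

lemma tangent_H_coords_exist:
  assumes Q: "Q \<in> H" and fr: "frame (snd Q) (D Q) w (\<nu> (snd Q))"
  shows "\<exists>X\<in>tangent_space H Q. ip (snd X) (D Q) = a \<and> ip (snd X) w = b \<and> ip (dD Q X) w = t"
proof -
  note f = frameD[OF fr] and H = hypersurfaceD[OF Q]
  define x where "x = a *\<^sub>R D Q + b *\<^sub>R w"
  define y where "y = t *\<^sub>R w + ip (shape (snd Q) x) (D Q) *\<^sub>R \<nu> (snd Q) - (K * a) *\<^sub>R snd Q"
  have pe: "K = 0 \<or> ip (snd Q) (D Q) = 0 \<and> ip (snd Q) w = 0 \<and> ip (snd Q) (\<nu> (snd Q)) = 0"
    "K = 0 \<or> ip w (snd Q) = 0 \<and> ip (\<nu> (snd Q)) (snd Q) = 0"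
    using f by auto
  have xa: "ip x (D Q) = a" "ip x w = b" by (simp_all add: x_def ip_simps f)
  have x: "x \<in> tangent_space S (snd Q)"
    unfolding x_def
    by (intro subspace_add subspace_scale subspace_tangent_space_S H(1,2)) (use f in \<open>simp add: tangent_space_S[OF H(1)]\<close>)
  have y: "ip y (D Q) = 0" "ip y w = t" "ip y (\<nu> (snd Q)) = ip (shape (snd Q) x) (D Q)"
    using pe(1) by (auto simp: y_def ip_simps f)
  have pp: "K * (a * (K * ip (snd Q) (snd Q))) = K * a"
    using proj_carrier[OF f(1)] by (metis mult.assoc mult.commute)
  have "K * ip y (snd Q) = - (K * (a * (K * ip (snd Q) (snd Q))))"
    using pe(2) by (auto simp: ip_simps y_def)
  then have "K * ip y (snd Q) = - (K * ip x (D Q))" using pp xa by simp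
  from tangent_space_H_exists[OF Q x y(1,3) this] show ?thesis using xa y by auto
qed

lemma shape_direction: 
  assumes "Q \<in> H"
  shows "ip (shape (snd Q) (D Q)) (D Q) \<noteq> 0"
proof -
  have "D Q \<noteq> 0"
  proof
    assume "D Q = 0"
    then have "ip (D Q) (D Q) = 0" by (simp add: ip.zero_left)
    then show False using hypersurfaceD(3)[OF assms] by simp
  qed
  then show ?thesis by (rule shape_tangent(3)[OF hypersurfaceD(1,2)[OF assms]])
qed

text \<open>The coordinates \<open>(a, b, \<theta>)\<close> identify the tangent space with three-space, so a nontrivial linear
equation in them defines a plane.\<close>

lemma dim_tangent_plane:
  assumes Q: "Q \<in> H" and fr: "frame (snd Q) (D Q) w (\<nu> (snd Q))" and c: "(c1, c2, c3) \<noteq> (0, 0, 0)"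
  defines "E \<equiv> {X \<in> tangent_space H Q. c1 * ip (snd X) (D Q) + c2 * ip (snd X) w + c3 * ip (dD Q X) w = 0}"
  shows "subspace E" "dim E = 2"
proof -
  define L where "L = (\<lambda>X. (ip (snd X) (D Q), ip (snd X) w, ip (dD Q X) w))"
  have lin: "linear L"
    by (rule linearI) (auto simp: L_def ip_simps linear_add[OF linear_dD] linear_scale[OF linear_dD])
  note T = subspace_tangent_space_H[OF Q]
  have "E = tangent_space H Q \<inter> L -` {z. (c1, c2, c3) \<bullet> z = 0}"
    by (auto simp: E_def L_def inner_prod_def)
  then show E: "subspace E"
    using subspace_inter[OF T linear_subspace_vimage[OF lin subspace_hyperplane]] by simp
  have inj: "inj_on L (tangent_space H Q)"
  proof (rule inj_onI)
    fix X Y assume X: "X \<in> tangent_space H Q" and Y: "Y \<in> tangent_space H Q" and e: "L X = L Y"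
    have s: "snd X = snd Y"
      using tangent_H_coords(1)[OF Q fr X] tangent_H_coords(1)[OF Q fr Y] e by (simp add: L_def)
    have "ip (dD Q X) (\<nu> (snd Q)) = ip (dD Q Y) (\<nu> (snd Q))"
      using tangent_space_H(4)[OF X normal] tangent_space_H(4)[OF Y normal] s by simp
    then have "dD Q X = dD Q Y"
      using tangent_H_coords(2)[OF Q fr X] tangent_H_coords(2)[OF Q fr Y] e by (simp add: L_def)
    then show "X = Y" using tangent_space_H_eqI[OF X Y s] by simp
  qed
  have "L ` E = {z. (c1, c2, c3) \<bullet> z = 0}"
  proof (intro equalityI subsetI)
    fix z assume z: "z \<in> {z. (c1, c2, c3) \<bullet> z = 0}"
    obtain a b t where abt: "z = (a, b, t)" by (cases z)
    from tangent_H_coords_exist[OF Q fr, of a b t] show "z \<in> L ` E"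
      using z by (force simp: abt E_def L_def inner_prod_def)
  qed (auto simp: E_def L_def inner_prod_def)
  then have "dim (L ` E) = 2"
    using dim_hyperplane[of "(c1, c2, c3)"] c by (simp add: zero_prod_def)
  moreover have "inj_on L (span E)"
    unfolding span_eq_iff[THEN iffD2, OF E] by (rule inj_on_subset[OF inj]) (auto simp: E_def)
  ultimately show "dim E = 2" using dim_image_eq[OF lin] by simp
qed

end

section \<open>The null planes\<close>

text \<open>What is used about the neutral metric and the complex structure, in terms of the coordinates
\<open>(a, b, \<theta>, h)\<close> of a variation of a geodesic. The sign of \<open>\<kappa>\<close> and \<open>s\<close> depends on the orientation of
the frame, hence the existential quantifiers. The last assumption says that moving the point along
the geodesic does not change the geodesic.\<close>

locale neutral_space = geodesic_space F K D dgeod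
  for F :: "('m::euclidean_space, 'l::euclidean_space) space_form" and K D dgeod +
  assumes neutral_frame: "frame p v w n \<Longrightarrow> \<exists>\<kappa>. \<kappa> \<noteq> 0 \<and>
      (\<forall>a1 b1 t1 h1 a2 b2 t2 h2. neutral F (geod F p v)
        (dgeod p v (a1 *\<^sub>R v + b1 *\<^sub>R w) (t1 *\<^sub>R w + h1 *\<^sub>R n - (K * a1) *\<^sub>R p))
        (dgeod p v (a2 *\<^sub>R v + b2 *\<^sub>R w) (t2 *\<^sub>R w + h2 *\<^sub>R n - (K * a2) *\<^sub>R p)) = \<kappa> * (b1 * h2 + b2 * h1))"
    and alpha_frame: "frame p v w n \<Longrightarrow> \<exists>s. s \<noteq> 0 \<and>
      (\<forall>a t h. alpha_cx F (geod F p v) (dgeod p v (a *\<^sub>R v) (t *\<^sub>R w + h *\<^sub>R n - (K * a) *\<^sub>R p))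
        = dgeod p v 0 (s *\<^sub>R (t *\<^sub>R n - h *\<^sub>R w)))"
    and dgeod_along: "frame p v w n \<Longrightarrow>
      dgeod p v (a *\<^sub>R v) (t *\<^sub>R w + h *\<^sub>R n - (K * a) *\<^sub>R p) = dgeod p v 0 (t *\<^sub>R w + h *\<^sub>R n)"

locale convex_surface_neutral = convex_surface F K D dgeod S \<nu> + neutral_space F K D dgeod
  for F :: "('m::euclidean_space, 'l::euclidean_space) space_form" and K D dgeod S \<nu>
begin

text \<open>The vectors for which the point of tangency moves along the geodesic.\<close>

definition along_plane :: "'l \<times> 'm \<Rightarrow> ('l \<times> 'm) set" where
  "along_plane Q = {X \<in> tangent_space H Q. snd X \<in> span {D Q}}"

text \<open>The vectors for which the velocity of the point of tangency is conjugate to the direction of the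
geodesic with respect to the second fundamental form.\<close>

definition conjugate_plane :: "'l \<times> 'm \<Rightarrow> ('l \<times> 'm) set" where
  "conjugate_plane Q = {X \<in> tangent_space H Q. ip (shape (snd Q) (snd X)) (D Q) = 0}"

context
  fixes Q w
  assumes Q: "Q \<in> H" and fr: "frame (snd Q) (D Q) w (\<nu> (snd Q))"
begin

lemma along_plane_eq: "along_plane Q = {X \<in> tangent_space H Q. ip (snd X) w = 0}"
proof -
  have "snd X \<in> span {D Q} \<longleftrightarrow> ip (snd X) w = 0" if "X \<in> tangent_space H Q" for X
  proof
    assume "snd X \<in> span {D Q}"
    then obtain k where "snd X = k *\<^sub>R D Q" by (auto simp: span_singleton)
    then show "ip (snd X) w = 0" using frameD[OF fr] by (simp add: ip_simps)
  next
    assume "ip (snd X) w = 0"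
    then show "snd X \<in> span {D Q}"
      by (subst tangent_H_coords(1)[OF Q fr that]) (simp add: span_base span_scale)
  qed
  then show ?thesis unfolding along_plane_def by blast
qed

lemma shape_coords:
  assumes "X \<in> tangent_space H Q"
  shows "ip (dD Q X) (\<nu> (snd Q)) = ip (snd X) (D Q) * ip (shape (snd Q) (D Q)) (D Q) + ip (snd X) w * ip (shape (snd Q) w) (D Q)"
proof -
  have A: "linear (shape (snd Q))" by (rule shape_tangent(1)[OF hypersurfaceD(1)[OF Q]])
  have "shape (snd Q) (snd X) = ip (snd X) (D Q) *\<^sub>R shape (snd Q) (D Q) + ip (snd X) w *\<^sub>R shape (snd Q) w"
    by (subst tangent_H_coords(1)[OF Q fr assms]) (simp add: linear_add[OF A] linear_scale[OF A])
  then show ?thesis using tangent_space_H(4)[OF assms normal] by (simp add: ip_simps)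
qed

lemma conjugate_plane_eq: "conjugate_plane Q = {X \<in> tangent_space H Q. ip (dD Q X) (\<nu> (snd Q)) = 0}"
  by (auto simp: conjugate_plane_def tangent_space_H(4)[OF _ normal])

lemma plane_dims: "subspace (along_plane Q)" "dim (along_plane Q) = 2" "subspace (conjugate_plane Q)" "dim (conjugate_plane Q) = 2"
proof -
  have a: "along_plane Q = {X \<in> tangent_space H Q. 0 * ip (snd X) (D Q) + 1 * ip (snd X) w + 0 * ip (dD Q X) w = 0}"
    unfolding along_plane_eq by simp
  have b: "conjugate_plane Q = {X \<in> tangent_space H Q. ip (shape (snd Q) (D Q)) (D Q) * ip (snd X) (D Q)
      + ip (shape (snd Q) w) (D Q) * ip (snd X) w + 0 * ip (dD Q X) w = 0}"
    unfolding conjugate_plane_eq using shape_coords by (auto simp: mult.commute)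
  show "subspace (along_plane Q)" "dim (along_plane Q) = 2"
    unfolding a by (rule dim_tangent_plane[OF Q fr]; simp)+
  show "subspace (conjugate_plane Q)" "dim (conjugate_plane Q) = 2"
    unfolding b by (rule dim_tangent_plane[OF Q fr]; use shape_direction[OF Q] in simp)+
qed

lemma fst_coords:
  assumes "X \<in> tangent_space H Q"
  shows "fst X = dgeod (snd Q) (D Q) (ip (snd X) (D Q) *\<^sub>R D Q + ip (snd X) w *\<^sub>R w)
      (ip (dD Q X) w *\<^sub>R w + ip (dD Q X) (\<nu> (snd Q)) *\<^sub>R \<nu> (snd Q) - (K * ip (snd X) (D Q)) *\<^sub>R snd Q)"
  unfolding tangent_H_coords(1)[OF Q fr assms, symmetric] tangent_H_coords(2)[OF Q fr assms, symmetric]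
  by (rule tangent_space_H(2)[OF assms])

lemma neutral_H:
  "\<exists>\<kappa>. \<kappa> \<noteq> 0 \<and>
    (\<forall>X\<in>tangent_space H Q. \<forall>Y\<in>tangent_space H Q. neutral F (fst Q) (fst X) (fst Y)
      = \<kappa> * (ip (snd X) w * ip (dD Q Y) (\<nu> (snd Q)) + ip (snd Y) w * ip (dD Q X) (\<nu> (snd Q)))) \<and>
    (\<forall>X\<in>tangent_space H Q. neutral F (fst Q) (fst X) (dgeod (snd Q) (D Q) w 0)
       = \<kappa> * ip (dD Q X) (\<nu> (snd Q))) \<and>
    (\<forall>h. neutral F (fst Q) (dgeod (snd Q) (D Q) 0 (h *\<^sub>R \<nu> (snd Q))) (dgeod (snd Q) (D Q) w 0) = \<kappa> * h)"
proof -
  obtain \<kappa> where \<kappa>: "\<kappa> \<noteq> 0" and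
    N: "\<And>a1 b1 t1 h1 a2 b2 t2 h2. neutral F (geod F (snd Q) (D Q))
        (dgeod (snd Q) (D Q) (a1 *\<^sub>R D Q + b1 *\<^sub>R w) (t1 *\<^sub>R w + h1 *\<^sub>R \<nu> (snd Q) - (K * a1) *\<^sub>R snd Q))
        (dgeod (snd Q) (D Q) (a2 *\<^sub>R D Q + b2 *\<^sub>R w) (t2 *\<^sub>R w + h2 *\<^sub>R \<nu> (snd Q) - (K * a2) *\<^sub>R snd Q)) = \<kappa> * (b1 * h2 + b2 * h1)"
    using neutral_frame[OF fr] by blast
  show ?thesis
  proof (intro exI conjI ballI allI)
    show "\<kappa> \<noteq> 0" by (rule \<kappa>)
    fix X assume X: "X \<in> tangent_space H Q"
    show "neutral F (fst Q) (fst X) (dgeod (snd Q) (D Q) w 0) = \<kappa> * ip (dD Q X) (\<nu> (snd Q))"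
      unfolding hypersurfaceD(4)[OF Q] fst_coords[OF X] using N[where ?a2.0 = 0 and ?b2.0 = 1 and ?t2.0 = 0 and ?h2.0 = 0] by simp
    fix Y assume Y: "Y \<in> tangent_space H Q"
    show "neutral F (fst Q) (fst X) (fst Y)
      = \<kappa> * (ip (snd X) w * ip (dD Q Y) (\<nu> (snd Q)) + ip (snd Y) w * ip (dD Q X) (\<nu> (snd Q)))"
      unfolding hypersurfaceD(4)[OF Q] fst_coords[OF X] fst_coords[OF Y] by (rule N)
  next
    fix h show "neutral F (fst Q) (dgeod (snd Q) (D Q) 0 (h *\<^sub>R \<nu> (snd Q))) (dgeod (snd Q) (D Q) w 0) = \<kappa> * h"
      unfolding hypersurfaceD(4)[OF Q]
      using N[where ?a1.0 = 0 and ?b1.0 = 0 and ?t1.0 = 0 and ?h1.0 = h and ?a2.0 = 0 and ?b2.0 = 1 and ?t2.0 = 0 and ?h2.0 = 0] by simp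
  qed
qed

text \<open>The neutral metric is the product of the linear forms \<open>b\<close> and \<open>h\<close>. A plane on which the product of two
linear forms vanishes is contained in the kernel of one of them.\<close>

lemma null_plane_iff: "null_plane F S Q E \<longleftrightarrow> E = along_plane Q \<or> E = conjugate_plane Q"
proof
  obtain \<kappa> where \<kappa>: "\<kappa> \<noteq> 0" and N: "\<And>X Y. X \<in> tangent_space H Q \<Longrightarrow> Y \<in> tangent_space H Q \<Longrightarrow> neutral F (fst Q) (fst X) (fst Y)
      = \<kappa> * (ip (snd X) w * ip (dD Q Y) (\<nu> (snd Q)) + ip (snd Y) w * ip (dD Q X) (\<nu> (snd Q)))"
    using neutral_H by blast
  show "null_plane F S Q E" if "E = along_plane Q \<or> E = conjugate_plane Q"
    using that
  proof
    assume "E = along_plane Q"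
    then show ?thesis unfolding null_plane_def using plane_dims N by (auto simp: along_plane_eq)
  next
    assume "E = conjugate_plane Q"
    then show ?thesis unfolding null_plane_def using plane_dims N by (auto simp: conjugate_plane_eq)
  qed
  assume E: "null_plane F S Q E"
  then have sE: "subspace E" and dE: "dim E = 2" and ET: "E \<subseteq> tangent_space H Q"
    and null: "\<And>X. X \<in> E \<Longrightarrow> neutral F (fst Q) (fst X) (fst X) = 0"
    unfolding null_plane_def by auto
  let ?b = "\<lambda>X. ip (snd X) w" and ?h = "\<lambda>X. ip (dD Q X) (\<nu> (snd Q))"
  have bh: "?b X = 0 \<or> ?h X = 0" if "X \<in> E" for X
    using null[OF that] N[of X X] \<kappa> that ET by auto
  have "E \<subseteq> along_plane Q \<or> E \<subseteq> conjugate_plane Q"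
  proof (rule ccontr)
    assume "\<not> (E \<subseteq> along_plane Q \<or> E \<subseteq> conjugate_plane Q)"
    then obtain X Y where X: "X \<in> E" "?b X \<noteq> 0" and Y: "Y \<in> E" "?h Y \<noteq> 0"
      unfolding along_plane_eq conjugate_plane_eq using ET by blast
    have "?h X = 0" "?b Y = 0" using bh[OF X(1)] bh[OF Y(1)] X(2) Y(2) by auto
    then have "?b (X + Y) \<noteq> 0" "?h (X + Y) \<noteq> 0"
      using X(2) Y(2) by (simp_all add: ip_simps linear_add[OF linear_dD])
    then show False using bh[OF subspace_add[OF sE X(1) Y(1)]] by blast
  qed
  then show "E = along_plane Q \<or> E = conjugate_plane Q"
    using subspace_dim_equal[OF sE plane_dims(1)] subspace_dim_equal[OF sE plane_dims(3)] dE plane_dims(2,4) by auto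
qed

text \<open>The complex structure sends \<open>(\<theta>, h)\<close> to a multiple of \<open>(-h, \<theta>)\<close>. Any such pair occurs on the plane
\<open>b = 0\<close>, for a suitable \<open>a\<close>, because \<open>h = a \<langle>A v, v\<rangle>\<close> there and \<open>\<langle>A v, v\<rangle> \<noteq> 0\<close>.\<close>

lemma along_plane_invariant: "alpha_cx F (fst Q) ` fst ` along_plane Q \<subseteq> fst ` along_plane Q"
proof clarify
  let ?p = "snd Q" and ?v = "D Q" and ?n = "\<nu> (snd Q)"
  obtain s where s: "\<And>a t h. alpha_cx F (geod F ?p ?v) (dgeod ?p ?v (a *\<^sub>R ?v) (t *\<^sub>R w + h *\<^sub>R ?n - (K * a) *\<^sub>R ?p))
        = dgeod ?p ?v 0 (s *\<^sub>R (t *\<^sub>R ?n - h *\<^sub>R w))"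
    using alpha_frame[OF fr] by blast
  fix \<gamma> p assume "(\<gamma>, p) \<in> along_plane Q"
  then obtain X where X: "X \<in> tangent_space H Q" "ip (snd X) w = 0" "\<gamma> = fst X"
    unfolding along_plane_eq by force
  let ?t = "ip (dD Q X) w" and ?h = "ip (dD Q X) ?n"
  have "fst X = dgeod ?p ?v (ip (snd X) ?v *\<^sub>R ?v) (?t *\<^sub>R w + ?h *\<^sub>R ?n - (K * ip (snd X) ?v) *\<^sub>R ?p)"
    using fst_coords[OF X(1)] X(2) by simp
  then have cx: "alpha_cx F (fst Q) \<gamma> = dgeod ?p ?v 0 (s *\<^sub>R (?t *\<^sub>R ?n - ?h *\<^sub>R w))"
    using s hypersurfaceD(4)[OF Q] X(3) by simp
  let ?a = "s * ?t / ip (shape ?p ?v) ?v"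
  obtain Y where Y: "Y \<in> tangent_space H Q" "ip (snd Y) ?v = ?a" "ip (snd Y) w = 0" "ip (dD Q Y) w = - s * ?h"
    using tangent_H_coords_exist[OF Q fr, of ?a 0 "- s * ?h"] by blast
  have "ip (dD Q Y) ?n = s * ?t"
    using shape_coords[OF Y(1)] Y shape_direction[OF Q] by simp
  then have "fst Y = dgeod ?p ?v (?a *\<^sub>R ?v) ((- s * ?h) *\<^sub>R w + (s * ?t) *\<^sub>R ?n - (K * ?a) *\<^sub>R ?p)"
    using fst_coords[OF Y(1)] Y(2-) by simp
  also have "\<dots> = dgeod ?p ?v 0 ((- s * ?h) *\<^sub>R w + (s * ?t) *\<^sub>R ?n)" by (rule dgeod_along[OF fr])
  also have "\<dots> = alpha_cx F (fst Q) \<gamma>" by (simp add: cx algebra_simps)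
  finally have "alpha_cx F (fst Q) \<gamma> = fst Y" by simp
  moreover have "Y \<in> along_plane Q" using Y by (simp add: along_plane_eq)
  ultimately show "alpha_cx F (fst Q) (fst (\<gamma>, p)) \<in> fst ` along_plane Q" by simp
qed

text \<open>The direction of the fibre, with \<open>\<theta> = 1\<close> and \<open>a = b = h = 0\<close>, is sent to a variation of the geodesic
with \<open>h \<noteq> 0\<close>. That the latter is not induced by any vector with \<open>h = 0\<close> is detected by the neutral product
with the variation which moves the point in the direction of \<open>w\<close>.\<close>

lemma conjugate_plane_not_invariant: "\<not> alpha_cx F (fst Q) ` fst ` conjugate_plane Q \<subseteq> fst ` conjugate_plane Q"
proof
  let ?p = "snd Q" and ?v = "D Q" and ?n = "\<nu> (snd Q)"
  obtain s where s0: "s \<noteq> 0" and s: "\<And>a t h. alpha_cx F (geod F ?p ?v) (dgeod ?p ?v (a *\<^sub>R ?v) (t *\<^sub>R w + h *\<^sub>R ?n - (K * a) *\<^sub>R ?p))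
        = dgeod ?p ?v 0 (s *\<^sub>R (t *\<^sub>R ?n - h *\<^sub>R w))"
    using alpha_frame[OF fr] by blast
  obtain \<kappa> where \<kappa>: "\<kappa> \<noteq> 0"
    and N: "\<And>X h. X \<in> tangent_space H Q \<Longrightarrow> neutral F (fst Q) (fst X) (dgeod (snd Q) (D Q) w 0)
       = \<kappa> * ip (dD Q X) (\<nu> (snd Q))"
    "\<And>h. neutral F (fst Q) (dgeod (snd Q) (D Q) 0 (h *\<^sub>R \<nu> (snd Q))) (dgeod (snd Q) (D Q) w 0) = \<kappa> * h"
    using neutral_H by blast
  assume inv: "alpha_cx F (fst Q) ` fst ` conjugate_plane Q \<subseteq> fst ` conjugate_plane Q"
  obtain X where X: "X \<in> tangent_space H Q" "ip (snd X) ?v = 0" "ip (snd X) w = 0" "ip (dD Q X) w = 1"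
    using tangent_H_coords_exist[OF Q fr, of 0 0 1] by blast
  have h: "ip (dD Q X) ?n = 0" using shape_coords[OF X(1)] X by simp
  then have "X \<in> conjugate_plane Q" using X by (simp add: conjugate_plane_eq)
  then obtain Y where Y: "Y \<in> conjugate_plane Q" "alpha_cx F (fst Q) (fst X) = fst Y" using inv by blast
  have "fst X = dgeod ?p ?v 0 w"
    using fst_coords[OF X(1)] X(2-) h by simp
  then have "fst Y = dgeod ?p ?v 0 (s *\<^sub>R ?n)"
    using s[of 0 1 0] hypersurfaceD(4)[OF Q] Y(2) by simp
  then have "\<kappa> * s = \<kappa> * ip (dD Q Y) ?n" using N(1)[of Y] N(2)[of s] Y(1) by (simp add: conjugate_plane_def)
  then show False using \<kappa> s0 Y(1) by (simp add: conjugate_plane_eq)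
qed

lemma along_plane_neq_conjugate_plane: "along_plane Q \<noteq> conjugate_plane Q"
  using along_plane_invariant conjugate_plane_not_invariant by metis

lemma alpha_plane_frame: "alpha_plane F S Q = along_plane Q"
  unfolding alpha_plane_def
  by (rule the_equality) (use null_plane_iff along_plane_invariant conjugate_plane_not_invariant in blast)+

lemma beta_plane_frame: "beta_plane F S Q = conjugate_plane Q"
  unfolding beta_plane_def alpha_plane_frame
  by (rule the_equality) (use null_plane_iff along_plane_neq_conjugate_plane in blast)+

end

lemma H_frame:
  assumes "Q \<in> H"
  obtains w where "w \<in> tangent_space S (snd Q)" "frame (snd Q) (D Q) w (\<nu> (snd Q))"
  using tangent_frame hypersurfaceD[OF assms] by metis

lemma alpha_plane_eq:
  assumes "Q \<in> H"
  shows "alpha_plane F S Q = {X \<in> tangent_space H Q. snd X \<in> span {D Q}}"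
proof -
  obtain w where "frame (snd Q) (D Q) w (\<nu> (snd Q))" using H_frame[OF assms] by blast
  from alpha_plane_frame[OF assms this] show ?thesis by (simp add: along_plane_def)
qed

lemma beta_plane_eq:
  assumes "Q \<in> H"
  shows "beta_plane F S Q = {X \<in> tangent_space H Q. ip (shape (snd Q) (snd X)) (D Q) = 0}"
proof -
  obtain w where "frame (snd Q) (D Q) w (\<nu> (snd Q))" using H_frame[OF assms] by blast
  from beta_plane_frame[OF assms this] show ?thesis by (simp add: conjugate_plane_def)
qed

end

section \<open>Contact structures\<close>

context convex_surface_neutral begin

lemma frame_tangent:
  assumes Q: "Q \<in> H" and fr: "frame (snd Q) (D Q) w (\<nu> (snd Q))" and z: "z \<in> tangent_space S (snd Q)"
  shows "z = ip z (D Q) *\<^sub>R D Q + ip z w *\<^sub>R w"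
  using frame_expand[OF fr, of z] z by (simp add: tangent_space_S[OF hypersurfaceD(1)[OF Q]])

lemma snd_has_derivative: "(snd has_derivative snd) (at Q)"
  by (rule bounded_linear_imp_has_derivative[OF bounded_linear_snd])

lemma normal_snd_has_derivative:
  assumes "Q \<in> H"
  shows "((\<lambda>P. \<nu> (snd P)) has_derivative (\<lambda>X. - shape (snd Q) (snd X))) (at Q)"
  using diff_chain_at[OF snd_has_derivative normal_has_derivative[OF normal hypersurfaceD(1)[OF assms]]]
  by (simp add: o_def)

text \<open>Near \<open>Q\<^sub>0\<close>, let \<open>W\<close> be the projection of a fixed vector \<open>w\<^sub>0\<close> to the orthogonal complement of \<open>v\<close> in the
tangent plane of \<open>S\<close>. The form \<open>\<langle>dp, W\<rangle>\<close> defines the \<open>\<alpha>\<close>-planes. Differentiating \<open>\<langle>W, v\<rangle> = 0\<close> in the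
direction of the fibre gives its exterior derivative on the pair formed by the fibre direction and the
horizontal lift of \<open>v\<close>; on both of these vectors the form itself vanishes.\<close>

theorem contact_alpha: "contact_structure H (alpha_plane F S)"
  unfolding contact_structure_def
proof
  fix Q\<^sub>0 assume Q\<^sub>0: "Q\<^sub>0 \<in> H"
  obtain w\<^sub>0 where fr\<^sub>0: "frame (snd Q\<^sub>0) (D Q\<^sub>0) w\<^sub>0 (\<nu> (snd Q\<^sub>0))" by (rule H_frame[OF Q\<^sub>0])
  obtain N where N: "open N" "S \<subseteq> N" "smooth_on \<nu> N" by (rule smooth_normal)
  define G where "G = (snd -` N :: ('l \<times> 'm) set)"
  define W where "W Q = w\<^sub>0 - ip w\<^sub>0 (D Q) *\<^sub>R D Q - ip w\<^sub>0 (\<nu> (snd Q)) *\<^sub>R \<nu> (snd Q) - (K * ip w\<^sub>0 (snd Q)) *\<^sub>R snd Q" for Q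
  define U where "U = {Q \<in> G. 0 < ip (W Q) w\<^sub>0}"
  define \<omega> where "\<omega> Q X = ip (snd X) (W Q)" for Q and X :: "'l \<times> 'm"
  have oG: "open G" unfolding G_def by (intro open_vimage N continuous_intros)
  have HG: "H \<subseteq> G" using hypersurfaceD(1) N(2) by (auto simp: G_def)
  have smD: "smooth_on D G" by (rule smooth_on_subset[OF smooth_D]) simp
  have smP: "smooth_on snd G" by (rule smooth_on_snd[OF oG smooth_on_ident[OF oG]])
  have smn: "smooth_on (\<lambda>Q. \<nu> (snd Q)) G"
    by (rule smooth_on_compose[OF oG N(1) _ N(3) smP]) (auto simp: G_def)
  note smip = smooth_on_bilinear[OF oG metric_bilinear]
  have smW: "smooth_on W G"
    unfolding W_def
    by (rule smooth_on_diff[OF oG smooth_on_diff[OF oG smooth_on_diff[OF oG smooth_on_const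
      smooth_on_scaleR[OF oG smip[OF smooth_on_const smD] smD]] smooth_on_scaleR[OF oG smip[OF smooth_on_const smn] smn]]
      smooth_on_scaleR[OF oG smooth_on_linear[OF oG bounded_linear_mult_right smip[OF smooth_on_const smP]] smP]])
  have "continuous_on G (\<lambda>Q. ip (W Q) w\<^sub>0)"
    by (rule smooth_on_imp_continuous_on[OF smip[OF smW smooth_on_const]])
  from continuous_open_preimage[OF this oG open_greaterThan[of 0]]
  have oU: "open U" by (simp add: U_def vimage_def Int_def)
  have UG: "U \<subseteq> G" by (auto simp: U_def)
  note f\<^sub>0 = frameD[OF fr\<^sub>0]
  have "W Q\<^sub>0 = w\<^sub>0" using f\<^sub>0 by (simp add: W_def)
  then have Q\<^sub>0U: "Q\<^sub>0 \<in> U" using HG Q\<^sub>0 f\<^sub>0 by (auto simp: U_def)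
  have form: "one_form_on U \<omega>"
    unfolding one_form_on_def
  proof (intro conjI ballI allI)
    show "linear (\<omega> P)" for P by (rule linearI) (simp_all add: \<omega>_def ip_simps)
    show "smooth_on (\<lambda>P. \<omega> P X) U" for X
      unfolding \<omega>_def by (rule smooth_on_subset[OF smip[OF smooth_on_const smW] UG])
  qed
  have perp: "ip (W Q) (D Q) = 0" "W Q \<in> tangent_space S (snd Q)" if Q: "Q \<in> H" for Q
  proof -
    obtain w where "frame (snd Q) (D Q) w (\<nu> (snd Q))" by (rule H_frame[OF Q])
    note f = frameD[OF this]
    have pe: "K = 0 \<or> ip (snd Q) (D Q) = 0 \<and> ip (snd Q) (\<nu> (snd Q)) = 0"
      "K = 0 \<or> ip (D Q) (snd Q) = 0 \<and> ip (\<nu> (snd Q)) (snd Q) = 0"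
      using f by auto
    show "ip (W Q) (D Q) = 0" using pe by (auto simp: W_def ip_simps f)
    have "K * (ip w\<^sub>0 (snd Q) * (K * ip (snd Q) (snd Q))) = K * ip w\<^sub>0 (snd Q)"
      using proj_carrier[OF f(1)] by (metis mult.assoc mult.commute)
    then have "K * ip (W Q) (snd Q) = 0"
      using pe by (auto simp: W_def ip_simps right_diff_distrib)
    moreover have "ip (W Q) (\<nu> (snd Q)) = 0" using pe by (auto simp: W_def ip_simps f)
    ultimately show "W Q \<in> tangent_space S (snd Q)"
      by (simp add: tangent_space_S[OF hypersurfaceD(1)[OF Q]])
  qed
  show "\<exists>U \<omega>. open U \<and> Q\<^sub>0 \<in> U \<and> one_form_on U \<omega> \<and>
     (\<forall>Q\<in>H \<inter> U. alpha_plane F S Q = {X \<in> tangent_space H Q. \<omega> Q X = 0} \<and>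
        (\<exists>X\<in>tangent_space H Q. \<exists>Y\<in>tangent_space H Q. \<exists>Z\<in>tangent_space H Q.
           \<omega> Q X * ext_deriv \<omega> Q Y Z + \<omega> Q Y * ext_deriv \<omega> Q Z X + \<omega> Q Z * ext_deriv \<omega> Q X Y \<noteq> 0))"
  proof (rule exI[of _ U], rule exI[of _ \<omega>], intro conjI oU Q\<^sub>0U form ballI)
    fix Q assume "Q \<in> H \<inter> U"
    then have Q: "Q \<in> H" and QU: "Q \<in> U" by auto
    obtain w where fr: "frame (snd Q) (D Q) w (\<nu> (snd Q))" by (rule H_frame[OF Q])
    define l where "l = ip (W Q) w"
    have Wl: "W Q = l *\<^sub>R w"
      using frame_tangent[OF Q fr perp(2)[OF Q]] perp(1)[OF Q] by (simp add: l_def)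
    have l0: "l \<noteq> 0" using QU Wl by (auto simp: U_def ip.zero_left)
    have \<omega>w: "\<omega> Q X = l * ip (snd X) w" for X by (simp add: \<omega>_def Wl ip_simps)
    show "alpha_plane F S Q = {X \<in> tangent_space H Q. \<omega> Q X = 0}"
      unfolding alpha_plane_frame[OF Q fr] along_plane_eq[OF Q fr] \<omega>w using l0 by simp
    obtain X where X: "X \<in> tangent_space H Q" "ip (snd X) (D Q) = 0" "ip (snd X) w = 1" "ip (dD Q X) w = 0"
      using tangent_H_coords_exist[OF Q fr, of 0 1 0] by blast
    obtain Y where Y: "Y \<in> tangent_space H Q" "ip (snd Y) (D Q) = 0" "ip (snd Y) w = 0" "ip (dD Q Y) w = 1"
      using tangent_H_coords_exist[OF Q fr, of 0 0 1] by blast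
    obtain Z where Z: "Z \<in> tangent_space H Q" "ip (snd Z) (D Q) = 1" "ip (snd Z) w = 0" "ip (dD Q Z) w = 0"
      using tangent_H_coords_exist[OF Q fr, of 1 0 0] by blast
    have sY: "snd Y = 0" by (subst tangent_H_coords(1)[OF Q fr Y(1)]) (simp add: Y)
    have sZ: "snd Z = D Q" by (subst tangent_H_coords(1)[OF Q fr Z(1)]) (simp add: Z)
    have dW: "(W has_derivative frechet_derivative W (at Q)) (at Q)"
      by (rule smooth_on_has_derivative[OF smW]) (use Q HG in blast)
    have "((\<lambda>P. ip (snd Z) (W P)) has_derivative (\<lambda>h. ip (snd Z) (frechet_derivative W (at Q) h))) (at Q)"
      by (rule bounded_linear.has_derivative[OF ip.bounded_linear_right dW])
    then have 1: "frechet_derivative (\<lambda>P. \<omega> P Z) (at Q) Y = ip (D Q) (frechet_derivative W (at Q) Y)"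
      unfolding \<omega>_def by (simp add: frechet_derivative_eq sZ)
    have 2: "frechet_derivative (\<lambda>P. \<omega> P Y) (at Q) Z = 0"
      unfolding \<omega>_def sY by (simp add: ip.zero_left)
    have "ip (W Q) (dD Q Y) + ip (frechet_derivative W (at Q) Y) (D Q) = 0"
      by (rule derivative_zero_of_constant[OF ip.FDERIV[OF dW D_has_derivative] oU QU perp(1) Y(1)])
    then have "ip (D Q) (frechet_derivative W (at Q) Y) = - l"
      using Y(4) metric_sym[of w] by (simp add: Wl ip_simps metric_sym[of "D Q"])
    then have "ext_deriv \<omega> Q Y Z = - l" by (simp add: ext_deriv_def 1 2)
    moreover have "\<omega> Q X = l" "\<omega> Q Y = 0" "\<omega> Q Z = 0" using X Y Z by (simp_all add: \<omega>w)
    ultimately have "\<omega> Q X * ext_deriv \<omega> Q Y Z + \<omega> Q Y * ext_deriv \<omega> Q Z X + \<omega> Q Z * ext_deriv \<omega> Q X Y \<noteq> 0"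
      using l0 by simp
    then show "\<exists>X\<in>tangent_space H Q. \<exists>Y\<in>tangent_space H Q. \<exists>Z\<in>tangent_space H Q.
           \<omega> Q X * ext_deriv \<omega> Q Y Z + \<omega> Q Y * ext_deriv \<omega> Q Z X + \<omega> Q Z * ext_deriv \<omega> Q X Y \<noteq> 0"
      using X(1) Y(1) Z(1) by blast
  qed
qed

text \<open>On the tangent hypersurface \<open>\<langle>A dp, v\<rangle> = \<langle>dv, \<nu>\<rangle>\<close>. The right-hand side has the advantage that the second
derivatives of \<open>D\<close> cancel in its exterior derivative, while the derivatives of \<open>\<nu>\<close> are given by \<open>A\<close>.
The exterior derivative is evaluated on the fibre direction and a lift of a vector conjugate to \<open>v\<close>.\<close>

theorem contact_beta: "contact_structure H (beta_plane F S)"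
  unfolding contact_structure_def
proof
  fix Q\<^sub>0 assume Q\<^sub>0: "Q\<^sub>0 \<in> H"
  obtain N where N: "open N" "S \<subseteq> N" "smooth_on \<nu> N" by (rule smooth_normal)
  define G where "G = (snd -` N :: ('l \<times> 'm) set)"
  define \<omega> where "\<omega> Q X = ip (dD Q X) (\<nu> (snd Q))" for Q X
  have oG: "open G" unfolding G_def by (intro open_vimage N continuous_intros)
  have HG: "H \<subseteq> G" using hypersurfaceD(1) N(2) by (auto simp: G_def)
  have smn: "smooth_on (\<lambda>Q. \<nu> (snd Q)) G"
    by (rule smooth_on_compose[OF oG N(1) _ N(3) smooth_on_snd[OF oG smooth_on_ident[OF oG]]]) (auto simp: G_def)
  have smD: "smooth_on (\<lambda>Q. dD Q X) UNIV" for X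
    by (rule smooth_on_frechet_derivative[OF smooth_D])
  have form: "one_form_on G \<omega>"
    unfolding one_form_on_def
  proof (intro conjI ballI allI)
    show "linear (\<omega> P)" for P
      by (rule linearI) (simp_all add: \<omega>_def ip_simps linear_add[OF linear_dD] linear_scale[OF linear_dD])
    show "smooth_on (\<lambda>P. \<omega> P X) G" for X
      unfolding \<omega>_def
      by (rule smooth_on_bilinear[OF oG metric_bilinear smooth_on_subset[OF smD] smn]) simp
  qed
  show "\<exists>U \<omega>. open U \<and> Q\<^sub>0 \<in> U \<and> one_form_on U \<omega> \<and>
     (\<forall>Q\<in>H \<inter> U. beta_plane F S Q = {X \<in> tangent_space H Q. \<omega> Q X = 0} \<and>
        (\<exists>X\<in>tangent_space H Q. \<exists>Y\<in>tangent_space H Q. \<exists>Z\<in>tangent_space H Q.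
           \<omega> Q X * ext_deriv \<omega> Q Y Z + \<omega> Q Y * ext_deriv \<omega> Q Z X + \<omega> Q Z * ext_deriv \<omega> Q X Y \<noteq> 0))"
  proof (rule exI[of _ G], rule exI[of _ \<omega>], intro conjI oG form ballI)
    show "Q\<^sub>0 \<in> G" using Q\<^sub>0 HG by blast
    fix Q assume "Q \<in> H \<inter> G"
    then have Q: "Q \<in> H" by auto
    let ?A = "shape (snd Q)"
    obtain w where fr: "frame (snd Q) (D Q) w (\<nu> (snd Q))" by (rule H_frame[OF Q])
    show "beta_plane F S Q = {X \<in> tangent_space H Q. \<omega> Q X = 0}"
      unfolding beta_plane_frame[OF Q fr] conjugate_plane_eq[OF Q fr] \<omega>_def ..
    have \<omega>s: "\<omega> Q X = ip (?A (snd X)) (D Q)" if "X \<in> tangent_space H Q" for X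
      unfolding \<omega>_def by (rule tangent_space_H(4)[OF that normal])
    have ext: "ext_deriv \<omega> Q Y Z = ip (dD Q Y) (?A (snd Z)) - ip (dD Q Z) (?A (snd Y))" for Y Z
    proof -
      have d: "frechet_derivative (\<lambda>P. \<omega> P Z) (at Q) Y =
          ip (dD Q Z) (- ?A (snd Y)) + ip (frechet_derivative (\<lambda>P. dD P Z) (at Q) Y) (\<nu> (snd Q))" for Y Z
      proof -
        have "((\<lambda>P. dD P Z) has_derivative frechet_derivative (\<lambda>P. dD P Z) (at Q)) (at Q)"
          by (rule smooth_on_has_derivative[OF smD]) simp
        from ip.FDERIV[OF this normal_snd_has_derivative[OF Q]] show ?thesis
          unfolding \<omega>_def by (simp add: frechet_derivative_eq)
      qed
      have "frechet_derivative (\<lambda>P. dD P Z) (at Q) Y = frechet_derivative (\<lambda>P. dD P Y) (at Q) Z"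
        by (rule frechet_derivative_commute[OF open_UNIV smooth_D]) simp
      then show ?thesis unfolding ext_deriv_def d by (simp add: ip_simps)
    qed
    obtain X where X: "X \<in> tangent_space H Q" "ip (snd X) (D Q) = 1" "ip (snd X) w = 0" "ip (dD Q X) w = 0"
      using tangent_H_coords_exist[OF Q fr, of 1 0 0] by blast
    obtain Y where Y: "Y \<in> tangent_space H Q" "ip (snd Y) (D Q) = 0" "ip (snd Y) w = 0" "ip (dD Q Y) w = 1"
      using tangent_H_coords_exist[OF Q fr, of 0 0 1] by blast
    \<comment> \<open>coordinates of a vector conjugate to the direction\<close>
    obtain Z where Z: "Z \<in> tangent_space H Q" "ip (snd Z) (D Q) = - ip (?A w) (D Q)"
      "ip (snd Z) w = ip (?A (D Q)) (D Q)" "ip (dD Q Z) w = 0"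
      using tangent_H_coords_exist[OF Q fr, of "- ip (?A w) (D Q)" "ip (?A (D Q)) (D Q)" 0] by blast
    have sX: "snd X = D Q" by (subst tangent_H_coords(1)[OF Q fr X(1)]) (simp add: X)
    have sY: "snd Y = 0" by (subst tangent_H_coords(1)[OF Q fr Y(1)]) (simp add: Y)
    have A0: "?A 0 = 0" by (rule linear_0[OF shape_tangent(1)[OF hypersurfaceD(1)[OF Q]]])
    have "ip (dD Q Z) (\<nu> (snd Q)) = 0" using shape_coords[OF Q fr Z(1)] Z by simp
    then have \<omega>: "\<omega> Q X \<noteq> 0" "\<omega> Q Y = 0" "\<omega> Q Z = 0"
      using shape_direction[OF Q] by (simp_all add: \<omega>s[OF X(1)] \<omega>s[OF Y(1)] sX sY A0 ip.zero_left) (simp add: \<omega>_def)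
    have dY: "dD Q Y = w"
      using shape_coords[OF Q fr Y(1)] by (subst tangent_H_coords(2)[OF Q fr Y(1)]) (simp add: Y)
    have "ip w (?A (snd Z)) \<noteq> 0"
    proof
      assume 0: "ip w (?A (snd Z)) = 0"
      note sZ = tangent_space_H(1)[OF Z(1)]
      have "?A (snd Z) = ip (?A (snd Z)) (D Q) *\<^sub>R D Q + ip (?A (snd Z)) w *\<^sub>R w"
        by (rule frame_tangent[OF Q fr shape_tangent(2)[OF hypersurfaceD(1)[OF Q] sZ]])
      then have "?A (snd Z) = 0" using \<omega>(3) 0 metric_sym[of w] by (simp add: \<omega>s Z(1))
      then have "ip (?A (snd Z)) (snd Z) = 0" by (simp add: ip.zero_left)
      then have "snd Z = 0" using shape_tangent(3)[OF hypersurfaceD(1)[OF Q] sZ] by blast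
      then show False using Z(3) shape_direction[OF Q] by (simp add: ip.zero_left)
    qed
    then have "ext_deriv \<omega> Q Y Z \<noteq> 0" by (simp add: ext dY sY A0 ip_simps)
    then have "\<omega> Q X * ext_deriv \<omega> Q Y Z + \<omega> Q Y * ext_deriv \<omega> Q Z X + \<omega> Q Z * ext_deriv \<omega> Q X Y \<noteq> 0"
      using \<omega> by simp
    then show "\<exists>X\<in>tangent_space H Q. \<exists>Y\<in>tangent_space H Q. \<exists>Z\<in>tangent_space H Q.
           \<omega> Q X * ext_deriv \<omega> Q Y Z + \<omega> Q Y * ext_deriv \<omega> Q Z X + \<omega> Q Z * ext_deriv \<omega> Q X Y \<noteq> 0"
      using X(1) Y(1) Z(1) by blast
  qed
qed

section \<open>Legendrian knots\<close>

lemma knot_tangent: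
  assumes C: "knot F S C"
  defines "c \<equiv> snd \<circ> C"
  shows "C t \<in> H" "vector_derivative C (at t) \<in> tangent_space H (C t)"
    "vector_derivative c (at t) = snd (vector_derivative C (at t))"
    "vector_derivative c (at t) \<in> tangent_space S (c t)" "vector_derivative c (at t) \<noteq> 0"
proof -
  have sm: "smooth_on C UNIV" and CH: "\<And>t. C t \<in> H" and ne: "vector_derivative c (at t) \<noteq> 0"
    using C unfolding knot_def c_def by blast+
  show "C t \<in> H" "vector_derivative c (at t) \<noteq> 0" by (fact CH ne)+
  show T: "vector_derivative C (at t) \<in> tangent_space H (C t)"
    by (rule tangent_space_curve[OF open_UNIV _ sm]) (use CH in auto)
  have "(c has_vector_derivative snd (vector_derivative C (at t))) (at t)"
    unfolding c_def o_def
    by (rule bounded_linear.has_vector_derivative[OF bounded_linear_snd smooth_on_has_vector_derivative[OF sm UNIV_I]])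
  then show e: "vector_derivative c (at t) = snd (vector_derivative C (at t))"
    by (rule vector_derivative_at)
  show "vector_derivative c (at t) \<in> tangent_space S (c t)"
    unfolding e using tangent_space_H(1)[OF T] by (simp add: c_def)
qed

theorem alpha_legendrian:
  assumes C: "knot F S C"
  shows "legendrian (alpha_plane F S) C \<longleftrightarrow> tangent_to_contact_curve F S C"
proof -
  note K = knot_tangent[OF C]
  have "vector_derivative C (at t) \<in> alpha_plane F S (C t) \<longleftrightarrow>
      vector_derivative (snd \<circ> C) (at t) \<in> span {direction F S (C t)}" for t
    unfolding alpha_plane_eq[OF K(1)] direction_eq[OF K(1)] K(3) using K(2) by simp
  then show ?thesis unfolding legendrian_def tangent_to_contact_curve_def by simp
qed

lemma beta_legendrian:
  assumes C: "knot F S C"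
  shows "legendrian (beta_plane F S) C \<longleftrightarrow>
    (\<forall>t. ip (shape (snd (C t)) (vector_derivative (snd \<circ> C) (at t))) (D (C t)) = 0)"
proof -
  note K = knot_tangent[OF C]
  show ?thesis
    unfolding legendrian_def beta_plane_eq[OF K(1)] K(3) using K(2) by simp
qed

lemma tangent_positive:
  assumes p: "p \<in> S" and x: "x \<in> tangent_space S p" "x \<noteq> 0"
  shows "0 < ip x x"
proof -
  obtain e1 e2 where fr: "frame p e1 e2 (\<nu> p)" using principal_frame[OF p] by metis
  have e: "x = ip x e1 *\<^sub>R e1 + ip x e2 *\<^sub>R e2"
    using frame_expand[OF fr, of x] x by (simp add: tangent_space_S[OF p])
  have "ip x x = ip x e1 * ip x e1 + ip x e2 * ip x e2"
    by (subst (2) e) (simp add: ip_simps)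
  moreover have "ip x e1 \<noteq> 0 \<or> ip x e2 \<noteq> 0" using e x(2) by auto
  ultimately show ?thesis
    by (metis add_nonneg_pos add_pos_nonneg not_real_square_gt_zero zero_le_square)
qed

lemma normal_unique:
  assumes \<mu>: "unit_normal_field F S \<mu>" and p: "p \<in> S"
  shows "\<exists>s::real. s \<noteq> 0 \<and> \<mu> p = s *\<^sub>R \<nu> p"
proof -
  obtain e1 e2 where e: "e1 \<in> tangent_space S p" "e2 \<in> tangent_space S p" and fr: "frame p e1 e2 (\<nu> p)"
    using principal_frame[OF p] by metis
  have "ip (\<mu> p) e1 = 0" "ip (\<mu> p) e2 = 0"
    using tangent_space_S_perp(2)[OF p _ \<mu>] e metric_sym[of "\<mu> p"] by simp_all
  then have m: "\<mu> p = ip (\<mu> p) (\<nu> p) *\<^sub>R \<nu> p"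
    using frame_expand[OF fr, of "\<mu> p"] unit_normalD(1)[OF \<mu> p] by simp
  moreover have "ip (\<mu> p) (\<nu> p) \<noteq> 0"
  proof
    assume "ip (\<mu> p) (\<nu> p) = 0"
    then have "\<mu> p = 0" using m by simp
    then show False using unit_normalD(2)[OF \<mu> p] by (simp add: ip.zero_left)
  qed
  ultimately show ?thesis by blast
qed

text \<open>By \<open>tangent_space_H\<close>, both sides are products of one and the same vector with the two normals at \<open>p\<close>,
which are proportional. Hence no derivative of the factor of proportionality occurs.\<close>

lemma shape_other_normal:
  assumes \<mu>: "unit_normal_field F S \<mu>" and p: "p \<in> S"
  shows "\<exists>s. s \<noteq> 0 \<and> (\<forall>x\<in>tangent_space S p. \<forall>v\<in>tangent_space S p.
    ip v v = 1 \<longrightarrow> ip (shape_operator \<mu> p x) v = s * ip (shape p x) v)"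
proof -
  obtain s :: real where s: "s \<noteq> 0" "\<mu> p = s *\<^sub>R \<nu> p" using normal_unique[OF assms] by blast
  have "ip (shape_operator \<mu> p x) v = s * ip (shape p x) v"
    if x: "x \<in> tangent_space S p" and v: "v \<in> tangent_space S p" "ip v v = 1" for x v
  proof -
    let ?Q = "(geod F p v, p)"
    note Q = hypersurfaceI[OF p v]
    obtain w where fr: "frame (snd ?Q) (D ?Q) w (\<nu> (snd ?Q))" by (rule H_frame[OF Q(1)])
    obtain X where X: "X \<in> tangent_space H ?Q" "ip (snd X) v = ip x v" "ip (snd X) w = ip x w"
      using tangent_H_coords_exist[OF Q(1) fr, of "ip x v" "ip x w" 0] unfolding Q(2) by blast
    have "snd X = x"
      using tangent_H_coords(1)[OF Q(1) fr X(1)] frame_tangent[OF Q(1) fr, of x] x X(2,3) unfolding Q(2) by simp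
    then show ?thesis
      using tangent_space_H(4)[OF X(1) \<mu>] tangent_space_H(4)[OF X(1) normal] s Q(2) by (simp add: ip_simps)
  qed
  with s(1) show ?thesis by blast
qed

lemma shape_other_normal_definite:
  assumes \<mu>: "unit_normal_field F S \<mu>" and p: "p \<in> S" and x: "x \<in> tangent_space S p" "x \<noteq> 0"
  shows "shape_operator \<mu> p x \<noteq> 0"
proof
  assume 0: "shape_operator \<mu> p x = 0"
  let ?v = "normalise ip x"
  have v: "ip ?v ?v = 1" by (rule normalise_unit[OF metric_bilinear tangent_positive[OF p x]])
  have vT: "?v \<in> tangent_space S p"
    unfolding normalise_def by (rule subspace_scale[OF subspace_tangent_space_S[OF p] x(1)])
  obtain s where "s \<noteq> 0" "ip (shape_operator \<mu> p x) ?v = s * ip (shape p x) ?v"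
    using shape_other_normal[OF \<mu> p] x(1) vT v by blast
  then have "ip (shape p x) ?v = 0" using 0 by (simp add: ip.zero_left)
  then have "ip (shape p x) x = 0"
    using tangent_positive[OF p x] by (simp add: normalise_def ip_simps)
  then show False using shape_tangent(3)[OF p x] by simp
qed

text \<open>Both alternatives say that the velocity of the contact curve is an eigenvector of a shape operator.\<close>

lemma curvature_line_or_umbilic:
  assumes C: "knot F S C" and iii: "line_of_curvature F S (snd \<circ> C) \<or> umbilic_along F S (snd \<circ> C)"
  shows "\<exists>\<mu>. unit_normal_field F S \<mu> \<and> (\<forall>t. \<exists>k. shape_operator \<mu> (snd (C t)) (vector_derivative (snd \<circ> C) (at t))
    = k *\<^sub>R vector_derivative (snd \<circ> C) (at t))"
  using iii
proof
  assume "line_of_curvature F S (snd \<circ> C)"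
  then show ?thesis unfolding line_of_curvature_def principal_direction_def by (auto simp: o_def)
next
  assume "umbilic_along F S (snd \<circ> C)"
  then obtain \<mu> where \<mu>: "unit_normal_field F S \<mu>"
    and k: "\<And>t. \<exists>k. principal_curvatures F S \<mu> (snd (C t)) k k"
    unfolding umbilic_along_def by auto
  have "\<exists>k. shape_operator \<mu> (snd (C t)) (vector_derivative (snd \<circ> C) (at t)) = k *\<^sub>R vector_derivative (snd \<circ> C) (at t)" for t
  proof -
    let ?p = "snd (C t)" and ?x = "vector_derivative (snd \<circ> C) (at t)"
    note K = knot_tangent[OF C, of t]
    have p: "?p \<in> S" using hypersurfaceD(1)[OF K(1)] .
    obtain k e1 e2 where e: "e1 \<in> tangent_space S ?p" "e2 \<in> tangent_space S ?p"
      "ip e1 e1 = 1" "ip e2 e2 = 1" "ip e1 e2 = 0"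
      "shape_operator \<mu> ?p e1 = k *\<^sub>R e1" "shape_operator \<mu> ?p e2 = k *\<^sub>R e2"
      using k[of t] unfolding principal_curvatures_def by blast
    have "frame ?p e1 e2 (\<mu> ?p)"
      unfolding frame_def
      using e S_carrier p tangent_space_S_perp[OF p] unit_normalD[OF \<mu> p] \<mu> by auto
    from frame_expand[OF this, of ?x] have x: "?x = ip ?x e1 *\<^sub>R e1 + ip ?x e2 *\<^sub>R e2"
      using tangent_space_S_perp(1)[OF p] tangent_space_S_perp(2)[OF p _ \<mu>] K(4) by (simp add: o_def)
    have "linear (\<lambda>x. - shape_operator \<mu> ?p x)"
      using normal_has_derivative[OF \<mu> p] by (rule has_derivative_linear)
    from linear_compose_neg[OF this] have lin: "linear (shape_operator \<mu> ?p)" by simp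
    have "shape_operator \<mu> ?p ?x = ip ?x e1 *\<^sub>R k *\<^sub>R e1 + ip ?x e2 *\<^sub>R k *\<^sub>R e2"
      by (subst x) (simp only: linear_add[OF lin] linear_scale[OF lin] e)
    also have "\<dots> = k *\<^sub>R (ip ?x e1 *\<^sub>R e1 + ip ?x e2 *\<^sub>R e2)" by (simp add: algebra_simps)
    also have "\<dots> = k *\<^sub>R ?x" by (simp only: x[symmetric])
    finally show ?thesis by blast
  qed
  with \<mu> show ?thesis by blast
qed

text \<open>With \<open>x = c'\<close>, the three conditions are \<open>\<langle>A x, v\<rangle> = 0\<close>, \<open>\<langle>x, v\<rangle> = 0\<close> and \<open>A x = k x\<close>, where \<open>k \<noteq> 0\<close> since \<open>A\<close>
is definite. For the first implication note that the tangent plane of \<open>S\<close> is two-dimensional, so the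
orthogonal complement of \<open>v\<close> in it is a line.\<close>

theorem beta_legendrian_two_of_three:
  assumes C: "knot F S C"
  defines "i \<equiv> legendrian (beta_plane F S) C"
    and "ii \<equiv> normal_to_contact_curve F S C UNIV"
    and "iii \<equiv> line_of_curvature F S (snd \<circ> C) \<or> umbilic_along F S (snd \<circ> C)"
  shows "i \<Longrightarrow> ii \<Longrightarrow> iii" "i \<Longrightarrow> iii \<Longrightarrow> ii" "ii \<Longrightarrow> iii \<Longrightarrow> i"
proof -
  note K = knot_tangent[OF C]
  define x where "x t = vector_derivative (snd \<circ> C) (at t)" for t
  define p where "p t = snd (C t)" for t
  define v where "v t = D (C t)" for t
  have p: "p t \<in> S" and v: "v t \<in> tangent_space S (p t)" "ip (v t) (v t) = 1" for t
    using hypersurfaceD[OF K(1)] by (auto simp: p_def v_def)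
  have x: "x t \<in> tangent_space S (p t)" "x t \<noteq> 0" for t
    using K(4,5) by (auto simp: x_def p_def)
  have i: "i \<longleftrightarrow> (\<forall>t. ip (shape (p t) (x t)) (v t) = 0)"
    unfolding i_def beta_legendrian[OF C] by (simp add: x_def p_def v_def)
  have ii: "ii \<longleftrightarrow> (\<forall>t. ip (x t) (v t) = 0)"
    unfolding ii_def normal_to_contact_curve_def by (simp add: x_def v_def direction_eq[OF K(1)])
  have iii: "\<exists>\<mu>. unit_normal_field F S \<mu> \<and> (\<forall>t. \<exists>k. shape_operator \<mu> (p t) (x t) = k *\<^sub>R x t)" if iii
    using curvature_line_or_umbilic[OF C] that by (simp add: iii_def p_def x_def)
  show iii if i ii
  proof -
    have "principal_direction S \<nu> (p t) (x t)" for t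
    proof -
      obtain w where fr: "frame (p t) (v t) w (\<nu> (p t))" by (rule tangent_frame[OF p v])
      have e: "z = ip z (v t) *\<^sub>R v t + ip z w *\<^sub>R w" if "z \<in> tangent_space S (p t)" for z
        using frame_expand[OF fr, of z] that by (simp add: tangent_space_S[OF p])
      have xw: "x t = ip (x t) w *\<^sub>R w" using e[OF x(1)] \<open>ii\<close> by (simp add: ii)
      then have "ip (x t) w \<noteq> 0" using x(2)[of t] by (metis scaleR_zero_left)
      then have w: "w = (1 / ip (x t) w) *\<^sub>R x t" by (subst xw) simp
      have "shape (p t) (x t) = ip (shape (p t) (x t)) w *\<^sub>R w"
        using e[OF shape_tangent(2)[OF p x(1)]] \<open>i\<close> by (simp add: i)
      also have "\<dots> = (ip (shape (p t) (x t)) w / ip (x t) w) *\<^sub>R x t"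
        by (subst (2) w) simp
      finally show ?thesis unfolding principal_direction_def using x by blast
    qed
    then have "line_of_curvature F S (snd \<circ> C)"
      unfolding line_of_curvature_def using normal by (auto simp: x_def p_def)
    then show iii by (simp add: iii_def)
  qed
  show ii if i iii
    unfolding ii
  proof
    fix t
    obtain \<mu> k where \<mu>: "unit_normal_field F S \<mu>" and k: "shape_operator \<mu> (p t) (x t) = k *\<^sub>R x t"
      using iii[OF \<open>iii\<close>] by blast
    have "k \<noteq> 0" using shape_other_normal_definite[OF \<mu> p x] k by auto
    moreover have "ip (shape_operator \<mu> (p t) (x t)) (v t) = 0"
      using shape_other_normal[OF \<mu> p, of t] x(1) v \<open>i\<close> by (auto simp: i)
    ultimately show "ip (x t) (v t) = 0" by (simp add: k ip_simps)
  qed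
  show i if ii iii
    unfolding i
  proof
    fix t
    obtain \<mu> k where \<mu>: "unit_normal_field F S \<mu>" and k: "shape_operator \<mu> (p t) (x t) = k *\<^sub>R x t"
      using iii[OF \<open>iii\<close>] by blast
    obtain s where s: "s \<noteq> 0" "ip (shape_operator \<mu> (p t) (x t)) (v t) = s * ip (shape (p t) (x t)) (v t)"
      using shape_other_normal[OF \<mu> p, of t] x(1) v by blast
    then show "ip (shape (p t) (x t)) (v t) = 0" using \<open>ii\<close> by (simp add: k ip_simps ii)
  qed
qed

end

section \<open>The Reeb vector field\<close>

text \<open>The definition of \<open>one_form_on\<close> gives smoothness for each fixed argument; expansion in the basis
gives differentiability in both arguments together.\<close>

lemma one_form_has_derivative:
  fixes \<omega> :: "'a::euclidean_space \<Rightarrow> 'a \<Rightarrow> real" and \<Phi> Y :: "'b::euclidean_space \<Rightarrow> 'a"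
  assumes \<omega>: "one_form_on U \<omega>" and U: "open U" "\<Phi> z \<in> U"
    and \<Phi>: "(\<Phi> has_derivative \<Phi>') (at z)" and Y: "(Y has_derivative Y') (at z)"
  shows "((\<lambda>z. \<omega> (\<Phi> z) (Y z)) has_derivative
    (\<lambda>h. frechet_derivative (\<lambda>P. \<omega> P (Y z)) (at (\<Phi> z)) (\<Phi>' h) + \<omega> (\<Phi> z) (Y' h))) (at z)"
proof -
  have expand: "\<omega> P W = (\<Sum>i\<in>Basis. (W \<bullet> i) * \<omega> P i)" if "P \<in> U" for P W
  proof -
    have lin: "linear (\<omega> P)" using \<omega> that unfolding one_form_on_def by blast
    have "\<omega> P W = \<omega> P (\<Sum>i\<in>Basis. (W \<bullet> i) *\<^sub>R i)" by (simp only: euclidean_representation)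
    also have "\<dots> = (\<Sum>i\<in>Basis. (W \<bullet> i) * \<omega> P i)"
      by (simp add: linear_sum[OF lin] linear_scale[OF lin])
    finally show ?thesis .
  qed
  have d: "((\<lambda>P. \<omega> P W) has_derivative frechet_derivative (\<lambda>P. \<omega> P W) (at (\<Phi> z))) (at (\<Phi> z))" for W
    using \<omega> U(2) smooth_on_has_derivative unfolding one_form_on_def by blast
  have "((\<lambda>P. \<Sum>i\<in>Basis. (W \<bullet> i) * \<omega> P i) has_derivative
      (\<lambda>h. \<Sum>i\<in>Basis. (W \<bullet> i) * frechet_derivative (\<lambda>P. \<omega> P i) (at (\<Phi> z)) h)) (at (\<Phi> z))" for W
    by (rule has_derivative_sum, rule has_derivative_mult_right, rule d)
  then have d': "((\<lambda>P. \<omega> P W) has_derivative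
      (\<lambda>h. \<Sum>i\<in>Basis. (W \<bullet> i) * frechet_derivative (\<lambda>P. \<omega> P i) (at (\<Phi> z)) h)) (at (\<Phi> z))" for W
    by (rule has_derivative_transform_within_open[OF _ U]) (rule expand[symmetric])
  have fd: "frechet_derivative (\<lambda>P. \<omega> P W) (at (\<Phi> z)) h =
      (\<Sum>i\<in>Basis. (W \<bullet> i) * frechet_derivative (\<lambda>P. \<omega> P i) (at (\<Phi> z)) h)" for W h
    by (rule fun_cong[OF frechet_derivative_eq[OF d']])
  have "((\<lambda>z. \<Sum>i\<in>Basis. (Y z \<bullet> i) * \<omega> (\<Phi> z) i) has_derivative
      (\<lambda>h. \<Sum>i\<in>Basis. (Y z \<bullet> i) * frechet_derivative (\<lambda>P. \<omega> P i) (at (\<Phi> z)) (\<Phi>' h) + (Y' h \<bullet> i) * \<omega> (\<Phi> z) i)) (at z)"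
  proof (rule has_derivative_sum)
    fix i :: 'a
    have "((\<lambda>z. \<omega> (\<Phi> z) i) has_derivative (\<lambda>h. frechet_derivative (\<lambda>P. \<omega> P i) (at (\<Phi> z)) (\<Phi>' h))) (at z)"
      using diff_chain_at[OF \<Phi> d] by (simp add: o_def)
    from has_derivative_mult[OF has_derivative_inner_left[OF Y, of i] this]
    show "((\<lambda>z. (Y z \<bullet> i) * \<omega> (\<Phi> z) i) has_derivative
      (\<lambda>h. (Y z \<bullet> i) * frechet_derivative (\<lambda>P. \<omega> P i) (at (\<Phi> z)) (\<Phi>' h) + (Y' h \<bullet> i) * \<omega> (\<Phi> z) i)) (at z)" .
  qed
  then have main: "((\<lambda>z. \<Sum>i\<in>Basis. (Y z \<bullet> i) * \<omega> (\<Phi> z) i) has_derivative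
      (\<lambda>h. frechet_derivative (\<lambda>P. \<omega> P (Y z)) (at (\<Phi> z)) (\<Phi>' h) + \<omega> (\<Phi> z) (Y' h))) (at z)"
    by (rule has_derivative_eq_rhs) (simp only: fd[of "Y z"] expand[OF U(2), of "Y' h" for h] sum.distrib)
  have "\<forall>\<^sub>F x in nhds z. \<Phi> x \<in> U"
    using topological_tendstoD[of \<Phi> "\<Phi> z" "nhds z", OF _ U] has_derivative_continuous[OF \<Phi>]
    unfolding continuous_at tendsto_at_iff_tendsto_nhds by blast
  then obtain V where V: "open V" "z \<in> V" "\<And>x. x \<in> V \<Longrightarrow> \<Phi> x \<in> U"
    unfolding eventually_nhds by blast
  show ?thesis
    by (rule has_derivative_transform_within_open[OF main V(1,2)]) (rule expand[OF V(3), symmetric])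
qed

lemma has_vector_derivative_const_on:
  assumes "(g has_vector_derivative d) (at t)" "open I" "t \<in> I" "\<And>s. s \<in> I \<Longrightarrow> g s = c"
  shows "d = 0"
proof -
  have "((\<lambda>s. c) has_vector_derivative d) (at t)"
    using has_vector_derivative_transform_within_open[OF assms(1-3)] assms(4) by metis
  then show ?thesis using vector_derivative_unique_at by (metis has_vector_derivative_const)
qed

context convex_surface_neutral begin

text \<open>The definition of the Reeb vector refers to an unknown smooth extension of the contact form. It is
pulled back along \<open>H_family\<close>, where it equals \<open>\<langle>dP, R P V\<rangle>\<close>. Differentiating this equality in a second
direction and antisymmetrising, the second derivatives of the family cancel on both sides, and
\<open>d\<omega>(Y, Y') = a \<theta>' - a' \<theta>\<close> results, where \<open>(a, \<theta>)\<close> and \<open>(a', \<theta>')\<close> are coordinates of \<open>Y\<close> and \<open>Y'\<close>.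
The Reeb condition for suitable \<open>Y'\<close> gives \<open>a = 0\<close> and \<open>\<theta> = 0\<close>.\<close>

lemma reeb_vectorD:
  assumes R: "quarter_turn F S R" and X: "reeb_vector H (alpha_form F S R) Q X"
  shows "snd X = R (snd Q) (D Q)" "ip (dD Q X) (R (snd Q) (D Q)) = 0"
proof -
  let ?p = "snd Q" and ?v = "D Q"
  have XT: "X \<in> tangent_space H Q" and X1: "alpha_form F S R Q X = 1" using X unfolding reeb_vector_def by auto
  have Q: "Q \<in> H" by (rule tangent_space_H(6)[OF XT])
  obtain U \<omega> where U: "open U" "Q \<in> U" and form: "one_form_on U \<omega>"
    and agree: "\<And>P W. P \<in> H \<inter> U \<Longrightarrow> W \<in> tangent_space H P \<Longrightarrow> \<omega> P W = alpha_form F S R P W"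
    and ext: "\<And>Y. Y \<in> tangent_space H Q \<Longrightarrow> ext_deriv \<omega> Q X Y = 0"
    using X unfolding reeb_vector_def by blast
  obtain M g where M: "open M" "smooth_on g M" and
    MS': "{(p, v). p \<in> S \<and> v \<in> tangent_space S p} \<subseteq> M"
    and g': "\<forall>x\<in>{(p, v). p \<in> S \<and> v \<in> tangent_space S p}. g x = (case x of (p, v) \<Rightarrow> R p v)"
    using R unfolding quarter_turn_def smooth_map_on_def by blast
  have MS: "(p, v) \<in> M" and g: "g (p, v) = R p v" if "p \<in> S" "v \<in> tangent_space S p" for p v
    using MS' g' that by auto
  have turn: "R p v \<in> tangent_space S p" "ip (R p v) (R p v) = ip v v" "ip (R p v) v = 0"
    if "p \<in> S" "v \<in> tangent_space S p" for p v
    using R that unfolding quarter_turn_def by blast+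
  define w where "w = R ?p ?v"
  have wT: "w \<in> tangent_space S ?p" and w1: "ip w w = 1" "ip w ?v = 0"
    using turn[OF hypersurfaceD(1,2)[OF Q]] hypersurfaceD(3)[OF Q] by (auto simp: w_def)
  have fr: "frame ?p ?v w (\<nu> ?p)"
    unfolding frame_def
    using hypersurfaceD[OF Q] wT w1 tangent_space_S_perp[OF hypersurfaceD(1)[OF Q] wT] normal
      unit_normalD[OF normal hypersurfaceD(1)[OF Q]] metric_sym[of ?v w] by auto
  obtain \<Phi> :: "(real^3) \<times> real \<Rightarrow> 'l \<times> 'm" and Z\<^sub>0
    where F0: "open Z\<^sub>0" "0 \<in> Z\<^sub>0" "smooth_on \<Phi> Z\<^sub>0" "\<Phi> ` Z\<^sub>0 \<subseteq> H" "\<Phi> 0 = Q"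
    and onto: "\<And>x y. x \<in> tangent_space S (snd Q) \<Longrightarrow> ip y (D Q) = 0 \<Longrightarrow>
       ip y (\<nu> (snd Q)) = ip (shape (snd Q) x) (D Q) \<Longrightarrow> K * ip y (snd Q) = - (K * ip x (D Q)) \<Longrightarrow>
       \<exists>z. snd (frechet_derivative \<Phi> (at 0) z) = x \<and> dD Q (frechet_derivative \<Phi> (at 0) z) = y"
    by (rule H_family[OF Q]) (rule that)
  define Z where "Z = {z \<in> Z\<^sub>0. \<Phi> z \<in> U}"
  have oZ: "open Z"
    using continuous_open_preimage[OF smooth_on_imp_continuous_on[OF F0(3)] F0(1) U(1)]
    by (simp add: Z_def vimage_def Int_def)
  have Z: "0 \<in> Z" "smooth_on \<Phi> Z" "\<Phi> ` Z \<subseteq> H" "\<And>z. z \<in> Z \<Longrightarrow> \<Phi> z \<in> H \<inter> U"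
    using F0 U smooth_on_subset[OF F0(3), of Z] by (auto simp: Z_def)
  \<comment> \<open>\<open>d\<Phi> h\<close> is the vector field along the family obtained by moving in the parameter direction \<open>h\<close>\<close>
  define d\<Phi> where "d\<Phi> h z = frechet_derivative \<Phi> (at z) h" for h z
  have d\<Phi>T: "d\<Phi> h z \<in> tangent_space H (\<Phi> z)" if "z \<in> Z" for h z
    unfolding d\<Phi>_def by (rule tangent_space_of_family[OF oZ that Z(2,3)])
  have sd\<Phi>: "smooth_on (d\<Phi> h) Z" for h
    unfolding d\<Phi>_def by (rule smooth_on_frechet_derivative[OF Z(2)])
  have surj: "\<exists>h. d\<Phi> h 0 = Y" if Y: "Y \<in> tangent_space H Q" for Y
  proof -
    obtain h where h: "snd (d\<Phi> h 0) = snd Y" "dD Q (d\<Phi> h 0) = dD Q Y"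
      using onto[OF tangent_space_H(1,3)[OF Y] tangent_space_H(4)[OF Y normal] tangent_space_H(5)[OF Y]]
      unfolding d\<Phi>_def by blast
    have "d\<Phi> h 0 \<in> tangent_space H Q" using d\<Phi>T[OF Z(1)] F0(5) by simp
    from tangent_space_H_eqI[OF this Y h] show ?thesis by blast
  qed
  define W where "W z = g (snd (\<Phi> z), D (\<Phi> z))" for z
  note H = hypersurfaceD[OF Z(4)[THEN IntD1]]
  have smV: "smooth_on (\<lambda>z. D (\<Phi> z)) Z"
    by (rule smooth_on_compose[OF oZ open_UNIV _ smooth_D Z(2)]) simp
  have smW: "smooth_on W Z"
    unfolding W_def
    by (rule smooth_on_compose[OF oZ M(1) _ M(2) smooth_on_Pair[OF oZ smooth_on_snd[OF oZ Z(2)] smV]])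
      (auto intro!: MS H)
  have WR: "W z = R (snd (\<Phi> z)) (D (\<Phi> z))" if "z \<in> Z" for z
    unfolding W_def by (rule g[OF H(1,2)[OF that]])
  have W0: "W 0 = w" by (simp add: WR[OF Z(1)] F0(5) w_def)
  define dW where "dW = frechet_derivative W (at 0)"
  have dW: "(W has_derivative dW) (at 0)" unfolding dW_def by (rule smooth_on_has_derivative[OF smW Z(1)])
  have d1: "(\<Phi> has_derivative (\<lambda>h. d\<Phi> h 0)) (at 0)"
    using smooth_on_has_derivative[OF Z(2,1)] by (simp add: d\<Phi>_def)
  have dV: "((\<lambda>z. D (\<Phi> z)) has_derivative (\<lambda>h. dD Q (d\<Phi> h 0))) (at 0)"
    using diff_chain_at[OF d1, of D "dD Q"] D_has_derivative[of Q] by (simp add: o_def F0(5))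
  have const: "f' h = 0" if "(f has_derivative f') (at 0)" "\<And>z. z \<in> Z \<Longrightarrow> f z = (c::real)" for f f' c h
  proof -
    have "((\<lambda>z. c) has_derivative f') (at 0)"
      by (rule has_derivative_transform_within_open[OF that(1) oZ Z(1)]) (rule that(2))
    from has_derivative_unique[OF this has_derivative_const] show ?thesis by simp
  qed
  have "ip (W 0) (dD Q (d\<Phi> h 0)) + ip (dW h) (D (\<Phi> 0)) = 0" for h
    by (rule const[OF ip.FDERIV[OF dW dV], of 0]) (simp add: WR turn(3) H(1,2))
  then have dWv: "ip (dW h) ?v = - ip w (dD Q (d\<Phi> h 0))" for h
    by (simp add: W0 F0(5) eq_neg_iff_add_eq_0 add.commute)
  have "ip (W 0) (dW h) + ip (dW h) (W 0) = 0" for h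
    by (rule const[OF ip.FDERIV[OF dW dW], of 1]) (simp add: WR turn(2) H)
  then have ww: "ip w (dW h) + ip (dW h) w = 0" for h by (simp only: W0)
  have dWw: "ip (dW h) w = 0" for h using ww[of h] metric_sym[of w "dW h"] by linarith
  define d2 where "d2 h k = frechet_derivative (d\<Phi> h) (at 0) k" for h k
  have d2: "(d\<Phi> h has_derivative d2 h) (at 0)" for h
    unfolding d2_def by (rule smooth_on_has_derivative[OF sd\<Phi> Z(1)])
  have d2_sym: "d2 h k = d2 k h" for h k
    unfolding d2_def d\<Phi>_def by (rule frechet_derivative_commute[OF oZ Z(2,1)])
  \<comment> \<open>the same derivative computed for the extension and for the explicit formula\<close>
  have pull: "frechet_derivative (\<lambda>P. \<omega> P (d\<Phi> h 0)) (at Q) (d\<Phi> k 0) + \<omega> Q (d2 h k)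
      = ip (snd (d\<Phi> h 0)) (dW k) + ip (snd (d2 h k)) w" for h k
  proof -
    have 1: "((\<lambda>z. \<omega> (\<Phi> z) (d\<Phi> h z)) has_derivative
      (\<lambda>k. frechet_derivative (\<lambda>P. \<omega> P (d\<Phi> h 0)) (at (\<Phi> 0)) (d\<Phi> k 0) + \<omega> (\<Phi> 0) (d2 h k))) (at 0)"
      by (rule one_form_has_derivative[OF form U(1) _ d1 d2]) (simp add: F0(5) U)
    have 2: "((\<lambda>z. ip (snd (d\<Phi> h z)) (W z)) has_derivative
      (\<lambda>k. ip (snd (d\<Phi> h 0)) (dW k) + ip (snd (d2 h k)) (W 0))) (at 0)"
      by (rule ip.FDERIV[OF has_derivative_snd[OF d2] dW])
    have "\<omega> (\<Phi> z) (d\<Phi> h z) = ip (snd (d\<Phi> h z)) (W z)" if z: "z \<in> Z" for z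
      using agree[OF Z(4)[OF z] d\<Phi>T[OF z]] Z(4)[OF z] WR[OF z]
      by (simp add: alpha_form_def direction_eq)
    then have "((\<lambda>z. ip (snd (d\<Phi> h z)) (W z)) has_derivative
      (\<lambda>k. frechet_derivative (\<lambda>P. \<omega> P (d\<Phi> h 0)) (at (\<Phi> 0)) (d\<Phi> k 0) + \<omega> (\<Phi> 0) (d2 h k))) (at 0)"
      by (rule has_derivative_transform_within_open[OF 1 oZ Z(1)])
    from fun_cong[OF has_derivative_unique[OF this 2], of k] show ?thesis by (simp add: F0(5) W0)
  qed
  have e: "ext_deriv \<omega> Q (d\<Phi> h 0) (d\<Phi> k 0) = ip (snd (d\<Phi> k 0)) (dW h) - ip (snd (d\<Phi> h 0)) (dW k)" for h k
    using pull[of h k] pull[of k h] unfolding ext_deriv_def d2_sym[of k h] by linarith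
  have r: "ip (snd Y) (dW h) = - (ip (snd Y) ?v * ip w (dD Q (d\<Phi> h 0)))" if Y: "Y \<in> tangent_space H Q" for Y h
    by (subst tangent_H_coords(1)[OF Q fr Y])
      (simp add: ip_simps metric_sym[of ?v "dW h"] metric_sym[of w "dW h"] dWv dWw)
  have formula: "ext_deriv \<omega> Q Y Y' = ip (snd Y) ?v * ip w (dD Q Y') - ip (snd Y') ?v * ip w (dD Q Y)"
    if Y: "Y \<in> tangent_space H Q" and Y': "Y' \<in> tangent_space H Q" for Y Y'
  proof -
    obtain h k where "d\<Phi> h 0 = Y" "d\<Phi> k 0 = Y'" using surj[OF Y] surj[OF Y'] by blast
    then show ?thesis using e[of h k] r[OF Y, of k] r[OF Y', of h] by simp
  qed
  obtain Y where Y: "Y \<in> tangent_space H Q" "ip (snd Y) ?v = 0" "ip (dD Q Y) w = 1"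
    using tangent_H_coords_exist[OF Q fr, of 0 0 1] by blast
  obtain Y' where Y': "Y' \<in> tangent_space H Q" "ip (snd Y') ?v = 1" "ip (dD Q Y') w = 0"
    using tangent_H_coords_exist[OF Q fr, of 1 0 0] by blast
  have a: "ip (snd X) ?v = 0"
    using ext[OF Y(1)] formula[OF XT Y(1)] Y metric_sym[of w] by simp
  show "ip (dD Q X) (R (snd Q) (D Q)) = 0"
    using ext[OF Y'(1)] formula[OF XT Y'(1)] Y' metric_sym[of w] by (simp add: w_def[symmetric])
  have "ip (snd X) w = 1" using X1 by (simp add: alpha_form_def direction_eq[OF Q] w_def)
  then show "snd X = R (snd Q) (D Q)"
    unfolding w_def[symmetric] by (subst tangent_H_coords(1)[OF Q fr XT]) (simp add: a)
qed

text \<open>Let \<open>c\<close> be the contact curve and \<open>v\<close> the direction. Then \<open>c' = R c v\<close> is a unit vector, so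
\<open>\<langle>c'', c'\<rangle> = 0\<close>, and differentiating \<open>\<langle>c', v\<rangle> = 0\<close> gives \<open>\<langle>c'', v\<rangle> = - \<langle>c', v'\<rangle> = 0\<close>. The vectors \<open>c'\<close> and
\<open>v\<close> span the tangent plane.\<close>

theorem reeb_curves:
  assumes R: "quarter_turn F S R" and I: "open I" and C: "reeb_integral_curve F S R C I"
  shows "geodesic_of F S (snd \<circ> C) I" "normal_to_contact_curve F S C I"
proof -
  have sm: "smooth_on C I" and CH: "\<And>t. t \<in> I \<Longrightarrow> C t \<in> H"
    and reeb: "\<And>t. t \<in> I \<Longrightarrow> reeb_vector H (alpha_form F S R) (C t) (vector_derivative C (at t))"
    using C unfolding reeb_integral_curve_def by blast+
  define c where "c = snd \<circ> C"
  define c' where "c' t = vector_derivative c (at t)" for t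
  define V where "V t = D (C t)" for t
  have smc: "smooth_on c I" unfolding c_def o_def by (rule smooth_on_snd[OF I sm])
  have dC: "(C has_vector_derivative vector_derivative C (at t)) (at t)" if "t \<in> I" for t
    by (rule smooth_on_has_vector_derivative[OF sm that])
  have c'C: "c' t = snd (vector_derivative C (at t))" if "t \<in> I" for t
    unfolding c'_def c_def o_def
    by (rule vector_derivative_at[OF bounded_linear.has_vector_derivative[OF bounded_linear_snd dC[OF that]]])
  have c'R: "c' t = R (c t) (V t)" if "t \<in> I" for t
    using reeb_vectorD(1)[OF R reeb[OF that]] c'C[OF that] by (simp add: c_def V_def)
  have turn: "c' t \<in> tangent_space S (c t)" "ip (c' t) (c' t) = 1" "ip (c' t) (V t) = 0" if "t \<in> I" for t
    using R hypersurfaceD[OF CH[OF that]] unfolding c'R[OF that] quarter_turn_def by (auto simp: c_def V_def)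
  show "normal_to_contact_curve F S C I"
    unfolding normal_to_contact_curve_def using turn(3) by (simp add: c'_def c_def V_def direction_eq CH)
  show "geodesic_of F S (snd \<circ> C) I"
    unfolding geodesic_of_def
  proof (intro conjI ballI)
    show "smooth_on (snd \<circ> C) I" using smc by (simp add: c_def)
    fix t assume t: "t \<in> I"
    note Q = CH[OF t]
    show "(snd \<circ> C) t \<in> S" using hypersurfaceD(1)[OF Q] by simp
    show "vector_derivative (snd \<circ> C) (at t) \<noteq> 0"
    proof
      assume "vector_derivative (snd \<circ> C) (at t) = 0"
      then have "c' t = 0" by (simp add: c'_def c_def)
      then show False using turn(2)[OF t] by (simp add: ip.zero_left)
    qed
    define c'' where "c'' = vector_derivative c' (at t)"
    have smc': "smooth_on c' I"
      using smooth_on_vector_derivative[OF I smc] unfolding c'_def[abs_def] .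
    have dc': "(c' has_vector_derivative c'') (at t)"
      unfolding c''_def
      by (rule smooth_on_has_vector_derivative[OF smc' t])
    have dV: "(V has_vector_derivative dD (C t) (vector_derivative C (at t))) (at t)"
      unfolding V_def by (rule has_derivative_imp_vector_derivative[OF D_has_derivative dC[OF t]])
    have "ip (c' t) c'' + ip c'' (c' t) = 0"
      by (rule has_vector_derivative_const_on[OF ip.has_vector_derivative[OF dc' dc'] I t turn(2)])
    then have 1: "ip c'' (c' t) = 0" using metric_sym[of c''] by simp
    have "ip (c' t) (dD (C t) (vector_derivative C (at t))) + ip c'' (V t) = 0"
      by (rule has_vector_derivative_const_on[OF ip.has_vector_derivative[OF dc' dV] I t turn(3)])
    moreover have "ip (dD (C t) (vector_derivative C (at t))) (c' t) = 0"
      using reeb_vectorD(2)[OF R reeb[OF t]] by (simp add: c'R[OF t] c_def V_def)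
    ultimately have 2: "ip c'' (V t) = 0" using metric_sym[of "c' t"] by simp
    fix w assume w: "w \<in> tangent_space S ((snd \<circ> C) t)"
    have fr: "frame (snd (C t)) (D (C t)) (c' t) (\<nu> (snd (C t)))"
      unfolding frame_def
      using hypersurfaceD[OF Q] turn[OF t] tangent_space_S_perp[OF hypersurfaceD(1)[OF Q], of "c' t"]
        unit_normalD[OF normal hypersurfaceD(1)[OF Q]] metric_sym[of "V t" "c' t"] normal
      by (auto simp: c_def V_def)
    have "ip c'' w = 0"
      by (subst frame_tangent[OF Q fr, of w]) (use w 1 2 in \<open>auto simp: ip_simps V_def\<close>)
    then show "ip (vector_derivative (\<lambda>s. vector_derivative (snd \<circ> C) (at s)) (at t)) w = 0"
      unfolding c''_def c'_def[abs_def] c_def .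
  qed
qed

end

section \<open>The sphere and hyperbolic space\<close>

lemma vector_4:
  "(vector [x, y, z, w] :: 'a::zero^4) $ 1 = x"
  "(vector [x, y, z, w] :: 'a::zero^4) $ 2 = y"
  "(vector [x, y, z, w] :: 'a::zero^4) $ 3 = z"
  "(vector [x, y, z, w] :: 'a::zero^4) $ 4 = w"
  unfolding vector_def by simp_all

text \<open>Laplace expansion along two rows. It shows that the orientation used in \<open>eps_rot\<close> depends only on the
bivector \<open>wedge x y\<close>.\<close>

lemma det_4_wedge:
  "det (vector [x, y, X, Z] :: real^4^4) =
     wedge x y $ 1 $ 2 * wedge X Z $ 3 $ 4 - wedge x y $ 1 $ 3 * wedge X Z $ 2 $ 4
   + wedge x y $ 1 $ 4 * wedge X Z $ 2 $ 3 + wedge x y $ 2 $ 3 * wedge X Z $ 1 $ 4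
   - wedge x y $ 2 $ 4 * wedge X Z $ 1 $ 3 + wedge x y $ 3 $ 4 * wedge X Z $ 1 $ 2"
proof -
  have f1: "finite {2::4, 3, 4}" "1 \<notin> {2::4, 3, 4}" by auto
  have f2: "finite {3::4, 4}" "2 \<notin> {3::4, 4}" by auto
  have f3: "finite {4::4}" "3 \<notin> {4::4}" by auto
  show ?thesis
    unfolding det_def UNIV_4
    unfolding sum_over_permutations_insert[OF f1]
    unfolding sum_over_permutations_insert[OF f2]
    unfolding sum_over_permutations_insert[OF f3]
    unfolding permutes_sing
    by (simp add: sign_swap_id permutation_swap_id sign_compose permutation_compose sign_id swap_id_eq vector_4 wedge_def algebra_simps)
qed

lemma bounded_bilinear_eps_form: "bounded_bilinear (eps_form \<epsilon>)"
  unfolding bilinear_conv_bounded_bilinear[symmetric] bilinear_def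
  by (auto intro!: linearI simp: eps_form_def algebra_simps)

lemma bounded_bilinear_wedge: "bounded_bilinear wedge"
  unfolding bilinear_conv_bounded_bilinear[symmetric] bilinear_def
  by (auto intro!: linearI simp: wedge_def vec_eq_iff algebra_simps)

lemma bounded_bilinear_eps_form2: "bounded_bilinear (eps_form2 \<epsilon>)"
  unfolding bilinear_conv_bounded_bilinear[symmetric] bilinear_def
  by (auto intro!: linearI simp: eps_form2_def sum.distrib sum_distrib_left add_divide_distrib algebra_simps)

interpretation wedge: bounded_bilinear wedge by (rule bounded_bilinear_wedge)
interpretation eps: bounded_bilinear "eps_form \<epsilon>" for \<epsilon> by (rule bounded_bilinear_eps_form)
interpretation eps2: bounded_bilinear "eps_form2 \<epsilon>" for \<epsilon> by (rule bounded_bilinear_eps_form2)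

lemmas eps_simps = eps.add_left eps.add_right eps.diff_left eps.diff_right eps.scaleR_left eps.scaleR_right
  eps.minus_left eps.minus_right eps.zero_left eps.zero_right

lemmas wedge_simps = wedge.add_left wedge.add_right wedge.diff_left wedge.diff_right wedge.scaleR_left wedge.scaleR_right
  wedge.minus_left wedge.minus_right wedge.zero_left wedge.zero_right

lemma wedge_self: "wedge x x = 0"
  by (simp add: wedge_def vec_eq_iff)

lemma wedge_swap: "wedge y x = - wedge x y"
  by (simp add: wedge_def vec_eq_iff)

lemma eps_form_sym: "eps_form \<epsilon> x y = eps_form \<epsilon> y x"
  by (simp add: eps_form_def mult.commute)

definition eps_dual :: "real \<Rightarrow> real^4 \<Rightarrow> real^4" where
  "eps_dual \<epsilon> x = (\<chi> i. eps_sign \<epsilon> i * x $ i)"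

lemma eps_form_dual: "eps_form \<epsilon> x y = eps_dual \<epsilon> x \<bullet> y"
  by (simp add: eps_form_def eps_dual_def eps_sign_def inner_vec_def sum_4)

lemma linear_eps_dual: "linear (eps_dual \<epsilon>)"
  by (rule linearI) (simp_all add: eps_dual_def vec_eq_iff algebra_simps)

text \<open>Contraction of the bivector with the point: \<open>x \<and> y\<close> contracted with \<open>x\<close> is \<open>y\<close>, as \<open>x\<close> is a unit vector
orthogonal to \<open>y\<close>.\<close>

definition eps_direction :: "real \<Rightarrow> (real^4^4) \<times> (real^4) \<Rightarrow> real^4" where
  "eps_direction \<epsilon> Q = - (fst Q *v eps_dual \<epsilon> (snd Q))"

lemma wedge_mult_dual: "wedge x y *v eps_dual \<epsilon> z = eps_form \<epsilon> y z *\<^sub>R x - eps_form \<epsilon> x z *\<^sub>R y"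
  by (simp add: vec_eq_iff matrix_vector_mult_def wedge_def eps_dual_def eps_form_def eps_sign_def sum_4 algebra_simps)

definition wedge_deriv :: "real^4 \<Rightarrow> real^4 \<Rightarrow> real^4 \<Rightarrow> real^4 \<Rightarrow> real^4^4" where
  "wedge_deriv p v x y = wedge x v + wedge p y"

lemma curved_space_simps:
  "carrier_set (curved_space \<epsilon>) = eps_sphere \<epsilon>"
  "metric (curved_space \<epsilon>) v w = \<epsilon> * eps_form \<epsilon> v w"
  "geod (curved_space \<epsilon>) = wedge"
  "neutral (curved_space \<epsilon>) \<gamma> W\<^sub>1 W\<^sub>2 = - eps_form2 \<epsilon> W\<^sub>1 (eps_J \<epsilon> \<gamma> (eps_J' \<epsilon> \<gamma> W\<^sub>2))"
  "alpha_cx (curved_space \<epsilon>) = eps_J' \<epsilon>"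
  by (simp_all add: curved_space_def)

lemma curved_geodesic_space:
  assumes \<epsilon>: "\<epsilon> \<in> {1, - 1}"
  shows "geodesic_space (curved_space \<epsilon>) \<epsilon> (eps_direction \<epsilon>) wedge_deriv"
proof -
  have eps_pm_one: "\<epsilon> * \<epsilon> = 1" "\<epsilon> * (\<epsilon> * a) = a" for a using \<epsilon> by auto
  have sph: "eps_form \<epsilon> p p = 1" if "p \<in> eps_sphere \<epsilon>" for p using that by (simp add: eps_sphere_def)
  have m: "metric (curved_space \<epsilon>) = (\<lambda>v w. \<epsilon> * eps_form \<epsilon> v w)" by (simp add: curved_space_def)
  show ?thesis
  proof (rule geodesic_space.intro)
    have "bilinear (\<lambda>v w. \<epsilon> * eps_form \<epsilon> v w)"
      unfolding bilinear_def by (auto intro!: linearI simp: eps_simps algebra_simps)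
    then show "bounded_bilinear (metric (curved_space \<epsilon>))"
      unfolding m by (simp add: bilinear_conv_bounded_bilinear)
    let ?F = "curved_space \<epsilon>"
    show "metric ?F x y = metric ?F y x" for x y by (simp only: curved_space_simps eps_form_sym[of _ x])
    show "\<epsilon> * metric ?F p p = 1" if "p \<in> carrier_set ?F" for p
      using sph[of p] that by (simp add: curved_space_simps eps_pm_one)
    show "dim {z. \<epsilon> * metric ?F z p = 0} = 3" if p: "p \<in> carrier_set ?F" for p
    proof -
      have "{z. \<epsilon> * metric ?F z p = 0} = {z. eps_dual \<epsilon> p \<bullet> z = 0}"
        unfolding curved_space_simps eps_pm_one by (auto simp: eps_form_dual[symmetric] eps_form_sym[of \<epsilon> p])
      moreover have "eps_dual \<epsilon> p \<noteq> 0" using sph[of p] p by (auto simp: eps_form_dual curved_space_simps)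
      ultimately show ?thesis by (simp add: dim_hyperplane)
    qed
    show "smooth_on (\<lambda>(p, v). geod ?F p v) UNIV"
      unfolding case_prod_beta curved_space_simps
      by (rule smooth_on_bilinear[OF open_UNIV bounded_bilinear_wedge smooth_on_fst smooth_on_snd])
        (simp_all add: smooth_on_ident)
    show "((\<lambda>(p, v). geod ?F p v) has_derivative (\<lambda>(x, y). wedge_deriv p v x y)) (at (p, v))" for p v
      unfolding case_prod_beta curved_space_simps
      by (rule has_derivative_eq_rhs[OF wedge.FDERIV[OF bounded_linear_imp_has_derivative[OF bounded_linear_fst]
            bounded_linear_imp_has_derivative[OF bounded_linear_snd]]])
        (simp add: wedge_deriv_def fun_eq_iff add.commute)
    have "bilinear (\<lambda>(A::real^4^4) z. - (A *v eps_dual \<epsilon> z))"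
      unfolding bilinear_def
      by (auto intro!: linearI simp: linear_add[OF linear_eps_dual] linear_scale[OF linear_eps_dual]
          matrix_vector_right_distrib matrix_vector_mult_add_rdistrib matrix_vector_mult_scaleR scaleR_matrix_vector_assoc)
    then have "bounded_bilinear (\<lambda>(A::real^4^4) z. - (A *v eps_dual \<epsilon> z))"
      by (simp add: bilinear_conv_bounded_bilinear)
    from smooth_on_bilinear[OF open_UNIV this smooth_on_fst[OF open_UNIV smooth_on_ident[OF open_UNIV]]
        smooth_on_snd[OF open_UNIV smooth_on_ident[OF open_UNIV]]]
    show "smooth_on (eps_direction \<epsilon>) UNIV"
      unfolding eps_direction_def[abs_def] .
    show "eps_direction \<epsilon> (geod ?F p v, p) = v"
      if "p \<in> carrier_set ?F" "\<epsilon> * metric ?F v p = 0" for p v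
      using that sph[of p] by (simp add: eps_direction_def wedge_mult_dual curved_space_simps eps_pm_one)
  qed
qed

text \<open>The derivation of the exterior algebra which extends \<open>A\<close>. Both complex structures on the space of
geodesics are of this form, with \<open>A\<close> depending on the geodesic only. This is why they do not depend
on the pair \<open>x, y\<close> by which a geodesic is represented.\<close>

definition derivation :: "real^4^4 \<Rightarrow> real^4^4 \<Rightarrow> real^4^4" where
  "derivation A W = A ** W + W ** transpose A"

lemma derivation_wedge: "derivation A (wedge x y) = wedge (A *v x) y + wedge x (A *v y)"
  by (simp add: derivation_def vec_eq_iff matrix_matrix_mult_def matrix_vector_mult_def wedge_def transpose_def
      sum_4 algebra_simps)

lemma matrix_mult_add_rdistrib: "(A + B) ** C = A ** C + B ** (C :: real^4^4)" for A B :: "real^4^4"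
  by (simp add: matrix_matrix_mult_def vec_eq_iff sum.distrib algebra_simps)

lemma derivation_add: "derivation A (V + W) = derivation A V + derivation A W"
  by (simp add: derivation_def matrix_add_ldistrib matrix_mult_add_rdistrib)


definition curved_frame :: "real \<Rightarrow> real^4 \<Rightarrow> real^4 \<Rightarrow> real^4 \<Rightarrow> real^4 \<Rightarrow> bool" where
  "curved_frame \<epsilon> p v w n \<longleftrightarrow> p \<in> eps_sphere \<epsilon> \<and> eps_form \<epsilon> p p = 1 \<and>
     eps_form \<epsilon> v v = \<epsilon> \<and> eps_form \<epsilon> w w = \<epsilon> \<and> eps_form \<epsilon> n n = \<epsilon> \<and>
     eps_form \<epsilon> v p = 0 \<and> eps_form \<epsilon> w p = 0 \<and> eps_form \<epsilon> n p = 0 \<and>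
     eps_form \<epsilon> v w = 0 \<and> eps_form \<epsilon> v n = 0 \<and> eps_form \<epsilon> w n = 0"

context
  fixes \<epsilon> :: real
  assumes \<epsilon>: "\<epsilon> \<in> {1, - 1}"
begin

lemma eps_pm_one: "\<epsilon> * \<epsilon> = 1" "\<epsilon> * (\<epsilon> * a) = a" "\<epsilon> \<noteq> 0" "\<epsilon> * a = 1 \<longleftrightarrow> a = \<epsilon>"
  using \<epsilon> by auto

abbreviation "e \<equiv> eps_form \<epsilon>"

lemma curved_frame_iff:
  "geodesic_space.frame (curved_space \<epsilon>) \<epsilon> p v w n \<longleftrightarrow> curved_frame \<epsilon> p v w n"
  unfolding geodesic_space.frame_def[OF curved_geodesic_space[OF \<epsilon>]] curved_frame_def curved_space_simps
  by (auto simp: eps_pm_one eps_sphere_def)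

lemma curved_frameD:
  assumes "curved_frame \<epsilon> p v w n"
  shows "p \<in> eps_sphere \<epsilon>" "e p p = 1" "e v v = \<epsilon>" "e w w = \<epsilon>" "e n n = \<epsilon>"
    "e v p = 0" "e w p = 0" "e n p = 0" "e v w = 0" "e v n = 0" "e w n = 0"
    "e p v = 0" "e p w = 0" "e p n = 0" "e w v = 0" "e n v = 0" "e n w = 0"
  using assms eps_form_sym[of \<epsilon> p v] eps_form_sym[of \<epsilon> p w] eps_form_sym[of \<epsilon> p n]
    eps_form_sym[of \<epsilon> w v] eps_form_sym[of \<epsilon> n v] eps_form_sym[of \<epsilon> n w] by (auto simp: curved_frame_def)

lemma perp_expand:
  assumes fr: "curved_frame \<epsilon> p v w n" and X: "X \<in> eps_perp \<epsilon> p v"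
  shows "X = (\<epsilon> * e X w) *\<^sub>R w + (\<epsilon> * e X n) *\<^sub>R n"
  using geodesic_space.frame_expand[OF curved_geodesic_space[OF \<epsilon>] curved_frame_iff[THEN iffD2, OF fr], of X] X
  by (simp add: curved_space_simps eps_perp_def)

lemma curved_frame_det:
  assumes fr: "curved_frame \<epsilon> p v w n"
  shows "det (vector [p, v, w, n] :: real^4^4) \<noteq> 0"
proof
  let ?M = "vector [p, v, w, n] :: real^4^4"
  note f = curved_frameD[OF fr]
  let ?N = "(\<chi> i j. eps_sign \<epsilon> i * ?M $ j $ i) :: real^4^4"
  have G: "(?M ** ?N) $ i $ j = e (?M $ i) (?M $ j)" for i j
    by (simp add: matrix_matrix_mult_def eps_form_def eps_sign_def sum_4 algebra_simps)
  have off: "(?M ** ?N) $ i $ j = 0" if "i \<noteq> j" for i j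
    using that exhaust_4[of i] exhaust_4[of j] unfolding G by (elim disjE) (simp_all add: vector_4 f)
  have "(?M ** ?N) $ i $ i \<noteq> 0" for i
    using exhaust_4[of i] eps_pm_one(3) unfolding G by (elim disjE) (simp_all add: vector_4 f)
  then have "det (?M ** ?N) \<noteq> 0" by (simp add: det_diagonal[OF off])
  moreover assume "det ?M = 0"
  ultimately show False by (simp add: det_mul)
qed

definition frame_orientation :: "real^4 \<Rightarrow> real^4 \<Rightarrow> real^4 \<Rightarrow> real^4 \<Rightarrow> real" where
  "frame_orientation p v w n = sgn (det (vector [p, v, w, n] :: real^4^4))"

text \<open>On the plane spanned by \<open>w\<close> and \<open>n\<close>, the first three conditions in the definition of \<open>eps_rot\<close>
determine the vector up to sign, and the condition on the determinant fixes the sign.\<close>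

lemma eps_rot_frame:
  assumes fr: "curved_frame \<epsilon> p v w n"
  shows "eps_rot \<epsilon> p v (a *\<^sub>R w + b *\<^sub>R n) = frame_orientation p v w n *\<^sub>R (a *\<^sub>R n - b *\<^sub>R w)"
proof -
  note f = curved_frameD[OF fr]
  define d where "d = det (vector [p, v, w, n] :: real^4^4)"
  define s where "s = frame_orientation p v w n"
  have d0: "d \<noteq> 0" using curved_frame_det[OF fr] by (simp add: d_def)
  have s: "s * s = 1" "s = 1 \<or> s = - 1" "0 < s * d"
    using d0 by (auto simp: s_def frame_orientation_def d_def[symmetric] sgn_if)
  let ?X = "a *\<^sub>R w + b *\<^sub>R n"
  have det: "det (vector [p, v, ?X, z1 *\<^sub>R w + z2 *\<^sub>R n] :: real^4^4) = (a * z2 - b * z1) * d" for z1 z2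
  proof -
    have W: "wedge ?X (z1 *\<^sub>R w + z2 *\<^sub>R n) = (a * z2 - b * z1) *\<^sub>R wedge w n"
      by (simp add: wedge_simps wedge_self wedge_swap[of n w] algebra_simps)
    show ?thesis
      unfolding d_def det_4_wedge W vector_scaleR_component real_scaleR_def by (simp add: algebra_simps)
  qed
  show ?thesis
    unfolding eps_rot_def s_def[symmetric]
  proof (rule the_equality)
    have Z: "s *\<^sub>R (a *\<^sub>R n - b *\<^sub>R w) = (- s * b) *\<^sub>R w + (s * a) *\<^sub>R n" by (simp add: algebra_simps)
    have "0 \<le> (a * a + b * b) * (s * d)" using s(3) by simp
    then have "0 \<le> det (vector [p, v, ?X, (- s * b) *\<^sub>R w + (s * a) *\<^sub>R n] :: real^4^4)"
      unfolding det by (simp add: algebra_simps)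
    moreover have "e ((- s * b) *\<^sub>R w + (s * a) *\<^sub>R n) ((- s * b) *\<^sub>R w + (s * a) *\<^sub>R n) = e ?X ?X"
      using s(2) by (auto simp: eps_simps f)
    moreover have "(- s * b) *\<^sub>R w + (s * a) *\<^sub>R n \<in> eps_perp \<epsilon> p v"
      by (simp add: eps_perp_def eps_simps f)
    moreover have "e ((- s * b) *\<^sub>R w + (s * a) *\<^sub>R n) ?X = 0"
      by (simp add: eps_simps f)
    ultimately show "s *\<^sub>R (a *\<^sub>R n - b *\<^sub>R w) \<in> eps_perp \<epsilon> p v \<and> e (s *\<^sub>R (a *\<^sub>R n - b *\<^sub>R w)) ?X = 0 \<and>
        e (s *\<^sub>R (a *\<^sub>R n - b *\<^sub>R w)) (s *\<^sub>R (a *\<^sub>R n - b *\<^sub>R w)) = e ?X ?X \<and>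
        0 \<le> det (vector [p, v, ?X, s *\<^sub>R (a *\<^sub>R n - b *\<^sub>R w)] :: real^4^4)"
      unfolding Z by blast
  next
    fix Z assume Z: "Z \<in> eps_perp \<epsilon> p v \<and> e Z ?X = 0 \<and> e Z Z = e ?X ?X \<and>
        0 \<le> det (vector [p, v, ?X, Z] :: real^4^4)"
    then obtain z1 z2 where z: "Z = z1 *\<^sub>R w + z2 *\<^sub>R n" using perp_expand[OF fr] by blast
    have "\<epsilon> * (z1 * a + z2 * b) = 0" "\<epsilon> * (z1 * z1 + z2 * z2) = \<epsilon> * (a * a + b * b)"
      using Z by (simp_all add: z eps_simps f algebra_simps)
    then have 1: "z1 * a + z2 * b = 0" and 2: "z1 * z1 + z2 * z2 = a * a + b * b"
      using eps_pm_one(3) by simp_all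
    have 3: "0 \<le> (a * z2 - b * z1) * d" using Z unfolding z det by simp
    define r where "r = a * a + b * b"
    define k where "k = a * z2 - b * z1"
    have "k * k = (a * a + b * b) * (z1 * z1 + z2 * z2) - (z1 * a + z2 * b) * (z1 * a + z2 * b)"
      by (simp add: k_def algebra_simps)
    then have kk: "k * k = r * r" by (simp add: 1 2 r_def)
    have r: "0 \<le> r" by (simp add: r_def)
    have ks: "k = s * r"
    proof -
      have "k = r \<or> k = - r" using kk by (simp add: square_eq_iff)
      moreover have "0 \<le> k * s"
      proof -
        have "0 \<le> (k * d) * (s * d)" using 3 s(3) by (simp add: k_def)
        then have 4: "0 \<le> (k * s) * (d * d)" by (simp add: ac_simps)
        have "0 < d * d" using d0 by (simp add: zero_less_mult_iff) linarith
        then show ?thesis using 4 mult_neg_pos[of "k * s" "d * d"] by linarith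
      qed
      ultimately show ?thesis using s(2) r by auto
    qed
    have id: "r * z2 = a * k + b * (z1 * a + z2 * b)" "r * z1 = a * (z1 * a + z2 * b) - b * k"
      by (simp_all add: r_def k_def algebra_simps)
    have rz: "r * z2 = r * (s * a)" "r * z1 = r * (- s * b)"
      using id unfolding 1 ks by (simp_all add: ac_simps)
    have "z2 = s * a \<and> z1 = - s * b"
    proof (cases "r = 0")
      case True
      then show ?thesis using 2 by (simp add: r_def sum_squares_eq_zero_iff)
    next
      case False
      then show ?thesis
        using rz mult_left_cancel[of r z2 "s * a"] mult_left_cancel[of r z1 "- s * b"] by blast
    qed
    then show "Z = s *\<^sub>R (a *\<^sub>R n - b *\<^sub>R w)" by (simp add: z algebra_simps)
  qed
qed

text \<open>The plane orthogonal to a geodesic is the kernel of its bivector.\<close>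

lemma eps_perp_wedge:
  assumes "eps_frame \<epsilon> x y"
  shows "\<zeta> \<in> eps_perp \<epsilon> x y \<longleftrightarrow> wedge x y *v eps_dual \<epsilon> \<zeta> = 0"
proof
  assume "\<zeta> \<in> eps_perp \<epsilon> x y"
  then show "wedge x y *v eps_dual \<epsilon> \<zeta> = 0"
    by (simp add: eps_perp_def wedge_mult_dual eps_form_sym[of \<epsilon> x \<zeta>] eps_form_sym[of \<epsilon> y \<zeta>])
next
  assume "wedge x y *v eps_dual \<epsilon> \<zeta> = 0"
  then have 0: "e y \<zeta> *\<^sub>R x - e x \<zeta> *\<^sub>R y = 0" by (simp add: wedge_mult_dual)
  have f: "e x x = 1" "e x y = 0" "e y y = \<epsilon>" "e y x = 0"
    using assms eps_form_sym[of \<epsilon> x y] by (auto simp: eps_frame_def eps_sphere_def)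
  have "e (e y \<zeta> *\<^sub>R x - e x \<zeta> *\<^sub>R y) x = 0" "e (e y \<zeta> *\<^sub>R x - e x \<zeta> *\<^sub>R y) y = 0"
    by (simp_all only: 0 eps.zero_left)
  then show "\<zeta> \<in> eps_perp \<epsilon> x y"
    using eps_pm_one(3) by (simp add: eps_simps f eps_perp_def eps_form_sym[of \<epsilon> x \<zeta>] eps_form_sym[of \<epsilon> y \<zeta>])
qed

lemma frame_change:
  assumes "eps_frame \<epsilon> x y" "eps_frame \<epsilon> p v" "wedge p v = wedge x y"
  shows "eps_perp \<epsilon> x y = eps_perp \<epsilon> p v" "eps_rot \<epsilon> x y = eps_rot \<epsilon> p v"
proof -
  show P: "eps_perp \<epsilon> x y = eps_perp \<epsilon> p v"
    using eps_perp_wedge[OF assms(1)] eps_perp_wedge[OF assms(2)] assms(3) by auto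
  show "eps_rot \<epsilon> x y = eps_rot \<epsilon> p v"
    unfolding eps_rot_def P det_4_wedge assms(3) ..
qed

lemma eps_frame_of: "curved_frame \<epsilon> p v w n \<Longrightarrow> eps_frame \<epsilon> p v"
  by (simp add: curved_frame_def eps_frame_def eps_form_sym[of \<epsilon> p v])

definition turn_matrix :: "real^4 \<Rightarrow> real^4 \<Rightarrow> real \<Rightarrow> real^4^4" where
  "turn_matrix w n s = (\<chi> i j. s * \<epsilon> * (n $ i * eps_dual \<epsilon> w $ j - w $ i * eps_dual \<epsilon> n $ j))"

lemma turn_matrix_mult: "turn_matrix w n s *v \<zeta> = (s * \<epsilon>) *\<^sub>R (e w \<zeta> *\<^sub>R n - e n \<zeta> *\<^sub>R w)"
  by (simp add: turn_matrix_def vec_eq_iff matrix_vector_mult_def eps_dual_def eps_form_def eps_sign_def sum_4 algebra_simps)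

text \<open>The structure \<open>eps_J'\<close> is the derivation given by rotation of the orthogonal plane of the geodesic,
extended by zero.\<close>

lemma eps_J'_frame:
  assumes fr: "curved_frame \<epsilon> p v w n"
  shows "eps_J' \<epsilon> (wedge p v) (wedge p (a *\<^sub>R w + b *\<^sub>R n) + wedge v (c *\<^sub>R w + d *\<^sub>R n)) =
     frame_orientation p v w n *\<^sub>R (wedge p (a *\<^sub>R n - b *\<^sub>R w) + wedge v (c *\<^sub>R n - d *\<^sub>R w))"
proof -
  note f = curved_frameD[OF fr]
  let ?s = "frame_orientation p v w n"
  let ?A = "turn_matrix w n ?s"
  have perp: "a *\<^sub>R w + b *\<^sub>R n \<in> eps_perp \<epsilon> p v" for a b by (simp add: eps_perp_def eps_simps f)
  have rot: "eps_rot \<epsilon> p v X = ?A *v X" if "X \<in> eps_perp \<epsilon> p v" for X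
  proof -
    have "eps_rot \<epsilon> p v X = ?s *\<^sub>R ((\<epsilon> * e X w) *\<^sub>R n - (\<epsilon> * e X n) *\<^sub>R w)"
      using eps_rot_frame[OF fr, of "\<epsilon> * e X w" "\<epsilon> * e X n"] perp_expand[OF fr that] by simp
    then show ?thesis
      by (simp add: turn_matrix_mult eps_form_sym[of \<epsilon> X] algebra_simps)
  qed
  have as_derivation: "wedge x (eps_rot \<epsilon> x y X) + wedge y (eps_rot \<epsilon> x y Y) = derivation ?A (wedge x X + wedge y Y)"
    if "eps_frame \<epsilon> x y" "wedge p v = wedge x y" "X \<in> eps_perp \<epsilon> x y" "Y \<in> eps_perp \<epsilon> x y" for x y X Y
  proof -
    note fc = frame_change[OF that(1) eps_frame_of[OF fr] that(2)]
    have "w \<in> eps_perp \<epsilon> x y" "n \<in> eps_perp \<epsilon> x y" unfolding fc using perp[of 1 0] perp[of 0 1] by simp_all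
    then have "?A *v x = 0" "?A *v y = 0" by (simp_all add: turn_matrix_mult eps_perp_def)
    then show ?thesis
      using rot that(3,4) by (simp add: derivation_add derivation_wedge wedge.zero_left fc)
  qed
  let ?X = "a *\<^sub>R w + b *\<^sub>R n" and ?Y = "c *\<^sub>R w + d *\<^sub>R n"
  have "eps_J' \<epsilon> (wedge p v) (wedge p ?X + wedge v ?Y) = wedge p (eps_rot \<epsilon> p v ?X) + wedge v (eps_rot \<epsilon> p v ?Y)"
    unfolding eps_J'_def
  proof (rule the_equality)
    show "\<exists>x y. eps_frame \<epsilon> x y \<and> wedge p v = wedge x y \<and>
      (\<exists>X\<in>eps_perp \<epsilon> x y. \<exists>Y\<in>eps_perp \<epsilon> x y. wedge p ?X + wedge v ?Y = wedge x X + wedge y Y \<and>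
        wedge p (eps_rot \<epsilon> p v ?X) + wedge v (eps_rot \<epsilon> p v ?Y) = wedge x (eps_rot \<epsilon> x y X) + wedge y (eps_rot \<epsilon> x y Y))"
      using eps_frame_of[OF fr] perp by blast
  next
    fix W' assume "\<exists>x y. eps_frame \<epsilon> x y \<and> wedge p v = wedge x y \<and>
      (\<exists>X\<in>eps_perp \<epsilon> x y. \<exists>Y\<in>eps_perp \<epsilon> x y. wedge p ?X + wedge v ?Y = wedge x X + wedge y Y \<and>
        W' = wedge x (eps_rot \<epsilon> x y X) + wedge y (eps_rot \<epsilon> x y Y))"
    then have "W' = derivation ?A (wedge p ?X + wedge v ?Y)" using as_derivation by fastforce
    then show "W' = wedge p (eps_rot \<epsilon> p v ?X) + wedge v (eps_rot \<epsilon> p v ?Y)"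
      using as_derivation[OF eps_frame_of[OF fr] refl perp perp] by simp
  qed
  then show ?thesis unfolding eps_rot_frame[OF fr] by (simp add: wedge_simps scaleR_add_right)
qed

text \<open>The structure \<open>eps_J\<close> is the derivation given by \<open>x \<mapsto> y\<close>, \<open>y \<mapsto> - \<epsilon> x\<close> and zero on the orthogonal
plane. This linear map is the bivector of the geodesic itself, up to sign.\<close>

lemma eps_J_frame:
  assumes fr: "eps_frame \<epsilon> p v" and XY: "X \<in> eps_perp \<epsilon> p v" "Y \<in> eps_perp \<epsilon> p v"
  shows "eps_J \<epsilon> (wedge p v) (wedge p X + wedge v Y) = wedge v X - \<epsilon> *\<^sub>R wedge p Y"
proof -
  define B where "B = (\<chi> i j. - (wedge p v $ i $ j * eps_sign \<epsilon> j))"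
  have B: "B *v \<zeta> = - (wedge p v *v eps_dual \<epsilon> \<zeta>)" for \<zeta>
    by (simp add: B_def vec_eq_iff matrix_vector_mult_def eps_dual_def sum_negf mult.assoc)
  have as_derivation: "wedge y X - \<epsilon> *\<^sub>R wedge x Y = derivation B (wedge x X + wedge y Y)"
    if xy: "eps_frame \<epsilon> x y" "wedge p v = wedge x y" and P: "X \<in> eps_perp \<epsilon> x y" "Y \<in> eps_perp \<epsilon> x y" for x y X Y
  proof -
    have f: "e x x = 1" "e x y = 0" "e y y = \<epsilon>" "e y x = 0"
      using xy(1) eps_form_sym[of \<epsilon> x y] by (auto simp: eps_frame_def eps_sphere_def)
    have "B *v x = y" "B *v y = - \<epsilon> *\<^sub>R x" "B *v X = 0" "B *v Y = 0"
      using eps_perp_wedge[OF xy(1)] P unfolding B xy(2) by (auto simp: wedge_mult_dual f)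
    then show ?thesis by (simp add: derivation_add derivation_wedge wedge_simps)
  qed
  show ?thesis
    unfolding eps_J_def
  proof (rule the_equality)
    show "\<exists>x y. eps_frame \<epsilon> x y \<and> wedge p v = wedge x y \<and>
      (\<exists>X'\<in>eps_perp \<epsilon> x y. \<exists>Y'\<in>eps_perp \<epsilon> x y. wedge p X + wedge v Y = wedge x X' + wedge y Y' \<and>
        wedge v X - \<epsilon> *\<^sub>R wedge p Y = wedge y X' - \<epsilon> *\<^sub>R wedge x Y')"
      using fr XY by blast
  next
    fix W' assume "\<exists>x y. eps_frame \<epsilon> x y \<and> wedge p v = wedge x y \<and>
      (\<exists>X'\<in>eps_perp \<epsilon> x y. \<exists>Y'\<in>eps_perp \<epsilon> x y. wedge p X + wedge v Y = wedge x X' + wedge y Y' \<and>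
        W' = wedge y X' - \<epsilon> *\<^sub>R wedge x Y')"
    then have "W' = derivation B (wedge p X + wedge v Y)" using as_derivation by fastforce
    then show "W' = wedge v X - \<epsilon> *\<^sub>R wedge p Y" using as_derivation[OF fr refl XY] by simp
  qed
qed

lemma wedge_deriv_frame:
  "wedge_deriv p v (a *\<^sub>R v + b *\<^sub>R w) (t *\<^sub>R w + h *\<^sub>R n - (\<epsilon> * c) *\<^sub>R p)
    = wedge p (t *\<^sub>R w + h *\<^sub>R n) + wedge v ((- b) *\<^sub>R w + 0 *\<^sub>R n)"
  by (simp add: wedge_deriv_def wedge_simps wedge_self wedge_swap[of w v])

lemma curved_neutral_space: "neutral_space (curved_space \<epsilon>) \<epsilon> (eps_direction \<epsilon>) wedge_deriv"
proof (intro neutral_space.intro neutral_space_axioms.intro)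
  let ?F = "curved_space \<epsilon>"
  show "geodesic_space ?F \<epsilon> (eps_direction \<epsilon>) wedge_deriv" by (rule curved_geodesic_space[OF \<epsilon>])
  fix p v w n assume "geodesic_space.frame ?F \<epsilon> p v w n"
  then have fr: "curved_frame \<epsilon> p v w n" by (simp add: curved_frame_iff)
  note f = curved_frameD[OF fr]
  let ?s = "frame_orientation p v w n"
  have s: "?s \<noteq> 0" using curved_frame_det[OF fr] by (simp add: frame_orientation_def sgn_eq_0_iff)
  have perp: "a *\<^sub>R w + b *\<^sub>R n \<in> eps_perp \<epsilon> p v" for a b by (simp add: eps_perp_def eps_simps f)
  show "\<exists>\<kappa>. \<kappa> \<noteq> 0 \<and> (\<forall>a1 b1 t1 h1 a2 b2 t2 h2. neutral ?F (geod ?F p v)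
        (wedge_deriv p v (a1 *\<^sub>R v + b1 *\<^sub>R w) (t1 *\<^sub>R w + h1 *\<^sub>R n - (\<epsilon> * a1) *\<^sub>R p))
        (wedge_deriv p v (a2 *\<^sub>R v + b2 *\<^sub>R w) (t2 *\<^sub>R w + h2 *\<^sub>R n - (\<epsilon> * a2) *\<^sub>R p)) = \<kappa> * (b1 * h2 + b2 * h1))"
  proof (intro exI[of _ "- ?s"] conjI allI)
    fix a1 b1 t1 h1 a2 b2 t2 h2
    have X: "?s *\<^sub>R (t2 *\<^sub>R n - h2 *\<^sub>R w) \<in> eps_perp \<epsilon> p v" "?s *\<^sub>R ((- b2) *\<^sub>R n - 0 *\<^sub>R w) \<in> eps_perp \<epsilon> p v"
      by (simp_all add: eps_perp_def eps_simps f)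
    have J': "eps_J' \<epsilon> (wedge p v) (wedge p (t2 *\<^sub>R w + h2 *\<^sub>R n) + wedge v ((- b2) *\<^sub>R w + 0 *\<^sub>R n))
       = wedge p (?s *\<^sub>R (t2 *\<^sub>R n - h2 *\<^sub>R w)) + wedge v (?s *\<^sub>R ((- b2) *\<^sub>R n - 0 *\<^sub>R w))"
      unfolding eps_J'_frame[OF fr] by (simp only: wedge.scaleR_right scaleR_add_right)
    note JJ = eps_J_frame[OF eps_frame_of[OF fr] X]
    show "neutral ?F (geod ?F p v)
        (wedge_deriv p v (a1 *\<^sub>R v + b1 *\<^sub>R w) (t1 *\<^sub>R w + h1 *\<^sub>R n - (\<epsilon> * a1) *\<^sub>R p))
        (wedge_deriv p v (a2 *\<^sub>R v + b2 *\<^sub>R w) (t2 *\<^sub>R w + h2 *\<^sub>R n - (\<epsilon> * a2) *\<^sub>R p)) = - ?s * (b1 * h2 + b2 * h1)"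
      unfolding curved_space_simps wedge_deriv_frame J' JJ
      by (simp add: eps2.add_left eps2.add_right eps2.diff_right eps2.minus_right eps2.scaleR_right eps_form2_wedge eps_simps f eps_pm_one algebra_simps)
  qed (use s in simp)
  show "\<exists>s. s \<noteq> 0 \<and> (\<forall>a t h. alpha_cx ?F (geod ?F p v) (wedge_deriv p v (a *\<^sub>R v) (t *\<^sub>R w + h *\<^sub>R n - (\<epsilon> * a) *\<^sub>R p))
        = wedge_deriv p v 0 (s *\<^sub>R (t *\<^sub>R n - h *\<^sub>R w)))"
  proof (intro exI[of _ ?s] conjI s allI)
    fix a t h
    show "alpha_cx ?F (geod ?F p v) (wedge_deriv p v (a *\<^sub>R v) (t *\<^sub>R w + h *\<^sub>R n - (\<epsilon> * a) *\<^sub>R p))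
        = wedge_deriv p v 0 (?s *\<^sub>R (t *\<^sub>R n - h *\<^sub>R w))"
      using wedge_deriv_frame[of p v a 0 w t h n a] eps_J'_frame[OF fr, of t h 0 0]
      by (simp add: curved_space_simps wedge_deriv_def wedge_simps)
  qed
  show "wedge_deriv p v (a *\<^sub>R v) (t *\<^sub>R w + h *\<^sub>R n - (\<epsilon> * a) *\<^sub>R p) = wedge_deriv p v 0 (t *\<^sub>R w + h *\<^sub>R n)" for a t h
    by (simp add: wedge_deriv_def wedge_simps wedge_self)
qed

end

section \<open>Euclidean space\<close>

lemma vector_3_eq: "(vector [a, b, c] :: real^3) = a *\<^sub>R vector [1, 0, 0] + b *\<^sub>R vector [0, 1, 0] + c *\<^sub>R vector [0, 0, 1]"
  by (simp add: vec_eq_iff forall_3)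

lemma has_derivative_vector_3:
  assumes "(f has_derivative f') F" "(g has_derivative g') F" "(h has_derivative h') F"
  shows "((\<lambda>x. vector [f x, g x, h x] :: real^3) has_derivative (\<lambda>x. vector [f' x, g' x, h' x])) F"
  unfolding vector_3_eq[of "f _"] vector_3_eq[of "f' _"]
  by (intro has_derivative_add has_derivative_scaleR_left assms)

text \<open>The coordinate \<open>\<xi>\<close> is stereographic, so every component of the chart is the quotient of a polynomial by
a power of \<open>1 + \<bar>\<xi>\<bar>\<^sup>2\<close>. The polynomials are named below, and identities between components are
reduced to polynomial identities.\<close>

definition stereo_denom :: "complex \<Rightarrow> real" where "stereo_denom \<xi> = 1 + (Re \<xi>)\<^sup>2 + (Im \<xi>)\<^sup>2"

lemma stereo_denom_pos: "0 < stereo_denom \<xi>" "stereo_denom \<xi> \<noteq> 0"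
  using add_pos_nonneg[of 1 "(Re \<xi>)\<^sup>2 + (Im \<xi>)\<^sup>2"] by (simp_all add: stereo_denom_def add.assoc)

definition dir_z :: "complex \<Rightarrow> real" where "dir_z \<xi> = 1 - (Re \<xi>)\<^sup>2 - (Im \<xi>)\<^sup>2"

definition foot_x :: "complex \<Rightarrow> complex \<Rightarrow> real" where
  "foot_x \<xi> a = 2 * (Re a - Re a * ((Re \<xi>)\<^sup>2 - (Im \<xi>)\<^sup>2) - Im a * (2 * Re \<xi> * Im \<xi>))"

definition foot_y :: "complex \<Rightarrow> complex \<Rightarrow> real" where
  "foot_y \<xi> a = 2 * (Im a - Re a * (2 * Re \<xi> * Im \<xi>) + Im a * ((Re \<xi>)\<^sup>2 - (Im \<xi>)\<^sup>2))"

definition foot_z :: "complex \<Rightarrow> complex \<Rightarrow> real" where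
  "foot_z \<xi> a = - 4 * (Re \<xi> * Re a + Im \<xi> * Im a)"

lemmas chart_polys = dir_z_def foot_x_def foot_y_def foot_z_def stereo_denom_def

lemma line_dir_real: "line_dir \<xi> = vector [2 * Re \<xi> / stereo_denom \<xi>, 2 * Im \<xi> / stereo_denom \<xi>, dir_z \<xi> / stereo_denom \<xi>]"
  by (simp add: line_dir_def stereo_denom_def dir_z_def Let_def cmod_power2 Re_divide_of_real Im_divide_of_real diff_diff_eq add.assoc)

lemma line_foot_real:
  "line_foot \<xi> a = vector [foot_x \<xi> a / (stereo_denom \<xi>)\<^sup>2, foot_y \<xi> a / (stereo_denom \<xi>)\<^sup>2, foot_z \<xi> a / (stereo_denom \<xi>)\<^sup>2]"
proof -
  have d: "1 + (cmod \<xi>)\<^sup>2 = stereo_denom \<xi>" by (simp add: stereo_denom_def cmod_power2 add.assoc)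
  show ?thesis
    unfolding line_foot_def Let_def d Re_divide_of_real Im_divide_of_real foot_x_def foot_y_def foot_z_def
    by (simp add: power2_eq_square algebra_simps)
qed

lemma line_dir_unit: "line_dir \<xi> \<bullet> line_dir \<xi> = 1"
proof -
  have "(2 * Re \<xi>)\<^sup>2 + (2 * Im \<xi>)\<^sup>2 + (dir_z \<xi>)\<^sup>2 = (stereo_denom \<xi>)\<^sup>2"
    unfolding chart_polys by algebra
  then show ?thesis using stereo_denom_pos(2)[of \<xi>]
    by (simp add: line_dir_real inner_vec_def sum_3 power2_eq_square add_divide_distrib[symmetric])
qed

lemma line_foot_perp: "line_dir \<xi> \<bullet> line_foot \<xi> a = 0"
proof -
  have "2 * Re \<xi> * foot_x \<xi> a + 2 * Im \<xi> * foot_y \<xi> a + dir_z \<xi> * foot_z \<xi> a = 0"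
    unfolding chart_polys by algebra
  then show ?thesis
    by (simp add: line_dir_real line_foot_real inner_vec_def sum_3 add_divide_distrib[symmetric])
qed

lemma line_foot_inner: "line_foot \<xi> a \<bullet> line_foot \<xi> b = 4 / (stereo_denom \<xi>)\<^sup>2 * Re (a * cnj b)"
proof -
  let ?N = "foot_x \<xi> a * foot_x \<xi> b + foot_y \<xi> a * foot_y \<xi> b + foot_z \<xi> a * foot_z \<xi> b"
    and ?c = "4 * (Re a * Re b + Im a * Im b)"
  have "?N = ?c * (stereo_denom \<xi>)\<^sup>2"
    unfolding chart_polys by algebra
  have N: "?N / ((stereo_denom \<xi>)\<^sup>2 * (stereo_denom \<xi>)\<^sup>2) = ?c / (stereo_denom \<xi>)\<^sup>2"
    unfolding \<open>?N = ?c * (stereo_denom \<xi>)\<^sup>2\<close>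
    by (rule mult_divide_mult_cancel_right) (use stereo_denom_pos(2)[of \<xi>] in simp)
  have "line_foot \<xi> a \<bullet> line_foot \<xi> b = ?N / ((stereo_denom \<xi>)\<^sup>2 * (stereo_denom \<xi>)\<^sup>2)"
    unfolding line_foot_real inner_vec_def sum_3 vector_3 inner_real_def times_divide_times_eq add_divide_distrib[symmetric] ..
  then show ?thesis unfolding N by simp
qed

text \<open>Stereographic projection is conformal: multiplication of tangent vectors by \<open>\<i>\<close> is the rotation by a
right angle about the direction.\<close>

lemma line_dir_cross: "cross3 (line_dir \<xi>) (line_foot \<xi> a) = line_foot \<xi> (\<i> * a)"
proof -
  have p: "2 * Im \<xi> * foot_z \<xi> a - dir_z \<xi> * foot_y \<xi> a = foot_x \<xi> (\<i> * a) * stereo_denom \<xi>"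
    "dir_z \<xi> * foot_x \<xi> a - 2 * Re \<xi> * foot_z \<xi> a = foot_y \<xi> (\<i> * a) * stereo_denom \<xi>"
    "2 * Re \<xi> * foot_y \<xi> a - 2 * Im \<xi> * foot_x \<xi> a = foot_z \<xi> (\<i> * a) * stereo_denom \<xi>"
    unfolding chart_polys Re_i_times Im_i_times by algebra+
  have q: "x / stereo_denom \<xi> * (y / (stereo_denom \<xi>)\<^sup>2) - y' / (stereo_denom \<xi>)\<^sup>2 * (x' / stereo_denom \<xi>) = z / (stereo_denom \<xi>)\<^sup>2"
    if "x * y - x' * y' = z * stereo_denom \<xi>" for x y x' y' z
  proof -
    have "x / stereo_denom \<xi> * (y / (stereo_denom \<xi>)\<^sup>2) - y' / (stereo_denom \<xi>)\<^sup>2 * (x' / stereo_denom \<xi>) = (x * y - x' * y') / (stereo_denom \<xi> * (stereo_denom \<xi>)\<^sup>2)"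
      by (simp add: diff_divide_distrib mult.commute)
    then show ?thesis unfolding that using stereo_denom_pos(2)[of \<xi>] by simp
  qed
  show ?thesis
    unfolding vec_eq_iff forall_3 cross_components line_dir_real line_foot_real vector_3
    by (intro conjI q p)
qed

lemma linear_line_foot: "linear (line_foot \<xi>)"
  by (rule linearI) (simp_all add: line_foot_real chart_polys vec_eq_iff forall_3 add_divide_distrib[symmetric] algebra_simps)

lemma quotient_has_derivative:
  fixes N d :: "'a::real_normed_vector \<Rightarrow> real"
  assumes "(N has_derivative N') (at z)" "(d has_derivative d') (at z)" "d z \<noteq> 0"
  shows "((\<lambda>z. N z / (d z)\<^sup>2) has_derivative (\<lambda>h. (N' h * d z - 2 * N z * d' h) / (d z) ^ 3)) (at z)"
    and "((\<lambda>z. N z / d z) has_derivative (\<lambda>h. (N' h * d z - N z * d' h) / (d z)\<^sup>2)) (at z)"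
  by (auto intro!: derivative_eq_intros assms simp: fun_eq_iff assms(3) field_simps power2_eq_square power3_eq_cube)

text \<open>The formula for the foot point is the derivative of the stereographic chart. This identifies the
fibre coordinate \<open>\<eta>\<close> with a tangent vector of the sphere, and for this reason \<open>line_foot \<xi>\<close> is used
below as the notation for that derivative.\<close>

lemma line_dir_has_derivative: "(line_dir has_derivative line_foot \<xi>) (at \<xi>)"
proof -
  let ?d = "\<lambda>h. 2 * (Re \<xi> * Re h + Im \<xi> * Im h)"
  have d: "(stereo_denom has_derivative ?d) (at \<xi>)"
    unfolding stereo_denom_def[abs_def] by (auto intro!: derivative_eq_intros simp: fun_eq_iff algebra_simps)
  have n: "((\<lambda>z. 2 * Re z) has_derivative (\<lambda>h. 2 * Re h)) (at \<xi>)"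
    "((\<lambda>z. 2 * Im z) has_derivative (\<lambda>h. 2 * Im h)) (at \<xi>)"
    "(dir_z has_derivative (\<lambda>h. - ?d h)) (at \<xi>)"
    unfolding dir_z_def[abs_def] by (auto intro!: derivative_eq_intros simp: fun_eq_iff algebra_simps)
  note q = quotient_has_derivative(2)[OF _ d stereo_denom_pos(2)]
  have e: "2 * Re h * stereo_denom \<xi> - 2 * Re \<xi> * ?d h = foot_x \<xi> h"
    "2 * Im h * stereo_denom \<xi> - 2 * Im \<xi> * ?d h = foot_y \<xi> h"
    "- ?d h * stereo_denom \<xi> - dir_z \<xi> * ?d h = foot_z \<xi> h" for h
    unfolding chart_polys by algebra+
  show ?thesis
    unfolding line_dir_real[abs_def]
    by (rule has_derivative_eq_rhs[OF has_derivative_vector_3[OF q[OF n(1)] q[OF n(2)] q[OF n(3)]]])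
      (simp only: e line_foot_real[abs_def])
qed

text \<open>The second derivative of the chart, split into tangential and normal part: the tangential part is
given by the Christoffel symbol \<open>- 2 cnj \<xi> / (1 + \<bar>\<xi>\<bar>\<^sup>2)\<close> of the round metric, which is complex bilinear, and
the normal part by the second fundamental form of the unit sphere.\<close>

lemma line_foot_has_derivative:
  "((\<lambda>z. line_foot (fst z) (snd z)) has_derivative
    (\<lambda>h. line_foot \<xi> (snd h - 2 * cnj \<xi> * fst h * \<eta> / of_real (stereo_denom \<xi>))
      - (line_foot \<xi> \<eta> \<bullet> line_foot \<xi> (fst h)) *\<^sub>R line_dir \<xi>)) (at (\<xi>, \<eta>))"
proof -
  let ?x = "Re \<xi>" and ?y = "Im \<xi>" and ?p = "Re \<eta>" and ?q = "Im \<eta>" and ?d = "stereo_denom \<xi>"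
  define d' where "d' h = 2 * (?x * Re (fst h) + ?y * Im (fst h))" for h :: "complex \<times> complex"
  define m1 where "m1 h = foot_x \<xi> (snd h) - 2 * (?p * (2 * ?x * Re (fst h) - 2 * ?y * Im (fst h))
      + ?q * (2 * Re (fst h) * ?y + 2 * ?x * Im (fst h)))" for h :: "complex \<times> complex"
  define m2 where "m2 h = foot_y \<xi> (snd h) - 2 * (?p * (2 * Re (fst h) * ?y + 2 * ?x * Im (fst h))
      - ?q * (2 * ?x * Re (fst h) - 2 * ?y * Im (fst h)))" for h :: "complex \<times> complex"
  define m3 where "m3 h = foot_z \<xi> (snd h) + foot_z (fst h) \<eta>" for h :: "complex \<times> complex"
  have d: "((\<lambda>z. stereo_denom (fst z)) has_derivative d') (at (\<xi>, \<eta>))"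
    unfolding stereo_denom_def d'_def[abs_def] by (auto intro!: derivative_eq_intros simp: fun_eq_iff algebra_simps)
  have n: "((\<lambda>z. foot_x (fst z) (snd z)) has_derivative m1) (at (\<xi>, \<eta>))"
    "((\<lambda>z. foot_y (fst z) (snd z)) has_derivative m2) (at (\<xi>, \<eta>))"
    "((\<lambda>z. foot_z (fst z) (snd z)) has_derivative m3) (at (\<xi>, \<eta>))"
    unfolding foot_x_def foot_y_def foot_z_def m1_def[abs_def] m2_def[abs_def] m3_def[abs_def]
    by (auto intro!: derivative_eq_intros simp: fun_eq_iff algebra_simps)
  have "stereo_denom (fst (\<xi>, \<eta>)) \<noteq> 0" using stereo_denom_pos(2) by simp
  note Q = quotient_has_derivative(1)[OF _ d this]
  show ?thesis
    unfolding line_foot_real[of "fst _"]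
  proof (rule has_derivative_eq_rhs[OF has_derivative_vector_3[OF Q[OF n(1)] Q[OF n(2)] Q[OF n(3)]]], rule ext)
    fix h :: "complex \<times> complex"
    let ?a = "fst h" and ?g = "4 * (?p * Re (fst h) + ?q * Im (fst h))"
    \<comment> \<open>\<open>b\<close> is the argument of \<open>line_foot \<xi>\<close> on the right-hand side, multiplied by the denominator\<close>
    define b where "b = Complex
      (Re (snd h) * ?d - 2 * (?x * Re ?a * ?p + ?y * Im ?a * ?p - ?x * Im ?a * ?q + ?y * Re ?a * ?q))
      (Im (snd h) * ?d - 2 * (?x * Im ?a * ?p - ?y * Re ?a * ?p + ?x * Re ?a * ?q + ?y * Im ?a * ?q))"
    have \<beta>: "snd h - 2 * cnj \<xi> * fst h * \<eta> / of_real ?d = b / of_real ?d"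
      using stereo_denom_pos(2)[of \<xi>]
      by (simp add: complex_eq_iff b_def Re_divide_of_real Im_divide_of_real field_simps)
    have g: "line_foot \<xi> \<eta> \<bullet> line_foot \<xi> (fst h) = ?g / ?d\<^sup>2"
      unfolding line_foot_inner by simp
    have c: "n / ?d ^ 3 = k / ?d\<^sup>2 - m / ?d\<^sup>2 * (l / ?d)" if "n = k * ?d - m * l" for n k m l
      unfolding that using stereo_denom_pos(2)[of \<xi>] by (simp add: field_simps power2_eq_square power3_eq_cube)
    have nb: "foot_x \<xi> (b / of_real ?d) * ?d = foot_x \<xi> b" "foot_y \<xi> (b / of_real ?d) * ?d = foot_y \<xi> b"
      "foot_z \<xi> (b / of_real ?d) * ?d = foot_z \<xi> b"
      using stereo_denom_pos(2)[of \<xi>]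
      by (simp_all add: foot_x_def foot_y_def foot_z_def Re_divide_of_real Im_divide_of_real field_simps)
    have "m1 h * ?d - 2 * foot_x \<xi> \<eta> * d' h = foot_x \<xi> b - ?g * (2 * ?x)"
      "m2 h * ?d - 2 * foot_y \<xi> \<eta> * d' h = foot_y \<xi> b - ?g * (2 * ?y)"
      "m3 h * ?d - 2 * foot_z \<xi> \<eta> * d' h = foot_z \<xi> b - ?g * dir_z \<xi>"
      unfolding m1_def m2_def m3_def d'_def b_def chart_polys complex.sel by algebra+
    note e = this[folded nb]
    show "vector [(m1 h * stereo_denom (fst (\<xi>, \<eta>)) - 2 * foot_x (fst (\<xi>, \<eta>)) (snd (\<xi>, \<eta>)) * d' h) / stereo_denom (fst (\<xi>, \<eta>)) ^ 3,
        (m2 h * stereo_denom (fst (\<xi>, \<eta>)) - 2 * foot_y (fst (\<xi>, \<eta>)) (snd (\<xi>, \<eta>)) * d' h) / stereo_denom (fst (\<xi>, \<eta>)) ^ 3,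
        (m3 h * stereo_denom (fst (\<xi>, \<eta>)) - 2 * foot_z (fst (\<xi>, \<eta>)) (snd (\<xi>, \<eta>)) * d' h) / stereo_denom (fst (\<xi>, \<eta>)) ^ 3]
      = line_foot \<xi> (snd h - 2 * cnj \<xi> * fst h * \<eta> / of_real ?d) - (line_foot \<xi> \<eta> \<bullet> line_foot \<xi> (fst h)) *\<^sub>R line_dir \<xi>"
      unfolding \<beta> g line_foot_real[of \<xi> "b / _"] line_dir_real fst_conv snd_conv c[OF e(1)] c[OF e(2)] c[OF e(3)]
      by (simp add: vec_eq_iff forall_3)
  qed
qed

definition line_of_deriv :: "complex \<Rightarrow> complex \<Rightarrow> complex \<times> complex \<Rightarrow> (real^3) \<times> (real^3)" where
  "line_of_deriv \<xi> \<eta> = (\<lambda>(a, b). (line_foot \<xi> a, line_foot \<xi> (b - 2 * cnj \<xi> * a * \<eta> / of_real (stereo_denom \<xi>))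
      - (line_foot \<xi> \<eta> \<bullet> line_foot \<xi> a) *\<^sub>R line_dir \<xi>))"

lemma line_of_has_derivative: "(line_of has_derivative line_of_deriv \<xi> \<eta>) (at (\<xi>, \<eta>))"
proof -
  have "((\<lambda>z. line_dir (fst z)) has_derivative (\<lambda>h. line_foot \<xi> (fst h))) (at (\<xi>, \<eta>))"
    using diff_chain_at[OF bounded_linear_imp_has_derivative[OF bounded_linear_fst], of line_dir "line_foot \<xi>" "(\<xi>, \<eta>)"]
      line_dir_has_derivative[of \<xi>] by (simp add: o_def)
  from has_derivative_Pair[OF this line_foot_has_derivative[of \<xi> \<eta>]] show ?thesis
    unfolding line_of_def line_of_deriv_def case_prod_beta .
qed

lemma line_foot_eq_0: "line_foot \<xi> a = 0 \<longleftrightarrow> a = 0"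
proof
  assume "line_foot \<xi> a = 0"
  then have "line_foot \<xi> a \<bullet> line_foot \<xi> a = 0" by simp
  then have "4 * (Re a * Re a) + 4 * (Im a * Im a) = 0"
    unfolding line_foot_inner using stereo_denom_pos(2)[of \<xi>] by simp
  then have "Re a * Re a + Im a * Im a = 0" by linarith
  then show "a = 0" by (simp add: complex_eq_iff sum_squares_eq_zero_iff)
qed (simp add: linear_0[OF linear_line_foot])

lemma line_foot_inj: "line_foot \<xi> a = line_foot \<xi> b \<longleftrightarrow> a = b"
  using line_foot_eq_0[of \<xi> "a - b"] by (simp add: linear_diff[OF linear_line_foot])

text \<open>An injective linear map from the complex plane to the plane orthogonal to \<open>line_dir \<xi>\<close> is onto.\<close>

lemma line_foot_surj:
  assumes "line_dir \<xi> \<bullet> u = 0"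
  shows "\<exists>a. u = line_foot \<xi> a"
proof -
  have ne: "line_dir \<xi> \<noteq> 0" using line_dir_unit[of \<xi>] by auto
  have inj: "inj (line_foot \<xi>)" by (rule injI) (simp add: line_foot_inj)
  have "dim (range (line_foot \<xi>)) = 2"
    using dim_image_eq[OF linear_line_foot, of \<xi> UNIV] inj by simp
  then have "range (line_foot \<xi>) = {u. line_dir \<xi> \<bullet> u = 0}"
    using dim_hyperplane[OF ne]
    by (intro subspace_dim_equal linear_subspace_image[OF linear_line_foot subspace_UNIV] subspace_hyperplane)
      (auto simp: line_foot_perp)
  then show ?thesis using assms by blast
qed

lemma line_dir_third: "line_dir \<xi> $ 3 = 2 / stereo_denom \<xi> - 1"
proof -
  have n: "dir_z \<xi> = 2 - stereo_denom \<xi>" by (simp add: stereo_denom_def dir_z_def)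
  show ?thesis unfolding line_dir_real vector_3 n using stereo_denom_pos(2)[of \<xi>] by (simp add: diff_divide_distrib)
qed

lemma line_of_inj: "inj line_of"
proof (rule injI)
  fix z z' :: "complex \<times> complex" assume e: "line_of z = line_of z'"
  obtain \<xi> \<eta> \<xi>' \<eta>' where z: "z = (\<xi>, \<eta>)" "z' = (\<xi>', \<eta>')" by (cases z, cases z')
  have d: "line_dir \<xi> = line_dir \<xi>'" and f: "line_foot \<xi> \<eta> = line_foot \<xi>' \<eta>'"
    using e by (simp_all add: z line_of_def)
  have "2 / stereo_denom \<xi> = 2 / stereo_denom \<xi>'" using line_dir_third[of \<xi>] line_dir_third[of \<xi>'] d by simp
  then have c: "stereo_denom \<xi> = stereo_denom \<xi>'" using stereo_denom_pos(2)[of \<xi>] stereo_denom_pos(2)[of \<xi>'] by (simp add: field_simps)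
  have "line_dir \<xi> $ 1 = line_dir \<xi>' $ 1" "line_dir \<xi> $ 2 = line_dir \<xi>' $ 2" using d by simp_all
  then have "\<xi> = \<xi>'" using stereo_denom_pos(2)[of \<xi>'] by (simp add: line_dir_real c complex_eq_iff)
  then show "z = z'" using f by (simp add: z line_foot_inj)
qed

lemma line_of_surj:
  assumes v: "v \<bullet> v = 1" "v $ 3 \<noteq> - 1" and q: "v \<bullet> q = 0"
  shows "\<exists>\<xi> \<eta>. v = line_dir \<xi> \<and> q = line_foot \<xi> \<eta>"
proof -
  let ?k = "1 + v $ 3"
  have k: "?k \<noteq> 0" using v(2) by linarith
  define \<xi> where "\<xi> = Complex (v $ 1 / ?k) (v $ 2 / ?k)"
  have vv: "(v $ 1)\<^sup>2 + (v $ 2)\<^sup>2 = 1 - (v $ 3)\<^sup>2" using v(1) by (simp add: inner_vec_def sum_3 power2_eq_square)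
  have s: "(v $ 1 / ?k)\<^sup>2 + (v $ 2 / ?k)\<^sup>2 = (1 - v $ 3) / ?k"
  proof -
    have "(v $ 1 / ?k)\<^sup>2 + (v $ 2 / ?k)\<^sup>2 = (1 - (v $ 3)\<^sup>2) / ?k\<^sup>2"
      by (simp add: power_divide add_divide_distrib[symmetric] vv)
    also have "1 - (v $ 3)\<^sup>2 = (1 - v $ 3) * ?k" by (simp add: power2_eq_square algebra_simps)
    finally show ?thesis using k by (simp add: power2_eq_square)
  qed
  have c: "stereo_denom \<xi> = 2 / ?k"
  proof -
    have "stereo_denom \<xi> = 1 + (1 - v $ 3) / ?k" using s by (simp add: stereo_denom_def \<xi>_def add.assoc)
    then show ?thesis using k by (simp add: field_simps)
  qed
  have "line_dir \<xi> $ 3 = v $ 3" using k by (simp add: line_dir_third c field_simps)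
  moreover have "line_dir \<xi> $ 1 = v $ 1" "line_dir \<xi> $ 2 = v $ 2"
    using k unfolding line_dir_real c vector_3 by (simp_all add: \<xi>_def)
  ultimately have d: "v = line_dir \<xi>" by (simp add: vec_eq_iff forall_3)
  with line_foot_surj[of \<xi> q] q show ?thesis by auto
qed

text \<open>The tangent vectors of the tangent bundle of the sphere: the linearization of \<open>v \<bullet> v = 1\<close> and
\<open>v \<bullet> q = 0\<close>.\<close>

definition line_tangent :: "(real^3) \<times> (real^3) \<Rightarrow> (real^3) \<times> (real^3) \<Rightarrow> bool" where
  "line_tangent \<gamma> W \<longleftrightarrow> fst \<gamma> \<bullet> fst W = 0 \<and> fst \<gamma> \<bullet> snd W = - (snd \<gamma> \<bullet> fst W)"

text \<open>The vertical coordinate is shifted by the Christoffel symbol, so that \<open>b\<close> describes the covariant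
derivative of the foot point.\<close>

lemma line_tangent_coords:
  assumes "line_tangent (line_of (\<xi>, \<eta>)) W"
  shows "\<exists>a b. W = (line_foot \<xi> a, line_foot \<xi> b - (line_foot \<xi> \<eta> \<bullet> line_foot \<xi> a) *\<^sub>R line_dir \<xi>) \<and>
    line_dcoords (line_of (\<xi>, \<eta>)) W = (a, b + 2 * cnj \<xi> * a * \<eta> / of_real (stereo_denom \<xi>))"
proof -
  have l: "line_of (\<xi>, \<eta>) = (line_dir \<xi>, line_foot \<xi> \<eta>)" by (simp add: line_of_def)
  have t: "line_dir \<xi> \<bullet> fst W = 0" "line_dir \<xi> \<bullet> snd W = - (line_foot \<xi> \<eta> \<bullet> fst W)"
    using assms by (simp_all add: line_tangent_def l)
  obtain a where a: "fst W = line_foot \<xi> a" using line_foot_surj[OF t(1)] by blast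
  have "line_dir \<xi> \<bullet> (snd W + (line_foot \<xi> \<eta> \<bullet> fst W) *\<^sub>R line_dir \<xi>) = 0"
    using t(2) by (simp add: inner_add_right line_dir_unit)
  then obtain b where "snd W + (line_foot \<xi> \<eta> \<bullet> fst W) *\<^sub>R line_dir \<xi> = line_foot \<xi> b"
    using line_foot_surj by blast
  then have b: "snd W = line_foot \<xi> b - (line_foot \<xi> \<eta> \<bullet> line_foot \<xi> a) *\<^sub>R line_dir \<xi>"
    by (simp add: a eq_diff_eq)
  have W: "W = (line_foot \<xi> a, line_foot \<xi> b - (line_foot \<xi> \<eta> \<bullet> line_foot \<xi> a) *\<^sub>R line_dir \<xi>)"
    using a b by (simp add: prod_eq_iff)
  let ?b = "b + 2 * cnj \<xi> * a * \<eta> / of_real (stereo_denom \<xi>)"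
  have W': "W = line_of_deriv \<xi> \<eta> (a, ?b)" by (simp add: line_of_deriv_def W)
  have inj: "inj (line_of_deriv \<xi> \<eta>)"
  proof (rule injI)
    fix r s assume e: "line_of_deriv \<xi> \<eta> r = line_of_deriv \<xi> \<eta> s"
    have "fst r = fst s" using e by (cases r, cases s) (simp add: line_of_deriv_def line_foot_inj)
    then show "r = s" using e by (cases r, cases s) (simp add: line_of_deriv_def line_foot_inj)
  qed
  have "line_dcoords (line_of (\<xi>, \<eta>)) W = (a, ?b)"
    unfolding line_dcoords_def line_coords_def inv_f_f[OF line_of_inj] frechet_derivative_eq[OF line_of_has_derivative] W'
    by (rule inv_f_f[OF inj])
  with W show ?thesis by blast
qed

text \<open>After the shift of \<open>line_tangent_coords\<close>, the second term in the coordinate expression of the metric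
cancels. What remains is \<open>Im (cnj b * a)\<close>, the mixed product of \<open>v\<close>, \<open>dq\<close> and \<open>dv\<close>.\<close>

lemma chart_neutral_eq:
  assumes W: "line_tangent (line_of (\<xi>, \<eta>)) W\<^sub>1" "line_tangent (line_of (\<xi>, \<eta>)) W\<^sub>2"
  shows "chart_neutral (line_of (\<xi>, \<eta>)) W\<^sub>1 W\<^sub>2 =
    (line_dir \<xi> \<bullet> cross3 (snd W\<^sub>1) (fst W\<^sub>2) + line_dir \<xi> \<bullet> cross3 (snd W\<^sub>2) (fst W\<^sub>1)) / 4"
proof -
  obtain a1 b1 where 1: "W\<^sub>1 = (line_foot \<xi> a1, line_foot \<xi> b1 - (line_foot \<xi> \<eta> \<bullet> line_foot \<xi> a1) *\<^sub>R line_dir \<xi>)"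
    "line_dcoords (line_of (\<xi>, \<eta>)) W\<^sub>1 = (a1, b1 + 2 * cnj \<xi> * a1 * \<eta> / of_real (stereo_denom \<xi>))"
    using line_tangent_coords[OF W(1)] by blast
  obtain a2 b2 where 2: "W\<^sub>2 = (line_foot \<xi> a2, line_foot \<xi> b2 - (line_foot \<xi> \<eta> \<bullet> line_foot \<xi> a2) *\<^sub>R line_dir \<xi>)"
    "line_dcoords (line_of (\<xi>, \<eta>)) W\<^sub>2 = (a2, b2 + 2 * cnj \<xi> * a2 * \<eta> / of_real (stereo_denom \<xi>))"
    using line_tangent_coords[OF W(2)] by blast
  have cr: "line_dir \<xi> \<bullet> cross3 (line_foot \<xi> b - k *\<^sub>R line_dir \<xi>) (line_foot \<xi> a)
      = 4 / (stereo_denom \<xi>)\<^sup>2 * Im (cnj b * a)" for a b k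
  proof -
    have "line_dir \<xi> \<bullet> cross3 (line_foot \<xi> b - k *\<^sub>R line_dir \<xi>) (line_foot \<xi> a)
        = cross3 (line_dir \<xi>) (line_foot \<xi> b - k *\<^sub>R line_dir \<xi>) \<bullet> line_foot \<xi> a"
      using cross_triple[of "line_dir \<xi>"] by (metis cross_triple inner_commute)
    also have "cross3 (line_dir \<xi>) (line_foot \<xi> b - k *\<^sub>R line_dir \<xi>) = line_foot \<xi> (\<i> * b)"
      by (simp add: Cross3.right_diff_distrib cross_mult_right line_dir_cross)
    finally show ?thesis by (simp add: line_foot_inner algebra_simps)
  qed
  define c where "c = 2 * cnj \<xi> * \<eta> / of_real (stereo_denom \<xi>)"
  have ab: "2 * cnj \<xi> * a * \<eta> / of_real (stereo_denom \<xi>) = c * a" for a by (simp add: c_def)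
  have d: "1 + (cmod \<xi>)\<^sup>2 = stereo_denom \<xi>" by (simp add: stereo_denom_def cmod_power2 add.assoc)
  have X: "Im ((cnj (b1 + c * a1) * a2 + cnj (b2 + c * a2) * a1) / 2 + c * ((a1 * cnj a2 + a2 * cnj a1) / 2))
      = (Im (cnj b1 * a2) + Im (cnj b2 * a1)) / 2"
    by (simp add: field_simps)
  have CN: "chart_neutral (line_of (\<xi>, \<eta>)) W\<^sub>1 W\<^sub>2 = 2 / (stereo_denom \<xi>)\<^sup>2 * ((Im (cnj b1 * a2) + Im (cnj b2 * a1)) / 2)"
    unfolding chart_neutral_def 1(2) 2(2) line_coords_def inv_f_f[OF line_of_inj] ab coord_neutral_def prod.case d c_def[symmetric] X ..
  have "(line_dir \<xi> \<bullet> cross3 (snd W\<^sub>1) (fst W\<^sub>2) + line_dir \<xi> \<bullet> cross3 (snd W\<^sub>2) (fst W\<^sub>1)) / 4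
      = (4 / (stereo_denom \<xi>)\<^sup>2 * Im (cnj b1 * a2) + 4 / (stereo_denom \<xi>)\<^sup>2 * Im (cnj b2 * a1)) / 4"
    unfolding 1(1) 2(1) fst_conv snd_conv cr ..
  also have "\<dots> = 2 / (stereo_denom \<xi>)\<^sup>2 * ((Im (cnj b1 * a2) + Im (cnj b2 * a1)) / 2)"
  proof -
    have "(4 / d * x + 4 / d * y) / 4 = 2 / d * ((x + y) / 2)" for d x y :: real
      by (simp add: add_divide_distrib distrib_left)
    then show ?thesis .
  qed
  finally show ?thesis unfolding CN ..
qed

text \<open>The shift of \<open>line_tangent_coords\<close> is complex linear, so multiplication by \<open>\<i>\<close> in the chart rotates
\<open>dv\<close> and the part of \<open>dq\<close> orthogonal to \<open>v\<close>; the part along \<open>v\<close> is forced by tangency.\<close>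

lemma chart_cx_eq:
  assumes W: "line_tangent (line_of (\<xi>, \<eta>)) W"
  shows "chart_cx (line_of (\<xi>, \<eta>)) W = (cross3 (line_dir \<xi>) (fst W),
    cross3 (line_dir \<xi>) (snd W) - (line_foot \<xi> \<eta> \<bullet> cross3 (line_dir \<xi>) (fst W)) *\<^sub>R line_dir \<xi>)"
proof -
  obtain a b where 1: "W = (line_foot \<xi> a, line_foot \<xi> b - (line_foot \<xi> \<eta> \<bullet> line_foot \<xi> a) *\<^sub>R line_dir \<xi>)"
    "line_dcoords (line_of (\<xi>, \<eta>)) W = (a, b + 2 * cnj \<xi> * a * \<eta> / of_real (stereo_denom \<xi>))"
    using line_tangent_coords[OF W] by blast
  have "\<i> * (b + 2 * cnj \<xi> * a * \<eta> / of_real (stereo_denom \<xi>)) - 2 * cnj \<xi> * (\<i> * a) * \<eta> / of_real (stereo_denom \<xi>) = \<i> * b"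
    by (simp add: distrib_left)
  then show ?thesis
    unfolding chart_cx_def 1(2) line_coords_def inv_f_f[OF line_of_inj] frechet_derivative_eq[OF line_of_has_derivative]
    by (simp add: line_of_deriv_def 1(1) Cross3.right_diff_distrib cross_mult_right line_dir_cross)
qed

lemma half_turn_props:
  "half_turn x \<bullet> half_turn y = x \<bullet> y" "half_turn (half_turn x) = x"
  "cross3 (half_turn x) (half_turn y) = half_turn (cross3 x y)"
  "half_turn (x - y) = half_turn x - half_turn y" "half_turn (k *\<^sub>R x) = k *\<^sub>R half_turn x"
  by (simp_all add: half_turn_def inner_vec_def sum_3 vec_eq_iff forall_3 cross3_def)

text \<open>The formulas obtained in the chart are invariant under rotations, so they also hold at the direction
missed by the chart, where the structures are defined by a half turn.\<close>

lemma flat_structures: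
  assumes v: "v \<bullet> v = 1" and q: "v \<bullet> q = 0"
    and W: "line_tangent (v, q) W\<^sub>1" "line_tangent (v, q) W\<^sub>2"
  shows "flat_neutral (v, q) W\<^sub>1 W\<^sub>2 = (v \<bullet> cross3 (snd W\<^sub>1) (fst W\<^sub>2) + v \<bullet> cross3 (snd W\<^sub>2) (fst W\<^sub>1)) / 4"
    and "flat_cx (v, q) W\<^sub>1 = (cross3 v (fst W\<^sub>1), cross3 v (snd W\<^sub>1) - (q \<bullet> cross3 v (fst W\<^sub>1)) *\<^sub>R v)"
proof -
  have chart: "chart_neutral (v, q) W\<^sub>1 W\<^sub>2 = (v \<bullet> cross3 (snd W\<^sub>1) (fst W\<^sub>2) + v \<bullet> cross3 (snd W\<^sub>2) (fst W\<^sub>1)) / 4 \<and>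
      chart_cx (v, q) W\<^sub>1 = (cross3 v (fst W\<^sub>1), cross3 v (snd W\<^sub>1) - (q \<bullet> cross3 v (fst W\<^sub>1)) *\<^sub>R v)"
    if v: "v \<bullet> v = 1" "v $ 3 \<noteq> - 1" and q: "v \<bullet> q = 0" and W: "line_tangent (v, q) W\<^sub>1" "line_tangent (v, q) W\<^sub>2"
    for v q W\<^sub>1 W\<^sub>2
  proof -
    obtain \<xi> \<eta> where e: "v = line_dir \<xi>" "q = line_foot \<xi> \<eta>" using line_of_surj[OF v q] by blast
    then have l: "(v, q) = line_of (\<xi>, \<eta>)" by (simp add: line_of_def)
    show ?thesis
      using chart_neutral_eq[OF W[unfolded l]] chart_cx_eq[OF W(1)[unfolded l]] unfolding l[symmetric] e[symmetric] by blast
  qed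
  show "flat_neutral (v, q) W\<^sub>1 W\<^sub>2 = (v \<bullet> cross3 (snd W\<^sub>1) (fst W\<^sub>2) + v \<bullet> cross3 (snd W\<^sub>2) (fst W\<^sub>1)) / 4"
    "flat_cx (v, q) W\<^sub>1 = (cross3 v (fst W\<^sub>1), cross3 v (snd W\<^sub>1) - (q \<bullet> cross3 v (fst W\<^sub>1)) *\<^sub>R v)"
  proof (atomize (full), cases "v $ 3 = - 1")
    case False
    then show "flat_neutral (v, q) W\<^sub>1 W\<^sub>2 = (v \<bullet> cross3 (snd W\<^sub>1) (fst W\<^sub>2) + v \<bullet> cross3 (snd W\<^sub>2) (fst W\<^sub>1)) / 4 \<and>
      flat_cx (v, q) W\<^sub>1 = (cross3 v (fst W\<^sub>1), cross3 v (snd W\<^sub>1) - (q \<bullet> cross3 v (fst W\<^sub>1)) *\<^sub>R v)"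
      using chart[OF v False q W] by (simp add: flat_neutral_def flat_cx_def)
  next
    case True
    let ?h = half_turn
    have "?h v $ 3 \<noteq> - 1" using True by (simp add: half_turn_def)
    moreover have "line_tangent (?h v, ?h q) (?h (fst W), ?h (snd W))" if "line_tangent (v, q) W" for W
      using that by (simp add: line_tangent_def half_turn_props)
    ultimately have "chart_neutral (?h v, ?h q) (?h (fst W\<^sub>1), ?h (snd W\<^sub>1)) (?h (fst W\<^sub>2), ?h (snd W\<^sub>2)) =
        (v \<bullet> cross3 (snd W\<^sub>1) (fst W\<^sub>2) + v \<bullet> cross3 (snd W\<^sub>2) (fst W\<^sub>1)) / 4 \<and>
      chart_cx (?h v, ?h q) (?h (fst W\<^sub>1), ?h (snd W\<^sub>1)) =
        (?h (cross3 v (fst W\<^sub>1)), ?h (cross3 v (snd W\<^sub>1) - (q \<bullet> cross3 v (fst W\<^sub>1)) *\<^sub>R v))"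
      using chart[of "?h v" "?h q" "(?h (fst W\<^sub>1), ?h (snd W\<^sub>1))" "(?h (fst W\<^sub>2), ?h (snd W\<^sub>2))"] v q W
      by (simp add: half_turn_props)
    then show "flat_neutral (v, q) W\<^sub>1 W\<^sub>2 = (v \<bullet> cross3 (snd W\<^sub>1) (fst W\<^sub>2) + v \<bullet> cross3 (snd W\<^sub>2) (fst W\<^sub>1)) / 4 \<and>
      flat_cx (v, q) W\<^sub>1 = (cross3 v (fst W\<^sub>1), cross3 v (snd W\<^sub>1) - (q \<bullet> cross3 v (fst W\<^sub>1)) *\<^sub>R v)"
      using True by (simp add: flat_neutral_def flat_cx_def line_half_turn_def map_prod_def case_prod_beta half_turn_props)
  qed
qed

text \<open>Derivative of \<open>(p, v) \<mapsto> (v, p - \<langle>p, v\<rangle> v)\<close>.\<close>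

definition line_deriv :: "real^3 \<Rightarrow> real^3 \<Rightarrow> real^3 \<Rightarrow> real^3 \<Rightarrow> (real^3) \<times> (real^3)" where
  "line_deriv p v x y = (y, x - ((x \<bullet> v + p \<bullet> y) *\<^sub>R v + (p \<bullet> v) *\<^sub>R y))"

lemma line_deriv_fst: "fst (line_deriv p v x y) = y"
  by (simp add: line_deriv_def)

lemma flat_space_simps:
  "carrier_set flat_space = UNIV" "metric flat_space = inner" "geod flat_space p v = (v, p - (p \<bullet> v) *\<^sub>R v)"
  "neutral flat_space = flat_neutral" "alpha_cx flat_space = flat_cx"
  by (simp_all add: flat_space_def)

lemma flat_geodesic_space: "geodesic_space flat_space 0 (\<lambda>Q. fst (fst Q)) line_deriv"
proof (rule geodesic_space.intro)
  show "bounded_bilinear (metric flat_space)" by (simp add: flat_space_simps bounded_bilinear_inner)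
  show "metric flat_space x y = metric flat_space y x" for x y by (simp add: flat_space_simps inner_commute)
  note f = smooth_on_fst[OF open_UNIV smooth_on_ident[OF open_UNIV]]
    and s = smooth_on_snd[OF open_UNIV smooth_on_ident[OF open_UNIV]]
  show "smooth_on (\<lambda>(p, v). geod flat_space p v) UNIV"
    unfolding flat_space_simps case_prod_beta
    by (rule smooth_on_Pair[OF open_UNIV s smooth_on_diff[OF open_UNIV f
          smooth_on_scaleR[OF open_UNIV smooth_on_bilinear[OF open_UNIV bounded_bilinear_inner f s] s]]])
  show "((\<lambda>(p, v). geod flat_space p v) has_derivative (\<lambda>(x, y). line_deriv p v x y)) (at (p, v))" for p v
    unfolding flat_space_simps case_prod_beta line_deriv_def
    by (auto intro!: derivative_eq_intros simp: fun_eq_iff inner_commute algebra_simps)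
  show "smooth_on (\<lambda>Q. fst (fst Q)) UNIV" by (rule smooth_on_fst[OF open_UNIV f])
qed (simp_all add: flat_space_simps)

lemma flat_neutral_space: "neutral_space flat_space 0 (\<lambda>Q. fst (fst Q)) line_deriv"
proof (intro neutral_space.intro neutral_space_axioms.intro)
  show "geodesic_space flat_space 0 (\<lambda>Q. fst (fst Q)) line_deriv" by (rule flat_geodesic_space)
  fix p v w n :: "real^3" assume "geodesic_space.frame flat_space 0 p v w n"
  then have f: "v \<bullet> v = 1" "w \<bullet> w = 1" "n \<bullet> n = 1" "v \<bullet> w = 0" "v \<bullet> n = 0" "w \<bullet> n = 0"
    "w \<bullet> v = 0" "n \<bullet> v = 0" "n \<bullet> w = 0"
    unfolding geodesic_space.frame_def[OF flat_geodesic_space] by (simp_all add: flat_space_simps inner_commute)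
  define k where "k = v \<bullet> cross3 w n"
  have ex: "z = (z \<bullet> v) *\<^sub>R v + (z \<bullet> w) *\<^sub>R w + (z \<bullet> n) *\<^sub>R n" for z
    using geodesic_space.frame_expand[OF flat_geodesic_space \<open>geodesic_space.frame flat_space 0 p v w n\<close>, of z]
    by (simp add: flat_space_simps)
  have vw: "cross3 v w = k *\<^sub>R n"
    using ex[of "cross3 v w"] by (simp add: dot_cross_self k_def) (metis cross_triple inner_commute)
  have vn: "cross3 v n = - k *\<^sub>R w"
  proof -
    have "cross3 v n \<bullet> w = - k" unfolding k_def by (metis cross_skew cross_triple inner_commute inner_minus_right)
    then show ?thesis using ex[of "cross3 v n"] by (simp add: dot_cross_self)
  qed
  have k0: "k \<noteq> 0"
  proof
    assume "k = 0"
    then have "(norm (cross3 v w))\<^sup>2 = 0" using vw by simp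
    then show False using norm_cross_dot[of v w] f by (simp add: dot_square_norm[symmetric] power_mult_distrib)
  qed
  have q: "v \<bullet> (p - (p \<bullet> v) *\<^sub>R v) = 0" by (simp add: inner_diff_right f inner_commute)
  have T: "line_tangent (v, p - (p \<bullet> v) *\<^sub>R v) (line_deriv p v x y)" if "v \<bullet> y = 0" for x y
    using that by (simp add: line_tangent_def line_deriv_def inner_diff_left inner_diff_right inner_add_right f inner_commute algebra_simps)
  have y: "v \<bullet> (t *\<^sub>R w + h *\<^sub>R n - (0 * a) *\<^sub>R p) = 0" for t h a by (simp add: inner_add_right f)
  show "\<exists>\<kappa>. \<kappa> \<noteq> 0 \<and> (\<forall>a1 b1 t1 h1 a2 b2 t2 h2. neutral flat_space (geod flat_space p v)
        (line_deriv p v (a1 *\<^sub>R v + b1 *\<^sub>R w) (t1 *\<^sub>R w + h1 *\<^sub>R n - (0 * a1) *\<^sub>R p))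
        (line_deriv p v (a2 *\<^sub>R v + b2 *\<^sub>R w) (t2 *\<^sub>R w + h2 *\<^sub>R n - (0 * a2) *\<^sub>R p)) = \<kappa> * (b1 * h2 + b2 * h1))"
  proof (intro exI[of _ "k / 4"] conjI allI)
    fix a1 b1 t1 h1 a2 b2 t2 h2 :: real
    have cr: "v \<bullet> cross3 (snd (line_deriv p v (a *\<^sub>R v + b *\<^sub>R w) (t *\<^sub>R w + h *\<^sub>R n))) (t' *\<^sub>R w + h' *\<^sub>R n)
       = k * (b * h') - k * (p \<bullet> v) * (t * h' - h * t')" for a b t h t' h'
    proof -
      have "v \<bullet> cross3 x z = cross3 v x \<bullet> z" for x z by (metis cross_triple inner_commute)
      then show ?thesis
        by (simp add: line_deriv_def Cross3.right_diff_distrib cross_add_right cross_mult_right vw vn inner_add_left inner_add_right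
            inner_diff_left f algebra_simps)
    qed
    show "neutral flat_space (geod flat_space p v)
        (line_deriv p v (a1 *\<^sub>R v + b1 *\<^sub>R w) (t1 *\<^sub>R w + h1 *\<^sub>R n - (0 * a1) *\<^sub>R p))
        (line_deriv p v (a2 *\<^sub>R v + b2 *\<^sub>R w) (t2 *\<^sub>R w + h2 *\<^sub>R n - (0 * a2) *\<^sub>R p)) = k / 4 * (b1 * h2 + b2 * h1)"
      unfolding flat_space_simps flat_structures(1)[OF f(1) q T[OF y] T[OF y]]
      using cr[of a1 b1 t1 h1 t2 h2] cr[of a2 b2 t2 h2 t1 h1] by (simp add: line_deriv_fst algebra_simps)
  qed (use k0 in simp)
  show "\<exists>s. s \<noteq> 0 \<and> (\<forall>a t h. alpha_cx flat_space (geod flat_space p v) (line_deriv p v (a *\<^sub>R v) (t *\<^sub>R w + h *\<^sub>R n - (0 * a) *\<^sub>R p))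
        = line_deriv p v 0 (s *\<^sub>R (t *\<^sub>R n - h *\<^sub>R w)))"
  proof (intro exI[of _ k] conjI k0 allI)
    fix a t h
    show "alpha_cx flat_space (geod flat_space p v) (line_deriv p v (a *\<^sub>R v) (t *\<^sub>R w + h *\<^sub>R n - (0 * a) *\<^sub>R p))
        = line_deriv p v 0 (k *\<^sub>R (t *\<^sub>R n - h *\<^sub>R w))"
      unfolding flat_space_simps flat_structures(2)[OF f(1) q T[OF y] T[OF y]]
      by (simp add: line_deriv_def Cross3.right_diff_distrib cross_add_right cross_mult_right vw vn
          inner_add_right inner_diff_left inner_diff_right f algebra_simps)
  qed
  show "line_deriv p v (a *\<^sub>R v) (t *\<^sub>R w + h *\<^sub>R n - (0 * a) *\<^sub>R p) = line_deriv p v 0 (t *\<^sub>R w + h *\<^sub>R n)" for a t h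
    by (simp add: line_deriv_def f algebra_simps)
qed

section \<open>The tangent hypersurface of a strictly convex sphere\<close>

theorem (in neutral_space) tangent_hypersurface_theorem:
  assumes S: "smooth_strictly_convex_sphere F S"
  shows "let H = tangent_hypersurface F S in
        contact_structure H (alpha_plane F S) \<and>
        contact_structure H (beta_plane F S) \<and>
        (\<forall>C. knot F S C \<longrightarrow>
          (legendrian (alpha_plane F S) C \<longleftrightarrow> tangent_to_contact_curve F S C)) \<and>
        (\<forall>C. knot F S C \<longrightarrow>
          (let i = legendrian (beta_plane F S) C;
               ii = normal_to_contact_curve F S C UNIV;
               iii = line_of_curvature F S (snd \<circ> C) \<or> umbilic_along F S (snd \<circ> C)
           in (i \<and> ii \<longrightarrow> iii) \<and> (i \<and> iii \<longrightarrow> ii) \<and> (ii \<and> iii \<longrightarrow> i))) \<and>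
        (\<forall>R C I. quarter_turn F S R \<and> open I \<and> is_interval I \<and> reeb_integral_curve F S R C I \<longrightarrow>
          geodesic_of F S (snd \<circ> C) I \<and> normal_to_contact_curve F S C I)"
proof -
  obtain \<nu> where "unit_normal_field F S \<nu>"
    "\<And>p. p \<in> S \<Longrightarrow> \<exists>k\<^sub>1 k\<^sub>2. principal_curvatures F S \<nu> p k\<^sub>1 k\<^sub>2 \<and> 0 < k\<^sub>1 * k\<^sub>2"
    using S unfolding smooth_strictly_convex_sphere_def strictly_convex_def by blast
  then interpret convex_surface_neutral F K D dgeod S \<nu>
    using S by unfold_locales (simp_all add: smooth_strictly_convex_sphere_def)
  show ?thesis
    unfolding Let_def
  proof (intro conjI allI impI)
    show "contact_structure H (alpha_plane F S)" "contact_structure H (beta_plane F S)"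
      by (fact contact_alpha contact_beta)+
  next
    fix C assume C: "knot F S C"
    show "legendrian (alpha_plane F S) C \<longleftrightarrow> tangent_to_contact_curve F S C"
      by (rule alpha_legendrian[OF C])
    note two = beta_legendrian_two_of_three[OF C]
    show "line_of_curvature F S (snd \<circ> C) \<or> umbilic_along F S (snd \<circ> C)"
      if "legendrian (beta_plane F S) C \<and> normal_to_contact_curve F S C UNIV"
      by (rule two(1)[OF conjunct1[OF that] conjunct2[OF that]])
    show "normal_to_contact_curve F S C UNIV"
      if "legendrian (beta_plane F S) C \<and> (line_of_curvature F S (snd \<circ> C) \<or> umbilic_along F S (snd \<circ> C))"
      by (rule two(2)[OF conjunct1[OF that] conjunct2[OF that]])
    show "legendrian (beta_plane F S) C"
      if "normal_to_contact_curve F S C UNIV \<and> (line_of_curvature F S (snd \<circ> C) \<or> umbilic_along F S (snd \<circ> C))"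
      by (rule two(3)[OF conjunct1[OF that] conjunct2[OF that]])
  next
    fix R C I assume "quarter_turn F S R \<and> open I \<and> is_interval I \<and> reeb_integral_curve F S R C I"
    then have "quarter_turn F S R" "open I" "reeb_integral_curve F S R C I" by auto
    note reeb = reeb_curves[OF this]
    show "geodesic_of F S (snd \<circ> C) I" "normal_to_contact_curve F S C I" by (fact reeb)+
  qed
qed

theorem theorem2:
  shows "(\<forall>S. smooth_strictly_convex_sphere flat_space S \<longrightarrow>
      (let F = flat_space; H = tangent_hypersurface F S in
        contact_structure H (alpha_plane F S) \<and>
        contact_structure H (beta_plane F S) \<and>
        (\<forall>C. knot F S C \<longrightarrow>
          (legendrian (alpha_plane F S) C \<longleftrightarrow> tangent_to_contact_curve F S C)) \<and>
        (\<forall>C. knot F S C \<longrightarrow>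
          (let i = legendrian (beta_plane F S) C;
               ii = normal_to_contact_curve F S C UNIV;
               iii = line_of_curvature F S (snd \<circ> C) \<or> umbilic_along F S (snd \<circ> C)
           in (i \<and> ii \<longrightarrow> iii) \<and> (i \<and> iii \<longrightarrow> ii) \<and> (ii \<and> iii \<longrightarrow> i))) \<and>
        (\<forall>R C I. quarter_turn F S R \<and> open I \<and> is_interval I \<and> reeb_integral_curve F S R C I \<longrightarrow>
          geodesic_of F S (snd \<circ> C) I \<and> normal_to_contact_curve F S C I)))
    \<and> (\<forall>\<epsilon>\<in>{1, - 1}. \<forall>S. smooth_strictly_convex_sphere (curved_space \<epsilon>) S \<longrightarrow>
      (let F = curved_space \<epsilon>; H = tangent_hypersurface F S in
        contact_structure H (alpha_plane F S) \<and>
        contact_structure H (beta_plane F S) \<and>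
        (\<forall>C. knot F S C \<longrightarrow>
          (legendrian (alpha_plane F S) C \<longleftrightarrow> tangent_to_contact_curve F S C)) \<and>
        (\<forall>C. knot F S C \<longrightarrow>
          (let i = legendrian (beta_plane F S) C;
               ii = normal_to_contact_curve F S C UNIV;
               iii = line_of_curvature F S (snd \<circ> C) \<or> umbilic_along F S (snd \<circ> C)
           in (i \<and> ii \<longrightarrow> iii) \<and> (i \<and> iii \<longrightarrow> ii) \<and> (ii \<and> iii \<longrightarrow> i))) \<and>
        (\<forall>R C I. quarter_turn F S R \<and> open I \<and> is_interval I \<and> reeb_integral_curve F S R C I \<longrightarrow>
          geodesic_of F S (snd \<circ> C) I \<and> normal_to_contact_curve F S C I)))"
  unfolding Let_def
  by (rule conjI,
      rule allI, rule impI,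
      rule neutral_space.tangent_hypersurface_theorem[OF flat_neutral_space, unfolded Let_def], assumption,
      rule ballI, rule allI, rule impI,
      rule neutral_space.tangent_hypersurface_theorem[OF curved_neutral_space, unfolded Let_def], assumption+)

end
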